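(* Let $\Gamma$ be a subgroup of $G$ of type (O) with $\Gamma_\infty=\{\mathrm{id}\}$, and suppose that $\Gamma\smallsetminus\Gamma_\infty$ is of type (F). Then $$\mathcal F:=\bigcap_{g\in\Gamma\smallsetminus\Gamma_\infty}\mathrm{Ext}\, I(g)$$ is a fundamental region for $\Gamma$ in $D$.
   Context: **$J^2C$-module structures.** A $J^2C$-module structure is a triple $(C,V,J)$ of two finite-dimensional real inner product spaces $C,V$ and an $\mathbb R$-bilinear map $J\colon C\times V\to V$, written $J_\zeta v=\zeta v=J(\zeta,v)$, such that (1) there is $e\in C\smallsetminus\{0\}$ with $J(e,v)=v$ for all $v\in V$; (2) $|J(\zeta,v)|=|\zeta||v|$ for all $\zeta\in C$, $v\in V$; (3) $C(Cv)=Cv$ for all $v\in V$, where $Cv=\{\zeta v\mid\zeta\in C\}$ and $C(Cv)=\{\zeta(\eta v)\mid \zeta,\eta\in C\}$. If $V\neq\{0\}$, $e$ is unique and $|e|=1$; if $V=\{0\}$, a unit vector $e\in C$ is fixed as part of the data. Identify $\mathbb Re$ with $\mathbb R$ via $ae\mapsto a$, put $C'=e^\perp$, and for $\zeta=a+z$ with $a\in\mathbb R$, $z\in C'$ put $\mathrm{Re}\,\zeta=a$, $\mathrm{Im}\,\zeta=z$, $\overline\zeta=a-z$, and $\zeta^{-1}=|\zeta|^{-2}\overline\zeta$ if $\zeta\ne0$. The map $\beta_2\colon V\times V\to C$ is defined by $\langle\beta_2(v,u),\zeta\rangle=\langle\zeta u,v\rangle$ for all $\zeta\in C$; the bracket $[\cdot,\cdot]\colon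 V\times V\to C'$ by $\langle z,[x,y]\rangle=\langle J(z,x),y\rangle$ for all $z\in C'$. **The space $D$.** Fix a $J^2C$-module structure with $(C,V)\neq(\mathbb Re,\{0\})$. Let $S=\mathbb R^+\times C'\times V$ be the Lie group with product $(t_1,Z_1,X_1)(t_2,Z_2,X_2)=(t_1t_2,\,Z_1+t_1Z_2+\tfrac12t_1^{1/2}[X_1,X_2],\,X_1+t_1^{1/2}X_2)$ and the left-invariant Riemannian metric which at the identity $(1,0,0)$ is the standard inner product of $\mathbb R\oplus C'\oplus V$. Let $D=\{(\zeta,v)\in C\oplus V\mid \mathrm{Re}\,\zeta>\tfrac14|v|^2\}$ with the Riemannian metric making $S\to D$, $(t,Z,X)\mapsto(t+\tfrac14|X|^2+Z,X)$ an isometry. $D$ is a rank one Riemannian symmetric space of noncompact type. $G$ is the full group of Riemannian isometries of $D$; its action extends continuously to $\overline D^g=\{(\zeta,v)\in C\oplus V\mid\mathrm{Re}\,\zeta\geq\tfrac14|v|^2\}\cup\{\infty\}$, the closure of $D$ in the one-point compactification of $C\oplus V$. $G_\infty$ is the stabilizer of $\infty$ in $G$; for a subgroup $\Gamma$, $\Gamma_\infty=\Gamma\cap G_\infty$. **Subgroups.** $A=\{a_t\mid t>0\}$ with $a_t(\zeta,v)=(t\zeta,t^{1/2}v)$; $N=\{n_{(Z,X)}\mid Z\in C',X\in V\}$ with $n_{(Z,X)}(\zeta,v)=(\tfrac14|X|^2+Z+\zeta+\tfrac12\beta_2(v,X),X+v)$; $M$ is the group of pairs $(\varphi,\psi)$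 of orthogonal maps $\varphi\colon C\to C$, $\psi\colon V\to V$ with $\varphi(e)=e$ and $\psi(\zeta v)=\varphi(\zeta)\psi(v)$, acting by $(\varphi,\psi)(\zeta,v)=(\varphi(\zeta),\psi(v))$; all fix $\infty$. The geodesic inversion is $\sigma(\zeta,v)=(\zeta^{-1},-\zeta^{-1}v)$, $\sigma 0=\infty$, $\sigma\infty=0$. One has $G_\infty=MAN$, and each $g\in G\smallsetminus G_\infty$ is uniquely of the form $g=n_1\sigma ma_tn_2$ with $n_1,n_2\in N$, $m\in M$, $a_t\in A$. **Isometric spheres.** The height is $\mathrm{ht}(\zeta,v)=\mathrm{Re}\,\zeta-\tfrac14|v|^2$. The Cygan metric on $\overline D^g\smallsetminus\{\infty\}$ is, for $z_j=(\zeta_j,v_j)$, $\varrho(z_1,z_2)=\big|\tfrac14|v_1|^2+\tfrac14|v_2|^2+|\mathrm{ht}(z_1)-\mathrm{ht}(z_2)|+\mathrm{Im}\,\zeta_1-\mathrm{Im}\,\zeta_2-\tfrac12\beta_2(v_1,v_2)\big|^{1/2}$. For $g=n_1\sigma ma_tn_2\in G\smallsetminus G_\infty$ put $R(g)=t^{-1/4}$, and let $I(g)$, $\mathrm{Ext}\,I(g)$, $\mathrm{Int}\,I(g)$ be the sets of $z\in D$ with $\varrho(z,g^{-1}\infty)=R(g)$, $>R(g)$, $<R(g)$, respectively. **Types and fundamental regions.** A subgroup $\Gamma$ of $G$ is of type (O) if $\bigcap_{g\in\Gamma\smallsetminus\Gamma_\infty}\mathrm{Ext}\,I(g)=D\smallsetminus\overline{\bigcup_{g\in\Gamma\smallsetminus\Gamma_\infty}\mathrm{Int}\,I(g)}$.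 A subset $T\subseteq G$ is of type (F) if for each $z\in D$ the maximum of $\{\mathrm{ht}(gz)\mid g\in\langle T\rangle\}$ exists, where $\langle T\rangle$ is the subgroup generated by $T$. A fundamental region for a subgroup $\Gamma$ in $D$ is an open set $Y\subseteq D$ such that the translates of $Y$ by any two distinct elements of $\Gamma$ are disjoint and $D=\bigcup_{g\in\Gamma}g\overline Y$. Closures are taken in $D$; an intersection over the empty index set is $D$. *)

theory Defs
  imports "HOL-Analysis.Analysis" "HOL-Algebra.Bij" "HOL-Algebra.Generated_Groups"
begin

section \<open>Module structures\<close>

text \<open>
  The space \<open>C\<close> contains a nonzero vector, so it is rendered by a type of class
  \<open>euclidean_space\<close>.  The space \<open>V\<close> may be zero, which that class excludes; it is rendered by
  a type of class \<open>real_inner\<close> together with the requirement of a finite spanning set.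
\<close>

definition J2C_module ::
    "'c::euclidean_space \<Rightarrow> ('c \<Rightarrow> 'v::real_inner \<Rightarrow> 'v) \<Rightarrow> bool" where
  "J2C_module e J \<longleftrightarrow>
     (\<exists>B :: 'v set. finite B \<and> span B = UNIV) \<and>
     bilinear J \<and>
     e \<noteq> 0 \<and> (\<forall>v. J e v = v) \<and> ((UNIV :: 'v set) = {0} \<longrightarrow> norm e = 1) \<and>
     (\<forall>\<zeta> v. norm (J \<zeta> v) = norm \<zeta> * norm v) \<and>
     (\<forall>v. {J \<zeta> (J \<eta> v) | \<zeta> \<eta>. True} = {J \<zeta> v | \<zeta>. True})"

text \<open>
  In what follows \<open>e\<close> is the distinguished unit vector; a real number \<open>a\<close> is identified with
  \<open>a *\<^sub>R e\<close>.
\<close>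

definition C_prime :: "'c::euclidean_space \<Rightarrow> 'c set" where
  "C_prime e = {z. z \<bullet> e = 0}"

definition c_re :: "'c::euclidean_space \<Rightarrow> 'c \<Rightarrow> real" where
  "c_re e \<zeta> = \<zeta> \<bullet> e"

definition c_im :: "'c::euclidean_space \<Rightarrow> 'c \<Rightarrow> 'c" where
  "c_im e \<zeta> = \<zeta> - c_re e \<zeta> *\<^sub>R e"

definition c_conj :: "'c::euclidean_space \<Rightarrow> 'c \<Rightarrow> 'c" where
  "c_conj e \<zeta> = c_re e \<zeta> *\<^sub>R e - c_im e \<zeta>"

definition c_inv :: "'c::euclidean_space \<Rightarrow> 'c \<Rightarrow> 'c" where
  "c_inv e \<zeta> = (1 / (norm \<zeta>)\<^sup>2) *\<^sub>R c_conj e \<zeta>"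

definition beta2 ::
    "('c::euclidean_space \<Rightarrow> 'v::real_inner \<Rightarrow> 'v) \<Rightarrow> 'v \<Rightarrow> 'v \<Rightarrow> 'c" where
  "beta2 J v u = (THE b. \<forall>\<zeta>. b \<bullet> \<zeta> = J \<zeta> u \<bullet> v)"

definition bracket ::
    "'c::euclidean_space \<Rightarrow> ('c \<Rightarrow> 'v::real_inner \<Rightarrow> 'v) \<Rightarrow> 'v \<Rightarrow> 'v \<Rightarrow> 'c" where
  "bracket e J x y = (THE w. w \<in> C_prime e \<and> (\<forall>z\<in>C_prime e. z \<bullet> w = J z x \<bullet> y))"

section \<open>The Riemannian space D\<close>

definition S_carrier :: "'c::euclidean_space \<Rightarrow> (real \<times> 'c \<times> 'v::real_inner) set" where
  "S_carrier e = {(t, Z, X). 0 < t \<and> Z \<in> C_prime e}"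

definition S_mult ::
    "'c::euclidean_space \<Rightarrow> ('c \<Rightarrow> 'v::real_inner \<Rightarrow> 'v) \<Rightarrow>
     real \<times> 'c \<times> 'v \<Rightarrow> real \<times> 'c \<times> 'v \<Rightarrow> real \<times> 'c \<times> 'v" where
  "S_mult e J = (\<lambda>(t1, Z1, X1) (t2, Z2, X2).
     (t1 * t2,
      Z1 + t1 *\<^sub>R Z2 + (sqrt t1 / 2) *\<^sub>R bracket e J X1 X2,
      X1 + sqrt t1 *\<^sub>R X2))"

definition S_tangent :: "'c::euclidean_space \<Rightarrow> (real \<times> 'c \<times> 'v::real_inner) set" where
  "S_tangent e = {(\<tau>, Z, X). Z \<in> C_prime e}"

definition D_dom :: "'c::euclidean_space \<Rightarrow> ('c \<times> 'v::real_inner) set" where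
  "D_dom e = {(\<zeta>, v). c_re e \<zeta> > (norm v)\<^sup>2 / 4}"

definition S_to_D ::
    "'c::euclidean_space \<Rightarrow> real \<times> 'c \<times> 'v::real_inner \<Rightarrow> 'c \<times> 'v" where
  "S_to_D e = (\<lambda>(t, Z, X). ((t + (norm X)\<^sup>2 / 4) *\<^sub>R e + Z, X))"

text \<open>
  For \<open>s\<close> in \<open>S\<close>, \<open>D_frame e J s\<close> restricted to \<open>S_tangent e\<close> is the differential at the
  identity \<open>(1, 0, 0)\<close> of left translation by \<open>s\<close> followed by \<open>S_to_D e\<close>.  The metric on \<open>D\<close>
  is the one for which all these differentials are linear isometries from \<open>S_tangent e\<close> with the
  standard inner product; equivalently, it corresponds under \<open>S_to_D e\<close> to the left-invariant
  metric on \<open>S\<close> that is standard at the identity.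
\<close>

definition D_frame ::
    "'c::euclidean_space \<Rightarrow> ('c \<Rightarrow> 'v::real_inner \<Rightarrow> 'v) \<Rightarrow>
     real \<times> 'c \<times> 'v \<Rightarrow> real \<times> 'c \<times> 'v \<Rightarrow> 'c \<times> 'v" where
  "D_frame e J s = frechet_derivative (S_to_D e \<circ> S_mult e J s) (at (1, 0, 0))"

definition D_metric ::
    "'c::euclidean_space \<Rightarrow> ('c \<Rightarrow> 'v::real_inner \<Rightarrow> 'v) \<Rightarrow>
     'c \<times> 'v \<Rightarrow> 'c \<times> 'v \<Rightarrow> 'c \<times> 'v \<Rightarrow> real" where
  "D_metric e J z \<xi> \<eta> =
     (let s = inv_into (S_carrier e) (S_to_D e) z;
          F = inv_into (S_tangent e) (D_frame e J s)
      in F \<xi> \<bullet> F \<eta>)"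

text \<open>Continuous differentiability of order \<open>k\<close>, for functions on an open set.\<close>

primrec Ck_on ::
    "nat \<Rightarrow> ('a::real_normed_vector \<Rightarrow> 'b::real_normed_vector) \<Rightarrow> 'a set \<Rightarrow> bool" where
  "Ck_on 0 f U \<longleftrightarrow> continuous_on U f"
| "Ck_on (Suc k) f U \<longleftrightarrow>
     (\<forall>x\<in>U. f differentiable (at x)) \<and>
     (\<forall>h. Ck_on k (\<lambda>x. frechet_derivative f (at x) h) U)"

definition smooth_on ::
    "('a::real_normed_vector \<Rightarrow> 'b::real_normed_vector) \<Rightarrow> 'a set \<Rightarrow> bool" where
  "smooth_on f U \<longleftrightarrow> (\<forall>k. Ck_on k f U)"

definition D_isometries ::
    "'c::euclidean_space \<Rightarrow> ('c \<Rightarrow> 'v::real_inner \<Rightarrow> 'v) \<Rightarrow>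
     ('c \<times> 'v \<Rightarrow> 'c \<times> 'v) set" where
  "D_isometries e J = {g \<in> Bij (D_dom e).
     smooth_on g (D_dom e) \<and> smooth_on (inv_into (D_dom e) g) (D_dom e) \<and>
     (\<forall>z\<in>D_dom e. \<forall>\<xi> \<eta>.
        D_metric e J (g z) (frechet_derivative g (at z) \<xi>) (frechet_derivative g (at z) \<eta>)
        = D_metric e J z \<xi> \<eta>)}"

definition G_grp ::
    "'c::euclidean_space \<Rightarrow> ('c \<Rightarrow> 'v::real_inner \<Rightarrow> 'v) \<Rightarrow>
     ('c \<times> 'v \<Rightarrow> 'c \<times> 'v) monoid" where
  "G_grp e J = (BijGroup (D_dom e))\<lparr>carrier := D_isometries e J\<rparr>"

section \<open>The boundary action\<close>

text \<open>The point at infinity is \<open>None\<close>.\<close>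

definition D_bar :: "'c::euclidean_space \<Rightarrow> ('c \<times> 'v::real_inner) option set" where
  "D_bar e = insert None (Some ` {(\<zeta>, v). c_re e \<zeta> \<ge> (norm v)\<^sup>2 / 4})"

definition D_bar_top :: "'c::euclidean_space \<Rightarrow> ('c \<times> 'v::real_inner) option topology" where
  "D_bar_top e = subtopology (Alexandroff_compactification euclidean) (D_bar e)"

definition bar_ext ::
    "'c::euclidean_space \<Rightarrow> ('c \<times> 'v::real_inner \<Rightarrow> 'c \<times> 'v) \<Rightarrow>
     ('c \<times> 'v) option \<Rightarrow> ('c \<times> 'v) option" where
  "bar_ext e g = (THE h. h \<in> extensional (D_bar e) \<and>
     continuous_map (D_bar_top e) (D_bar_top e) h \<and> (\<forall>z\<in>D_dom e. h (Some z) = Some (g z)))"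

definition G_inf ::
    "'c::euclidean_space \<Rightarrow> ('c \<Rightarrow> 'v::real_inner \<Rightarrow> 'v) \<Rightarrow>
     ('c \<times> 'v \<Rightarrow> 'c \<times> 'v) set" where
  "G_inf e J = {g \<in> carrier (G_grp e J). bar_ext e g None = None}"

definition stab_inf ::
    "'c::euclidean_space \<Rightarrow> ('c \<Rightarrow> 'v::real_inner \<Rightarrow> 'v) \<Rightarrow>
     ('c \<times> 'v \<Rightarrow> 'c \<times> 'v) set \<Rightarrow> ('c \<times> 'v \<Rightarrow> 'c \<times> 'v) set" where
  "stab_inf e J \<Gamma> = \<Gamma> \<inter> G_inf e J"

section \<open>Distinguished isometries\<close>

definition a_elt ::
    "'c::euclidean_space \<Rightarrow> real \<Rightarrow> 'c \<times> 'v::real_inner \<Rightarrow> 'c \<times> 'v" where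
  "a_elt e t = (\<lambda>(\<zeta>, v)\<in>D_dom e. (t *\<^sub>R \<zeta>, sqrt t *\<^sub>R v))"

definition n_elt ::
    "'c::euclidean_space \<Rightarrow> ('c \<Rightarrow> 'v::real_inner \<Rightarrow> 'v) \<Rightarrow> 'c \<Rightarrow> 'v \<Rightarrow>
     'c \<times> 'v \<Rightarrow> 'c \<times> 'v" where
  "n_elt e J Z X =
     (\<lambda>(\<zeta>, v)\<in>D_dom e. (((norm X)\<^sup>2 / 4) *\<^sub>R e + Z + \<zeta> + (1/2) *\<^sub>R beta2 J v X, X + v))"

definition N_grp ::
    "'c::euclidean_space \<Rightarrow> ('c \<Rightarrow> 'v::real_inner \<Rightarrow> 'v) \<Rightarrow>
     ('c \<times> 'v \<Rightarrow> 'c \<times> 'v) set" where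
  "N_grp e J = {n_elt e J Z X | Z X. Z \<in> C_prime e}"

definition M_grp ::
    "'c::euclidean_space \<Rightarrow> ('c \<Rightarrow> 'v::real_inner \<Rightarrow> 'v) \<Rightarrow>
     ('c \<times> 'v \<Rightarrow> 'c \<times> 'v) set" where
  "M_grp e J = {(\<lambda>(\<zeta>, v)\<in>D_dom e. (\<phi> \<zeta>, \<psi> v)) | \<phi> \<psi>.
     orthogonal_transformation \<phi> \<and> orthogonal_transformation \<psi> \<and> \<phi> e = e \<and>
     (\<forall>\<zeta> v. \<psi> (J \<zeta> v) = J (\<phi> \<zeta>) (\<psi> v))}"

definition geod_inversion ::
    "'c::euclidean_space \<Rightarrow> ('c \<Rightarrow> 'v::real_inner \<Rightarrow> 'v) \<Rightarrow> 'c \<times> 'v \<Rightarrow> 'c \<times> 'v" where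
  "geod_inversion e J = (\<lambda>(\<zeta>, v)\<in>D_dom e. (c_inv e \<zeta>, - J (c_inv e \<zeta>) v))"

section \<open>Isometric spheres\<close>

definition ht :: "'c::euclidean_space \<Rightarrow> 'c \<times> 'v::real_inner \<Rightarrow> real" where
  "ht e = (\<lambda>(\<zeta>, v). c_re e \<zeta> - (norm v)\<^sup>2 / 4)"

definition cygan ::
    "'c::euclidean_space \<Rightarrow> ('c \<Rightarrow> 'v::real_inner \<Rightarrow> 'v) \<Rightarrow>
     'c \<times> 'v \<Rightarrow> 'c \<times> 'v \<Rightarrow> real" where
  "cygan e J = (\<lambda>(\<zeta>1, v1) (\<zeta>2, v2). sqrt (norm (
     ((norm v1)\<^sup>2 / 4 + (norm v2)\<^sup>2 / 4 + \<bar>ht e (\<zeta>1, v1) - ht e (\<zeta>2, v2)\<bar>) *\<^sub>R e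
     + c_im e \<zeta>1 - c_im e \<zeta>2 - (1/2) *\<^sub>R beta2 J v1 v2)))"

text \<open>The parameter \<open>t\<close> in the decomposition \<open>g = n1 \<sigma> m a_t n2\<close> of an element not fixing infinity.\<close>

definition dilation ::
    "'c::euclidean_space \<Rightarrow> ('c \<Rightarrow> 'v::real_inner \<Rightarrow> 'v) \<Rightarrow>
     ('c \<times> 'v \<Rightarrow> 'c \<times> 'v) \<Rightarrow> real" where
  "dilation e J g = (THE t. 0 < t \<and> (\<exists>n1\<in>N_grp e J. \<exists>m\<in>M_grp e J. \<exists>n2\<in>N_grp e J.
     g = n1 \<otimes>\<^bsub>G_grp e J\<^esub> geod_inversion e J \<otimes>\<^bsub>G_grp e J\<^esub> m \<otimes>\<^bsub>G_grp e J\<^esub> a_elt e t \<otimes>\<^bsub>G_grp e J\<^esub> n2))"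

definition iso_radius ::
    "'c::euclidean_space \<Rightarrow> ('c \<Rightarrow> 'v::real_inner \<Rightarrow> 'v) \<Rightarrow>
     ('c \<times> 'v \<Rightarrow> 'c \<times> 'v) \<Rightarrow> real" where
  "iso_radius e J g = dilation e J g powr (- 1/4)"

text \<open>The point \<open>g\<^sup>-\<^sup>1 \<infinity>\<close>, which is finite when \<open>g\<close> does not fix infinity.\<close>

definition centre ::
    "'c::euclidean_space \<Rightarrow> ('c \<Rightarrow> 'v::real_inner \<Rightarrow> 'v) \<Rightarrow>
     ('c \<times> 'v \<Rightarrow> 'c \<times> 'v) \<Rightarrow> 'c \<times> 'v" where
  "centre e J g = the (bar_ext e (inv\<^bsub>G_grp e J\<^esub> g) None)"

definition Ext_I ::
    "'c::euclidean_space \<Rightarrow> ('c \<Rightarrow> 'v::real_inner \<Rightarrow> 'v) \<Rightarrow>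
     ('c \<times> 'v \<Rightarrow> 'c \<times> 'v) \<Rightarrow> ('c \<times> 'v) set" where
  "Ext_I e J g = {z \<in> D_dom e. cygan e J z (centre e J g) > iso_radius e J g}"

definition Int_I ::
    "'c::euclidean_space \<Rightarrow> ('c \<Rightarrow> 'v::real_inner \<Rightarrow> 'v) \<Rightarrow>
     ('c \<times> 'v \<Rightarrow> 'c \<times> 'v) \<Rightarrow> ('c \<times> 'v) set" where
  "Int_I e J g = {z \<in> D_dom e. cygan e J z (centre e J g) < iso_radius e J g}"

text \<open>The intersection with \<open>D_dom e\<close> matters only for an empty index set.\<close>

definition common_exterior ::
    "'c::euclidean_space \<Rightarrow> ('c \<Rightarrow> 'v::real_inner \<Rightarrow> 'v) \<Rightarrow>
     ('c \<times> 'v \<Rightarrow> 'c \<times> 'v) set \<Rightarrow> ('c \<times> 'v) set" where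
  "common_exterior e J \<Gamma> = D_dom e \<inter> (\<Inter>g\<in>\<Gamma> - stab_inf e J \<Gamma>. Ext_I e J g)"

section \<open>Types and fundamental regions\<close>

definition type_O ::
    "'c::euclidean_space \<Rightarrow> ('c \<Rightarrow> 'v::real_inner \<Rightarrow> 'v) \<Rightarrow>
     ('c \<times> 'v \<Rightarrow> 'c \<times> 'v) set \<Rightarrow> bool" where
  "type_O e J \<Gamma> \<longleftrightarrow>
     common_exterior e J \<Gamma>
     = D_dom e - (top_of_set (D_dom e) closure_of (\<Union>g\<in>\<Gamma> - stab_inf e J \<Gamma>. Int_I e J g))"

definition type_F ::
    "'c::euclidean_space \<Rightarrow> ('c \<Rightarrow> 'v::real_inner \<Rightarrow> 'v) \<Rightarrow>
     ('c \<times> 'v \<Rightarrow> 'c \<times> 'v) set \<Rightarrow> bool" where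
  "type_F e J T \<longleftrightarrow> T \<subseteq> carrier (G_grp e J) \<and>
     (\<forall>z\<in>D_dom e. \<exists>g\<in>generate (G_grp e J) T. \<forall>h\<in>generate (G_grp e J) T. ht e (h z) \<le> ht e (g z))"

definition fundamental_region ::
    "'c::euclidean_space \<Rightarrow> ('c \<times> 'v::real_inner \<Rightarrow> 'c \<times> 'v) set \<Rightarrow>
     ('c \<times> 'v) set \<Rightarrow> bool" where
  "fundamental_region e \<Gamma> Y \<longleftrightarrow>
     Y \<subseteq> D_dom e \<and> open Y \<and>
     (\<forall>g\<in>\<Gamma>. \<forall>h\<in>\<Gamma>. g \<noteq> h \<longrightarrow> g ` Y \<inter> h ` Y = {}) \<and>
     D_dom e = (\<Union>g\<in>\<Gamma>. g ` (top_of_set (D_dom e) closure_of Y))"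

end

theory Submission
  imports Defs
begin

text \<open>
  Let \<open>g\<close> be a nontrivial element of \<open>\<Gamma>\<close>.  It does not fix infinity, so \<open>g = n\<^sub>1 \<sigma> m a\<^sub>t n\<^sub>2\<close>, and with the boundary
  point \<open>p = g\<^sup>-\<^sup>1 \<infinity>\<close> one finds \<open>ht (g z) = ht z / (t |P(z, p)|\<^sup>2)\<close>, where \<open>P\<close> is the polarised height \<open>polar_ht\<close>
  and \<open>|P(z, p)|\<close> is the square of the Cygan distance.  Hence \<open>z\<close> lies in the exterior of the isometric sphere
  of \<open>g\<close> if and only if \<open>ht (g z) < ht z\<close> (\<open>isometric_sphere_heights\<close>), and the common exterior \<open>F\<close> is the set of
  points that are strictly higher than all their other translates.  Two translates of \<open>F\<close> are therefore disjoint.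
  Conversely, type (F) provides in every orbit a point \<open>w\<close> of maximal height.  Moving \<open>w\<close> vertically by any
  \<open>s > 0\<close> increases every \<open>|P(w, p)|\<close> and leads into \<open>F\<close>, so \<open>w\<close> lies in the closure of \<open>F\<close>.  Type (O)
  says that \<open>F\<close> is the complement of a closed set, hence open.
  
  The substance is the decomposition of an arbitrary isometry and its action on the boundary.  The function
  \<open>cosh_sq z w = |P(z, w)|\<^sup>2 / (4 ht z ht w)\<close>, which is \<open>cosh\<^sup>2\<close> of half the distance, is preserved by \<open>N\<close>, \<open>A\<close>
  and \<open>\<sigma>\<close> by direct computation.  A differentiable map that preserves it preserves the metric (\<open>speed_limit\<close>).  On
  the other hand a map preserving the metric cannot increase it on vertical pairs, by the eikonal
  inequality \<open>cosh_sq_derivative_le\<close>, and therefore on no pair, since \<open>ray_to_boundary\<close> makes every pair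
  vertical.  Isometries thus preserve \<open>cosh_sq\<close> (\<open>isometry_cosh_sq\<close>).  A distance preserving bijection that maps
  two points of the axis to a vertical pair multiplies all heights by a constant and is an element
  of \<open>MAN\<close>; by \<open>ray_to_boundary\<close> again every isometry has this property, possibly after composition with a
  translation and the inversion (\<open>bruhat\<close>).  The boundary extensions of the factors are explicit, and \<open>bar_ext_eq\<close>
  identifies them with the abstract ones.
\<close>


section \<open>The action of the module\<close>

locale j2c =
  fixes e :: "'c::euclidean_space" and J :: "'c \<Rightarrow> 'v::real_inner \<Rightarrow> 'v"
  assumes module: "J2C_module e J"
begin

lemma bilinear_J: "bilinear J"
  and J_e [simp]: "J e v = v"
  and norm_J: "norm (J \<zeta> v) = norm \<zeta> * norm v"
  using module by (auto simp: J2C_module_def)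

lemma norm_e [simp]: "norm e = 1"
proof (cases "(UNIV :: 'v set) = {0}")
  case True
  then show ?thesis
    using module by (auto simp: J2C_module_def)
next
  case False
  then obtain v :: 'v where "v \<noteq> 0"
    by blast
  moreover have "norm v = norm e * norm v"
    using norm_J[of e v] by simp
  ultimately show ?thesis
    by simp
qed

lemma e_inner_e [simp]: "e \<bullet> e = 1"
  by (simp add: dot_square_norm)

lemma bounded_bilinear_J: "bounded_bilinear J"
proof
  show "\<exists>K. \<forall>a b. norm (J a b) \<le> norm a * norm b * K"
    by (rule exI[of _ 1]) (simp add: norm_J)
qed (use bilinear_J in \<open>auto simp: bilinear_ladd bilinear_radd bilinear_lmul bilinear_rmul\<close>)

sublocale J: bounded_bilinear J
  by (rule bounded_bilinear_J)

lemmas J_simps = J.add_left J.add_right J.diff_left J.diff_right J.scaleR_left J.scaleR_right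
  J.minus_left J.minus_right J.zero_left J.zero_right

lemma J_inner_same_left: "J a u \<bullet> J a v = (norm a)\<^sup>2 * (u \<bullet> v)"
proof -
  have "(norm (J a (u + v)))\<^sup>2 = (norm a)\<^sup>2 * (norm (u + v))\<^sup>2"
       "(norm (J a u))\<^sup>2 = (norm a)\<^sup>2 * (norm u)\<^sup>2"
       "(norm (J a v))\<^sup>2 = (norm a)\<^sup>2 * (norm v)\<^sup>2"
    by (simp_all add: norm_J power_mult_distrib)
  then show ?thesis
    unfolding power2_norm_eq_inner J.add_right inner_add_left inner_add_right
    by (simp add: inner_commute algebra_simps)
qed

lemma J_inner_same_right: "J a u \<bullet> J b u = (a \<bullet> b) * (norm u)\<^sup>2"
proof -
  have "(norm (J (a + b) u))\<^sup>2 = (norm (a + b))\<^sup>2 * (norm u)\<^sup>2"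
       "(norm (J a u))\<^sup>2 = (norm a)\<^sup>2 * (norm u)\<^sup>2"
       "(norm (J b u))\<^sup>2 = (norm b)\<^sup>2 * (norm u)\<^sup>2"
    by (simp_all add: norm_J power_mult_distrib)
  then show ?thesis
    unfolding power2_norm_eq_inner J.add_left inner_add_left inner_add_right
    by (simp add: inner_commute algebra_simps)
qed

text \<open>
  The operator \<open>J (e + z)\<close> multiplies norms by \<open>|e + z|\<close> and hence inner products by \<open>1 + |z|\<^sup>2\<close>;
  expanding leaves no room for the two cross terms.
\<close>

lemma J_skew:
  assumes "z \<bullet> e = 0"
  shows "J z u \<bullet> v = - (u \<bullet> J z v)"
proof -
  have "(norm (e + z))\<^sup>2 = 1 + (norm z)\<^sup>2"
    using assms by (simp add: power2_norm_eq_inner inner_add_left inner_add_right inner_commute)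
  then have "J (e + z) u \<bullet> J (e + z) v = (1 + (norm z)\<^sup>2) * (u \<bullet> v)"
    by (simp add: J_inner_same_left)
  then show ?thesis
    using J_inner_same_left[of z u v]
    by (simp add: J.add_left inner_add_left inner_add_right algebra_simps)
qed

lemma c_simps:
  "c_re e (a + b) = c_re e a + c_re e b" "c_re e (a - b) = c_re e a - c_re e b"
  "c_re e (- a) = - c_re e a" "c_re e (r *\<^sub>R a) = r * c_re e a" "c_re e e = 1" "c_re e 0 = 0"
  "c_im e (a + b) = c_im e a + c_im e b" "c_im e (a - b) = c_im e a - c_im e b"
  "c_im e (- a) = - c_im e a" "c_im e (r *\<^sub>R a) = r *\<^sub>R c_im e a" "c_im e e = 0" "c_im e 0 = 0"
  "c_conj e (a + b) = c_conj e a + c_conj e b" "c_conj e (a - b) = c_conj e a - c_conj e b"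
  "c_conj e (- a) = - c_conj e a" "c_conj e (r *\<^sub>R a) = r *\<^sub>R c_conj e a" "c_conj e e = e"
  "c_conj e 0 = 0"
  by (simp_all add: c_re_def c_im_def c_conj_def inner_simps algebra_simps)

lemma c_im_inner_e [simp]: "c_im e a \<bullet> e = 0" "e \<bullet> c_im e a = 0"
  by (simp_all add: c_re_def c_im_def inner_simps inner_commute)

lemma c_re_im_idem [simp]: "c_re e (c_im e a) = 0" "c_im e (c_im e a) = c_im e a"
    "c_re e (c_conj e a) = c_re e a" "c_im e (c_conj e a) = - c_im e a"
    "c_conj e (c_conj e a) = a"
  by (simp_all add: c_re_def c_im_def c_conj_def inner_simps inner_commute)

lemma c_decomp: "a = c_re e a *\<^sub>R e + c_im e a"
  by (simp add: c_im_def)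

lemma norm_c_decomp: "(norm a)\<^sup>2 = (c_re e a)\<^sup>2 + (norm (c_im e a))\<^sup>2"
proof -
  have "(norm (c_re e a *\<^sub>R e + c_im e a))\<^sup>2 = (c_re e a)\<^sup>2 + (norm (c_im e a))\<^sup>2"
    unfolding power2_norm_eq_inner by (simp add: inner_simps power2_eq_square)
  then show ?thesis
    using c_decomp[of a] by simp
qed

lemma norm_conj [simp]: "norm (c_conj e a) = norm a"
proof -
  have "(norm (c_conj e a))\<^sup>2 = (norm a)\<^sup>2"
    using norm_c_decomp[of "c_conj e a"] norm_c_decomp[of a] by simp
  then show ?thesis
    by simp
qed

lemma c_re_le_norm: "\<bar>c_re e a\<bar> \<le> norm a"
  unfolding c_re_def using Cauchy_Schwarz_ineq2[of a e] by simp

lemma conj_inner: "c_conj e a \<bullet> b = a \<bullet> c_conj e b"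
  by (simp add: c_re_def c_im_def c_conj_def inner_simps inner_commute algebra_simps)

lemma C_prime_iff: "z \<in> C_prime e \<longleftrightarrow> c_re e z = 0"
  by (simp add: C_prime_def c_re_def)

lemma c_im_C_prime: "z \<in> C_prime e \<Longrightarrow> c_im e z = z"
  by (simp add: C_prime_iff c_im_def)

lemma J_adjoint: "J a u \<bullet> v = u \<bullet> J (c_conj e a) v"
proof -
  have "J a u = c_re e a *\<^sub>R u + J (c_im e a) u"
    by (subst c_decomp[of a]) (simp add: J_simps)
  then show ?thesis
    using J_skew[of "c_im e a" u v] by (simp add: c_conj_def J_simps inner_simps)
qed

lemma J_conj_J: "J (c_conj e a) (J a v) = (norm a)\<^sup>2 *\<^sub>R v"
proof (rule vector_eq_ldot[THEN iffD1], rule allI)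
  fix u
  show "u \<bullet> J (c_conj e a) (J a v) = u \<bullet> (norm a)\<^sup>2 *\<^sub>R v"
    using J_adjoint[of a u "J a v"] by (simp add: J_inner_same_left)
qed

lemma norm_inv: "norm (c_inv e a) = 1 / norm a"
  by (cases "a = 0") (simp_all add: c_inv_def power2_eq_square field_simps)

lemma inv_inv [simp]: "c_inv e (c_inv e a) = a"
  by (cases "a = 0")
    (simp_all add: c_inv_def c_simps norm_inv[unfolded c_inv_def] power2_eq_square field_simps)

lemma J_inv_J: "a \<noteq> 0 \<Longrightarrow> J (c_inv e a) (J a v) = v"
  by (simp add: c_inv_def J_simps J_conj_J)

lemma J_J_inv: "a \<noteq> 0 \<Longrightarrow> J a (J (c_inv e a) v) = v"
  using J_inv_J[of "c_inv e a" v] norm_inv[of a] by force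

lemma beta_inner: "beta2 J v u \<bullet> \<zeta> = J \<zeta> u \<bullet> v"
proof -
  define b where "b = (\<Sum>i\<in>Basis. (J i u \<bullet> v) *\<^sub>R i)"
  have b: "b \<bullet> \<zeta> = J \<zeta> u \<bullet> v" for \<zeta>
  proof -
    have "J \<zeta> u = J (\<Sum>i\<in>Basis. (\<zeta> \<bullet> i) *\<^sub>R i) u"
      by (simp add: euclidean_representation)
    also have "\<dots> \<bullet> v = (\<Sum>i\<in>Basis. (\<zeta> \<bullet> i) * (J i u \<bullet> v))"
      by (simp add: J.sum_left J_simps inner_sum_left)
    also have "\<dots> = b \<bullet> \<zeta>"
      unfolding b_def inner_sum_left inner_scaleR_left
      by (rule sum.cong) (simp_all add: inner_commute[of _ \<zeta>] mult.commute)
    finally show ?thesis by simp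
  qed
  have "beta2 J v u = b"
    unfolding beta2_def
  proof (rule the_equality)
    fix b' assume "\<forall>\<zeta>. b' \<bullet> \<zeta> = J \<zeta> u \<bullet> v"
    then show "b' = b"
      using b by (metis vector_eq_rdot)
  qed (use b in blast)
  then show ?thesis
    using b by simp
qed

lemma beta_eqI: "(\<And>\<zeta>. J \<zeta> u \<bullet> v = b \<bullet> \<zeta>) \<Longrightarrow> beta2 J v u = b"
  by (metis beta_inner vector_eq_rdot)

lemma norm_beta_le: "norm (beta2 J v u) \<le> norm v * norm u"
proof (cases "beta2 J v u = 0")
  case False
  have "(norm (beta2 J v u))\<^sup>2 = J (beta2 J v u) u \<bullet> v"
    by (simp add: power2_norm_eq_inner beta_inner)
  also have "\<dots> \<le> norm (J (beta2 J v u) u) * norm v"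
    by (rule norm_cauchy_schwarz)
  also have "\<dots> = norm (beta2 J v u) * (norm v * norm u)"
    by (simp add: norm_J)
  finally show ?thesis
    using False by (simp add: power2_eq_square)
qed simp

lemma bounded_bilinear_beta: "bounded_bilinear (beta2 J)"
proof
  show "\<exists>K. \<forall>a b. norm (beta2 J a b) \<le> norm a * norm b * K"
    by (rule exI[of _ 1]) (simp add: norm_beta_le)
qed (auto intro!: beta_eqI simp: J_simps inner_simps beta_inner)

sublocale beta: bounded_bilinear "beta2 J"
  by (rule bounded_bilinear_beta)

lemmas beta_simps = beta.add_left beta.add_right beta.diff_left beta.diff_right
  beta.scaleR_left beta.scaleR_right beta.minus_left beta.minus_right beta.zero_left beta.zero_right

lemma c_re_beta: "c_re e (beta2 J v u) = u \<bullet> v"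
  by (simp add: c_re_def beta_inner)

lemma conj_beta: "c_conj e (beta2 J v u) = beta2 J u v"
  by (rule sym, rule beta_eqI) (metis beta_inner J_adjoint conj_inner inner_commute)

lemma norm_beta_commute: "norm (beta2 J v u) = norm (beta2 J u v)"
  by (metis conj_beta norm_conj)

text \<open>
  For vectors of one subspace \<open>C v\<close> the form is linear in the conjugate of \<open>y\<close>.  This makes the equation of
  a ray in \<open>ray_to_boundary_from_base\<close> linear.
\<close>

lemma beta_J_right: "beta2 J v (J y v) = (norm v)\<^sup>2 *\<^sub>R c_conj e y"
proof (rule beta_eqI)
  fix \<zeta>
  have "J \<zeta> (J y v) \<bullet> v = J y v \<bullet> J (c_conj e \<zeta>) v"
    by (rule J_adjoint)
  then show "J \<zeta> (J y v) \<bullet> v = (norm v)\<^sup>2 *\<^sub>R c_conj e y \<bullet> \<zeta>"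
    by (simp add: J_inner_same_right conj_inner)
qed

lemma beta_same: "beta2 J v v = (norm v)\<^sup>2 *\<^sub>R e"
  using beta_J_right[of v e] by (simp add: c_simps)

text \<open>
  The bracket of \<open>N\<close> and the form defining its action are thus the imaginary part and the whole of one
  object, so only \<open>beta2\<close> is used below.
\<close>

lemma bracket_eq: "bracket e J x y = c_im e (beta2 J y x)"
  unfolding bracket_def
proof (rule the_equality)
  show "c_im e (beta2 J y x) \<in> C_prime e \<and>
      (\<forall>z\<in>C_prime e. z \<bullet> c_im e (beta2 J y x) = J z x \<bullet> y)"
    by (auto simp: C_prime_def inner_commute[of _ "c_im e _"])
      (simp add: c_im_def inner_simps inner_commute[of e] beta_inner)
next
  fix w assume w: "w \<in> C_prime e \<and> (\<forall>z\<in>C_prime e. z \<bullet> w = J z x \<bullet> y)"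
  show "w = c_im e (beta2 J y x)"
  proof (rule vector_eq_ldot[THEN iffD1], rule allI)
    fix z
    have w0: "e \<bullet> w = 0"
      using w by (simp add: C_prime_def inner_commute)
    have "c_im e z \<bullet> w = J (c_im e z) x \<bullet> y"
      using w by (simp add: C_prime_iff)
    also have "\<dots> = beta2 J y x \<bullet> c_im e z"
      by (simp add: beta_inner)
    also have "\<dots> = c_im e (beta2 J y x) \<bullet> z"
      by (simp add: c_im_def c_re_def inner_simps inner_commute)
    also have "c_im e z \<bullet> w = z \<bullet> w"
      using w0 by (simp add: c_im_def inner_simps)
    finally show "z \<bullet> w = z \<bullet> c_im e (beta2 J y x)"
      by (simp add: inner_commute)
  qed
qed

lemma J_J_exists: "\<exists>\<xi>. J \<zeta> (J \<eta> v) = J \<xi> v"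
  using module unfolding J2C_module_def by blast

text \<open>
  Here the condition \<open>C (C u) = C u\<close> enters: the subspace \<open>C u\<close> is stable under \<open>C\<close>, so
  testing \<open>v\<close> against \<open>C (\<zeta> u)\<close> is testing it against elements of \<open>C u\<close> of known norm.  In geometric terms
  \<open>|beta2 v u| / |u|\<close> is the length of the projection of \<open>v\<close> to \<open>C u\<close>.
\<close>

lemma norm_beta_J_le: "norm (beta2 J v (J \<zeta> u)) \<le> norm \<zeta> * norm (beta2 J v u)"
proof (cases "u = 0 \<or> beta2 J v (J \<zeta> u) = 0")
  case True
  then show ?thesis by (auto simp: J_simps beta_simps)
next
  case False
  define b where "b = beta2 J v (J \<zeta> u)"
  obtain \<xi> where \<xi>: "J b (J \<zeta> u) = J \<xi> u"
    using J_J_exists by blast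
  have "norm (J b (J \<zeta> u)) = norm (J \<xi> u)"
    by (simp add: \<xi>)
  then have n: "norm \<xi> = norm b * norm \<zeta>"
    using False by (simp add: norm_J)
  have "(norm b)\<^sup>2 = J b (J \<zeta> u) \<bullet> v"
    using beta_inner[of v "J \<zeta> u" b] by (simp add: b_def power2_norm_eq_inner)
  also have "\<dots> = beta2 J v u \<bullet> \<xi>"
    by (simp add: \<xi> beta_inner)
  also have "\<dots> \<le> norm (beta2 J v u) * norm \<xi>"
    by (rule norm_cauchy_schwarz)
  also have "\<dots> = norm b * (norm \<zeta> * norm (beta2 J v u))"
    by (simp add: n)
  finally show ?thesis
    using False by (simp add: b_def power2_eq_square)
qed

lemma norm_beta_J: "norm (beta2 J v (J \<zeta> u)) = norm \<zeta> * norm (beta2 J v u)"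
proof (cases "\<zeta> = 0")
  case True
  then show ?thesis by (simp add: J_simps beta_simps)
next
  case False
  have "norm (beta2 J v (J (c_inv e \<zeta>) (J \<zeta> u))) \<le> 1 / norm \<zeta> * norm (beta2 J v (J \<zeta> u))"
    using norm_beta_J_le[of v "c_inv e \<zeta>"] by (simp add: norm_inv)
  then have "norm \<zeta> * norm (beta2 J v u) \<le> norm (beta2 J v (J \<zeta> u))"
    using False by (simp add: J_inv_J field_simps)
  then show ?thesis
    using norm_beta_J_le[of v \<zeta> u] by simp
qed


section \<open>The polarised height and the basic transformations\<close>

text \<open>
  The polarisation of the height: \<open>polar_ht z z = 2 ht z\<close>.  Its norm plays three roles.  For two
  points of \<open>D\<close> it determines, together with their heights, their distance; for a point and a boundary point it is the square of the
  Cygan distance, and in the latter case \<open>ht z / |polar_ht z p|\<^sup>2\<close> is the exponential of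
  a Busemann function of \<open>p\<close>, up to the sign of the exponent.
\<close>

definition polar_ht :: "'c \<times> 'v \<Rightarrow> 'c \<times> 'v \<Rightarrow> 'c" where
  "polar_ht z w = fst z + c_conj e (fst w) - (1/2) *\<^sub>R beta2 J (snd z) (snd w)"

text \<open>
  For the Riemannian distance \<open>d\<close> this is \<open>cosh\<^sup>2 (d z w / 2)\<close>.  Working with this explicit function
  avoids infima of lengths of curves altogether.
\<close>

definition cosh_sq :: "'c \<times> 'v \<Rightarrow> 'c \<times> 'v \<Rightarrow> real" where
  "cosh_sq z w = (norm (polar_ht z w))\<^sup>2 / (4 * ht e z * ht e w)"

text \<open>
  The actions of \<open>N\<close>, of \<open>A\<close> and of the geodesic inversion by their formulas on all of \<open>C \<times> V\<close>, and the
  vertical translations, which are not isometries but move along the rays to infinity.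
\<close>

definition heis :: "'c \<Rightarrow> 'v \<Rightarrow> 'c \<times> 'v \<Rightarrow> 'c \<times> 'v" where
  "heis Z X z = (((norm X)\<^sup>2 / 4) *\<^sub>R e + Z + fst z + (1/2) *\<^sub>R beta2 J (snd z) X, X + snd z)"

definition dil :: "real \<Rightarrow> 'c \<times> 'v \<Rightarrow> 'c \<times> 'v" where
  "dil t z = (t *\<^sub>R fst z, sqrt t *\<^sub>R snd z)"

definition geo :: "'c \<times> 'v \<Rightarrow> 'c \<times> 'v" where
  "geo z = (c_inv e (fst z), - J (c_inv e (fst z)) (snd z))"

definition up :: "real \<Rightarrow> 'c \<times> 'v \<Rightarrow> 'c \<times> 'v" where
  "up s z = (fst z + s *\<^sub>R e, snd z)"

lemma ht_eq: "ht e z = c_re e (fst z) - (norm (snd z))\<^sup>2 / 4"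
  by (cases z) (simp add: ht_def)

lemma D_iff: "z \<in> D_dom e \<longleftrightarrow> 0 < ht e z"
  by (cases z) (simp add: ht_def D_dom_def)

lemma pair_eq_iff: "z = w \<longleftrightarrow> c_re e (fst z) = c_re e (fst w) \<and> c_im e (fst z) = c_im e (fst w) \<and> snd z = snd w"
  by (metis c_decomp prod_eq_iff)

lemma point_eq_iff: "z = w \<longleftrightarrow> ht e z = ht e w \<and> c_im e (fst z) = c_im e (fst w) \<and> snd z = snd w"
  by (subst pair_eq_iff) (auto simp: ht_eq)

text \<open>
  The real part alone already bounds the distance from below; this makes vertical translations
  recognisable from distances and heights.
\<close>

lemma re_polar_ht: "c_re e (polar_ht z w) = ht e z + ht e w + (norm (snd z - snd w))\<^sup>2 / 4"
  by (simp add: polar_ht_def c_simps ht_eq c_re_beta power2_norm_eq_inner inner_simps inner_commute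
      field_simps)

lemma im_polar_ht: "c_im e (polar_ht z w) = c_im e (fst z) - c_im e (fst w) - (1/2) *\<^sub>R c_im e (beta2 J (snd z) (snd w))"
  by (simp add: polar_ht_def c_simps)

lemma norm_polar_ht:
  "(norm (polar_ht z w))\<^sup>2 = (ht e z + ht e w + (norm (snd z - snd w))\<^sup>2 / 4)\<^sup>2 + (norm (c_im e (polar_ht z w)))\<^sup>2"
  using norm_c_decomp[of "polar_ht z w"] by (simp add: re_polar_ht)

lemma polar_ht_self: "polar_ht z z = (2 * ht e z) *\<^sub>R e"
  using c_decomp[of "polar_ht z z"] by (simp add: re_polar_ht im_polar_ht beta_same c_simps)

lemma ht_up: "ht e (up s z) = ht e z + s"
  by (simp add: ht_eq up_def c_simps)

lemma up_D: "z \<in> D_dom e \<Longrightarrow> 0 \<le> s \<Longrightarrow> up s z \<in> D_dom e"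
  by (simp add: D_iff ht_up)

lemma polar_ht_up: "polar_ht (up s z) w = polar_ht z w + s *\<^sub>R e" "polar_ht z (up s w) = polar_ht z w + s *\<^sub>R e"
  by (simp_all add: polar_ht_def up_def c_simps)

lemma polar_ht_heis:
  assumes "Z \<in> C_prime e"
  shows "polar_ht (heis Z X z) (heis Z X w) = polar_ht z w"
  using assms
  by (simp add: polar_ht_def heis_def c_simps C_prime_iff c_conj_def[of e Z] c_im_C_prime beta_simps conj_beta beta_same
      algebra_simps flip: scaleR_add_left)

lemma ht_heis: "Z \<in> C_prime e \<Longrightarrow> ht e (heis Z X z) = ht e z"
  by (simp add: ht_eq heis_def c_simps C_prime_iff c_re_beta power2_norm_eq_inner inner_simps
      inner_commute field_simps)

lemma polar_ht_dil: "0 < t \<Longrightarrow> polar_ht (dil t z) (dil t w) = t *\<^sub>R polar_ht z w"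
  by (simp add: polar_ht_def dil_def c_simps beta_simps algebra_simps)

lemma ht_dil: "0 < t \<Longrightarrow> ht e (dil t z) = t * ht e z"
  by (simp add: ht_eq dil_def c_simps power_mult_distrib algebra_simps)

lemma ht_geo: "ht e (geo z) = ht e z / (norm (fst z))\<^sup>2"
proof (cases "fst z = 0")
  case False
  have "(norm (J (c_inv e (fst z)) (snd z)))\<^sup>2 = (norm (snd z))\<^sup>2 / (norm (fst z))\<^sup>2"
    by (simp add: norm_J norm_inv power_divide)
  moreover have "c_re e (c_inv e (fst z)) = c_re e (fst z) / (norm (fst z))\<^sup>2"
    by (simp add: c_inv_def c_simps)
  ultimately show ?thesis
    by (simp add: ht_eq geo_def diff_divide_distrib)
qed (simp add: ht_eq geo_def c_inv_def c_simps J_simps)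

text \<open>
  In \<open>polar_ht (geo z) (geo w) = A' - B'/2\<close> the square norm of \<open>A'\<close> transforms as for inversion
  in a sphere, the inner product of \<open>A'\<close> and \<open>B'\<close> by cancelling each of the two inverses in \<open>A'\<close> against
  its counterpart in \<open>B'\<close>, and the norm of \<open>B'\<close> by \<open>norm_beta_J\<close>.
\<close>

lemma norm_polar_ht_geo:
  assumes "fst z \<noteq> 0" "fst w \<noteq> 0"
  shows "norm (polar_ht (geo z) (geo w)) = norm (polar_ht z w) / (norm (fst z) * norm (fst w))"
proof -
  obtain a u where z: "z = (a, u)" by force
  obtain b v where w: "w = (b, v)" by force
  have ab: "a \<noteq> 0" "b \<noteq> 0"
    using assms z w by auto
  define m n where "m = (norm a)\<^sup>2" and "n = (norm b)\<^sup>2"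
  have mn: "m > 0" "n > 0"
    using ab by (auto simp: m_def n_def)
  define A B A' B' where "A = a + c_conj e b" and "B = beta2 J u v"
    and "A' = (1/m) *\<^sub>R c_conj e a + (1/n) *\<^sub>R b"
    and "B' = beta2 J (J (c_inv e a) u) (J (c_inv e b) v)"
  have P: "polar_ht z w = A - (1/2) *\<^sub>R B"
    by (simp add: z w polar_ht_def A_def B_def)
  have P': "polar_ht (geo z) (geo w) = A' - (1/2) *\<^sub>R B'"
    by (simp add: z w polar_ht_def geo_def A'_def B'_def c_inv_def c_simps m_def n_def beta_simps J_simps)
  have norm_sum_sq: "(norm (x + y))\<^sup>2 = (norm x)\<^sup>2 + (norm y)\<^sup>2 + 2 * (x \<bullet> y)" for x y :: 'c
    by (simp add: power2_norm_eq_inner inner_simps inner_commute)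
  have ex: "(norm (x - (1/2) *\<^sub>R y))\<^sup>2 = (norm x)\<^sup>2 - x \<bullet> y + (norm y)\<^sup>2 / 4" for x y :: 'c
    using norm_sum_sq[of x "- (1/2) *\<^sub>R y"] by (simp add: power_divide)
  have A: "m * n * (norm A')\<^sup>2 = (norm A)\<^sup>2"
  proof -
    have "(norm A')\<^sup>2 = 1 / m + 1 / n + 2 * (c_conj e a \<bullet> b) / (m * n)"
      using norm_sum_sq[of "(1/m) *\<^sub>R c_conj e a" "(1/n) *\<^sub>R b"] ab
      by (simp add: A'_def m_def n_def power_divide power2_eq_square)
    moreover have "(norm A)\<^sup>2 = m + n + 2 * (a \<bullet> c_conj e b)"
      using norm_sum_sq[of a "c_conj e b"] by (simp add: A_def m_def n_def)
    ultimately show ?thesis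
      using mn by (simp add: conj_inner distrib_left)
  qed
  have "A' \<bullet> B' = J A' (J (c_inv e b) v) \<bullet> J (c_inv e a) u"
    by (simp add: B'_def beta_inner inner_commute[of A'])
  also have "\<dots> = J (c_inv e a) (J (c_inv e b) v) \<bullet> J (c_inv e a) u
      + (1/n) * (J b (J (c_inv e b) v) \<bullet> J (c_inv e a) u)"
  proof -
    have "A' = c_inv e a + (1/n) *\<^sub>R b"
      by (simp add: A'_def c_inv_def m_def)
    then show ?thesis
      by (simp add: J.add_left J.scaleR_left inner_add_left)
  qed
  also have "\<dots> = (1/m) * (J (c_inv e b) v \<bullet> u) + (1/n) * (v \<bullet> J (c_inv e a) u)"
    using ab by (simp add: J_inner_same_left norm_inv J_J_inv m_def power_divide)
  also have "v \<bullet> J (c_inv e a) u = (1/m) * (J a v \<bullet> u)"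
    by (simp add: c_inv_def J_simps J_adjoint m_def)
  also have "J (c_inv e b) v \<bullet> u = (1/n) * (J (c_conj e b) v \<bullet> u)"
    by (simp add: c_inv_def J_simps n_def)
  finally have AB: "m * n * (A' \<bullet> B') = A \<bullet> B"
    using mn
    by (simp add: A_def B_def inner_commute[of _ "beta2 J u v"] beta_inner J_simps inner_simps field_simps)
  have "norm B' = norm (beta2 J u v) / (norm a * norm b)"
    unfolding B'_def
    by (simp add: norm_beta_J norm_inv norm_beta_commute[of _ v] norm_beta_commute[of "J (c_inv e a) u"])
  then have B: "m * n * (norm B')\<^sup>2 = (norm B)\<^sup>2"
    using ab by (simp add: B_def m_def n_def power_divide power_mult_distrib)
  have "m * n * (norm (polar_ht (geo z) (geo w)))\<^sup>2
      = m * n * (norm A')\<^sup>2 - m * n * (A' \<bullet> B') + m * n * (norm B')\<^sup>2 / 4"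
    unfolding P' ex by (simp add: algebra_simps)
  also have "\<dots> = (norm (polar_ht z w))\<^sup>2"
    unfolding P ex A AB B ..
  finally have "(norm a * norm b * norm (polar_ht (geo z) (geo w)))\<^sup>2 = (norm (polar_ht z w))\<^sup>2"
    by (simp add: m_def n_def power_mult_distrib)
  then have "norm a * norm b * norm (polar_ht (geo z) (geo w)) = norm (polar_ht z w)"
    by (rule power2_eq_imp_eq) auto
  then show ?thesis
    using ab by (simp add: z w field_simps)
qed

lemma fst_D_nonzero: "z \<in> D_dom e \<Longrightarrow> fst z \<noteq> 0"
  by (auto simp: D_iff ht_eq c_simps)

lemma geo_D: "z \<in> D_dom e \<Longrightarrow> geo z \<in> D_dom e"
  using fst_D_nonzero[of z] by (simp add: D_iff ht_geo)

lemma heis_D: "Z \<in> C_prime e \<Longrightarrow> heis Z X z \<in> D_dom e \<longleftrightarrow> z \<in> D_dom e"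
  by (simp add: D_iff ht_heis)

lemma dil_D: "0 < t \<Longrightarrow> dil t z \<in> D_dom e \<longleftrightarrow> z \<in> D_dom e"
  by (simp add: D_iff ht_dil zero_less_mult_iff)

lemma cosh_sq_heis: "Z \<in> C_prime e \<Longrightarrow> cosh_sq (heis Z X z) (heis Z X w) = cosh_sq z w"
  by (simp add: cosh_sq_def polar_ht_heis ht_heis)

lemma cosh_sq_dil: "0 < t \<Longrightarrow> cosh_sq (dil t z) (dil t w) = cosh_sq z w"
  by (simp add: cosh_sq_def polar_ht_dil ht_dil power_mult_distrib field_simps power2_eq_square)

lemma cosh_sq_geo: "z \<in> D_dom e \<Longrightarrow> w \<in> D_dom e \<Longrightarrow> cosh_sq (geo z) (geo w) = cosh_sq z w"
  using fst_D_nonzero[of z] fst_D_nonzero[of w]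
  by (simp add: cosh_sq_def norm_polar_ht_geo ht_geo power_divide power_mult_distrib D_iff field_simps)

lemma geo_geo: "fst z \<noteq> 0 \<Longrightarrow> geo (geo z) = z"
  by (simp add: geo_def J_simps J_J_inv prod_eq_iff)

lemma neg_C_prime: "Z \<in> C_prime e \<Longrightarrow> - Z \<in> C_prime e"
  by (simp add: C_prime_iff c_simps)

lemma heis_heis: "heis Z X (heis W Y z) = heis (Z + W + (1/2) *\<^sub>R c_im e (beta2 J Y X)) (X + Y) z"
proof -
  have "(norm (X + Y))\<^sup>2 = (norm X)\<^sup>2 + (norm Y)\<^sup>2 + 2 * (X \<bullet> Y)"
    by (simp add: power2_norm_eq_inner inner_simps inner_commute)
  then show ?thesis
    by (simp add: heis_def c_im_def c_re_beta beta_simps algebra_simps add_divide_distrib)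
qed

lemma heis_0 [simp]: "heis 0 0 z = z"
  by (simp add: heis_def beta_simps)

lemma heis_minus: "heis (- Z) (- X) (heis Z X z) = z" "heis Z X (heis (- Z) (- X) z) = z"
  by (simp_all add: heis_heis beta_simps beta_same c_simps)

lemma dil_dil: "0 < s \<Longrightarrow> 0 < t \<Longrightarrow> dil s (dil t z) = dil (s * t) z"
  by (simp add: dil_def real_sqrt_mult)

lemma dil_1 [simp]: "dil 1 z = z"
  by (simp add: dil_def)

lemma dil_inverse: "0 < t \<Longrightarrow> dil (1/t) (dil t z) = z" "0 < t \<Longrightarrow> dil t (dil (1/t) z) = z"
  by (simp_all add: dil_dil)

lemma dil_heis: "0 < t \<Longrightarrow> dil t (heis Z X z) = heis (t *\<^sub>R Z) (sqrt t *\<^sub>R X) (dil t z)"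
  by (simp add: dil_def heis_def beta_simps algebra_simps power_mult_distrib)

text \<open>
  The element \<open>heis Z X\<close> moves the boundary point \<open>heis (- Z) (- X) 0\<close> to \<open>0\<close>, and \<open>fst z\<close> is the polarised
  height of \<open>z\<close> against \<open>0\<close>.
\<close>

lemma fst_heis: "Z \<in> C_prime e \<Longrightarrow> fst (heis Z X z) = polar_ht z (heis (- Z) (- X) 0)"
  by (simp add: heis_def polar_ht_def c_simps beta_simps C_prime_iff c_conj_def[of e Z] c_im_C_prime)

lemma cosh_sq_ge_1:
  assumes "z \<in> D_dom e" "w \<in> D_dom e"
  shows "1 \<le> cosh_sq z w"
proof -
  have h: "0 < ht e z" "0 < ht e w"
    using assms by (auto simp: D_iff)
  have "(2 * sqrt (ht e z * ht e w))\<^sup>2 \<le> (ht e z + ht e w)\<^sup>2"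
    using h zero_le_power2[of "ht e z - ht e w"]
    by (simp add: power_mult_distrib power2_eq_square algebra_simps)
  also have "\<dots> \<le> (ht e z + ht e w + (norm (snd z - snd w))\<^sup>2 / 4)\<^sup>2"
    using h by (intro power_mono) auto
  also have "\<dots> \<le> (norm (polar_ht z w))\<^sup>2"
    unfolding norm_polar_ht by simp
  finally show ?thesis
    using h by (simp add: cosh_sq_def power_mult_distrib)
qed


section \<open>Rays to the boundary\<close>

lemma up_heis: "heis Z X (up r z) = up r (heis Z X z)"
  by (simp add: heis_def up_def)

lemma up_dil: "dil t (up r z) = up (t * r) (dil t z)"
  by (simp add: dil_def up_def scaleR_add_right)

lemma geo_dil:
  assumes "0 < t"
  shows "geo (dil t z) = dil (1 / t) (geo z)"
proof -
  have "c_inv e (t *\<^sub>R \<zeta>) = (1 / t) *\<^sub>R c_inv e \<zeta>" for \<zeta>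
    using assms by (simp add: c_inv_def c_simps power2_eq_square field_simps)
  then show ?thesis
    using assms by (simp add: geo_def dil_def J_simps real_sqrt_divide real_div_sqrt field_simps)
qed

lemma norm_real_plus_im:
  assumes "\<iota> \<bullet> e = 0"
  shows "(norm (x *\<^sub>R e + y *\<^sub>R \<iota>))\<^sup>2 = x\<^sup>2 + y\<^sup>2 * (norm \<iota>)\<^sup>2"
  using assms unfolding power2_norm_eq_inner
  by (simp add: inner_simps inner_commute[of e \<iota>] power2_eq_square)

text \<open>
  Every point other than the base point lies on a ray from the base point to a boundary point \<open>p\<close>; moving
  \<open>p\<close> to infinity makes the ray vertical.  With \<open>n\<close> the translation moving \<open>p\<close> to \<open>0\<close>, the two first coordinates
  after \<open>n\<close> have to be \<open>1/q\<close> and \<open>1/(q + r)\<close>.  Writing \<open>q = r y\<close>, the second coordinates force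
  \<open>X = v + y v\<close>, and what remains is a linear equation in \<open>C\<close> for the conjugate \<open>Y\<close> of \<open>y\<close>.  Its solution is read
  off from the ball model, in which rays are straight: \<open>w\<close> has there the first coordinate
  \<open>a + \<iota> = (\<zeta> - 1) (\<zeta> + 1)\<^sup>-\<^sup>1\<close> and distance \<open>\<theta>\<close> from the origin, and \<open>y = (1 - \<theta>) (\<theta> - a - \<iota>)\<^sup>-\<^sup>1\<close>.
\<close>

lemma ray_to_boundary_from_base:
  assumes w: "w \<in> D_dom e" "w \<noteq> (e, 0)"
  shows "(\<exists>r>0. w = up r (e, 0)) \<or>
    (\<exists>Z\<in>C_prime e. \<exists>X. \<exists>r>0. geo (heis Z X w) = up r (geo (heis Z X (e, 0))))"
proof -
  obtain \<zeta> v where w': "w = (\<zeta>, v)" by force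
  define \<rho> where "\<rho> = c_re e \<zeta>"
  have ht: "0 < \<rho> - (norm v)\<^sup>2 / 4"
    using w by (simp add: D_iff ht_eq w' \<rho>_def)
  then have \<rho>: "0 < \<rho>"
    using zero_le_power2[of "norm v"] by linarith
  define N where "N = (norm \<zeta>)\<^sup>2 + 2 * \<rho> + 1"
  have N: "N > 0"
    using \<rho> by (simp add: N_def add_nonneg_pos)
  define a \<iota> s where "a = ((norm \<zeta>)\<^sup>2 - 1) / N" and "\<iota> = (2 / N) *\<^sub>R c_im e \<zeta>"
    and "s = a\<^sup>2 + (norm \<iota>)\<^sup>2"
  have im: "\<iota> \<bullet> e = 0"
    by (simp add: \<iota>_def)
  have \<zeta>: "\<zeta> = \<rho> *\<^sub>R e + (N / 2) *\<^sub>R \<iota>"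
    using N c_decomp[of \<zeta>] by (simp add: \<iota>_def \<rho>_def)
  have n\<zeta>: "(norm \<zeta>)\<^sup>2 = \<rho>\<^sup>2 + N\<^sup>2 / 4 * (norm \<iota>)\<^sup>2"
    using norm_real_plus_im[OF im, of \<rho> "N / 2"] \<zeta> by (simp add: power_divide)
  have s: "s = 1 - 4 * \<rho> / N"
  proof -
    have "N\<^sup>2 * s = ((norm \<zeta>)\<^sup>2 - 1)\<^sup>2 + 4 * ((norm \<zeta>)\<^sup>2 - \<rho>\<^sup>2)"
      using N n\<zeta> by (simp add: s_def a_def power_divide distrib_left)
    also have "\<dots> = N * (N - 4 * \<rho>)"
      by (simp add: N_def power2_eq_square algebra_simps)
    finally have "N * s = N - 4 * \<rho>"
      using N by (simp add: power2_eq_square)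
    then show ?thesis
      using N by (simp add: field_simps)
  qed
  have a: "1 - 2 * a + s = 4 / N"
  proof -
    have "N * a = (norm \<zeta>)\<^sup>2 - 1" "N * s = N - 4 * \<rho>"
      using N by (simp_all add: a_def s field_simps)
    then have "N * (1 - 2 * a + s) = 4"
      by (simp add: distrib_left right_diff_distrib) (simp add: N_def)
    then show ?thesis
      using N by (simp add: field_simps)
  qed
  (* \<theta> is tanh (d/2) for the distance d of w from the base point, so 1 - \<theta>\<^sup>2 = 1 / cosh_sq. *)
  define \<theta> where "\<theta> = sqrt (1 - 4 * (\<rho> - (norm v)\<^sup>2 / 4) / N)"
  have s0: "0 \<le> s"
    by (simp add: s_def)
  have th_arg: "1 - 4 * (\<rho> - (norm v)\<^sup>2 / 4) / N = s + (norm v)\<^sup>2 / N"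
    using N by (simp add: s field_simps)
  have th2: "\<theta>\<^sup>2 = s + (norm v)\<^sup>2 / N"
    unfolding \<theta>_def th_arg using N s0 by simp
  have nv: "(norm v)\<^sup>2 = N * (\<theta>\<^sup>2 - s)"
    using N by (simp add: th2)
  have th1: "\<theta> < 1"
    unfolding \<theta>_def using ht N by simp
  have th0: "0 < \<theta>"
  proof (rule ccontr)
    assume "\<not> 0 < \<theta>"
    moreover have "0 \<le> \<theta>"
      unfolding \<theta>_def th_arg using s0 N by simp
    ultimately have "s + (norm v)\<^sup>2 / N = 0"
      using th2 by simp
    then have *: "s = 0" "v = 0"
      using s0 N by (simp_all add: add_nonneg_eq_0_iff)
    then have "\<iota> = 0" "a = 0"
      by (simp_all add: s_def sum_power2_eq_zero_iff)
    then have "4 / N = 1" "N = 4 * \<rho>"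
      using a s * N by (simp_all add: field_simps)
    then have "\<rho> = 1"
      by simp
    then show False
      using w(2) \<zeta> * \<open>\<iota> = 0\<close> by (simp add: w')
  qed
  define K where "K = \<theta>\<^sup>2 - 2 * a * \<theta> + s"
  have K': "K = (\<theta> - a)\<^sup>2 + (norm \<iota>)\<^sup>2"
    by (simp add: K_def s_def power2_eq_square algebra_simps)
  show ?thesis
  proof (cases "K = 0")
    (* K vanishes exactly when the ray through w ends at infinity; then w is above the base point. *)
    case True
    then have *: "\<theta> = a" "\<iota> = 0"
      by (simp_all add: K' sum_power2_eq_zero_iff)
    then have "v = 0"
      using nv by (simp add: s_def)
    have "\<rho> > 1"
    proof (rule ccontr)
      assume "\<not> \<rho> > 1"
      then have "(norm \<zeta>)\<^sup>2 \<le> 1"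
        using \<rho> by (simp add: n\<zeta> * power_le_one)
      then have "a \<le> 0"
        using N by (simp add: a_def divide_nonpos_pos)
      then show False
        using * th0 by simp
    qed
    moreover have "w = up (\<rho> - 1) (e, 0)"
      using \<zeta> * \<open>v = 0\<close> by (simp add: w' up_def algebra_simps)
    ultimately show ?thesis
      by (intro disjI1 exI[of _ "\<rho> - 1"]) simp
  next
    case False
    then have K: "K > 0"
      by (simp add: K' add_nonneg_nonneg order_less_le)
    define c where "c = (1 - \<theta>) / K"
    define Y where "Y = (c * (\<theta> - a)) *\<^sub>R e + (- c) *\<^sub>R \<iota>"
    define y where "y = c_conj e Y"
    define r where "r = K / (2 * \<theta> * (1 - \<theta>))"
    define q where "q = r *\<^sub>R y"
    define X where "X = v + J y v"
    define Z where "Z = c_im e (c_inv e q)"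
    have c: "c > 0" and r: "r > 0"
      using th0 th1 K by (simp_all add: c_def r_def)
    have rc: "r * c = 1 / (2 * \<theta>)"
      using th0 th1 K by (simp add: r_def c_def)
    have ny: "(norm y)\<^sup>2 = c\<^sup>2 * K"
      unfolding y_def norm_conj Y_def norm_real_plus_im[OF im] K'
      by (simp add: power_mult_distrib distrib_left)
    have ne: "(norm (e + y))\<^sup>2 = 4 / (N * K)"
    proof -
      have "e + y = c_conj e ((1 + c * (\<theta> - a)) *\<^sub>R e + (- c) *\<^sub>R \<iota>)"
        by (simp add: y_def Y_def c_simps algebra_simps)
      then have "(norm (e + y))\<^sup>2 = (1 + c * (\<theta> - a))\<^sup>2 + c\<^sup>2 * (norm \<iota>)\<^sup>2"
        by (simp only: norm_conj norm_real_plus_im[OF im]) simp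
      also have "\<dots> = 1 + 2 * c * (\<theta> - a) + c\<^sup>2 * K"
        by (simp add: K' power2_eq_square algebra_simps)
      also have "K * \<dots> = K + 2 * (1 - \<theta>) * (\<theta> - a) + (1 - \<theta>)\<^sup>2"
        using K by (simp add: c_def distrib_left power2_eq_square)
      also have "\<dots> = 1 - 2 * a + s"
        by (simp add: K_def power2_eq_square algebra_simps)
      also have "\<dots> = 4 / N"
        by (rule a)
      finally show ?thesis
        using K N by (simp add: field_simps)
    qed
    have y0: "y \<noteq> 0" and ey0: "e + y \<noteq> 0"
      using ny ne c K N by auto
    have q0: "q \<noteq> 0" and qr: "q + r *\<^sub>R e = r *\<^sub>R (e + y)"
      using y0 r by (simp_all add: q_def scaleR_add_right)
    have inv_q: "c_inv e q = (1 / (r * (c\<^sup>2 * K))) *\<^sub>R Y"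
      using r by (simp add: c_inv_def q_def c_simps power_mult_distrib ny) (simp add: y_def power2_eq_square)
    have inv_qr: "c_inv e (q + r *\<^sub>R e) = (N * K / (4 * r)) *\<^sub>R (e + Y)"
      using r N K unfolding qr
      by (simp add: c_inv_def c_simps power_mult_distrib ne) (simp add: y_def power2_eq_square)
    have nX: "(norm X)\<^sup>2 = (norm (e + y))\<^sup>2 * (norm v)\<^sup>2"
      using norm_J[of "e + y" v] by (simp add: X_def J.add_left power_mult_distrib)
    have re_q: "c_re e (c_inv e q) = 1 + (norm X)\<^sup>2 / 4"
    proof -
      have "c_re e \<iota> = 0"
        using im by (simp add: c_re_def)
      then have "c_re e (c_inv e q) = c * (\<theta> - a) / (r * (c\<^sup>2 * K))"
        by (simp add: inv_q Y_def c_simps)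
      also have "\<dots> = (\<theta> - a) / ((r * c) * K)"
        using c by (simp add: power2_eq_square)
      also have "\<dots> = 2 * \<theta> * (\<theta> - a) / K"
        by (simp add: rc)
      also have "\<dots> = 1 + (\<theta>\<^sup>2 - s) / K"
        using K by (simp add: field_simps) (simp add: K_def power2_eq_square algebra_simps)
      also have "(\<theta>\<^sup>2 - s) / K = (norm X)\<^sup>2 / 4"
        using N K by (simp add: nX ne nv field_simps)
      finally show ?thesis .
    qed
    (* The first coordinates of the two translated points differ by the right-hand side,
       because beta2 v X = |v|\<^sup>2 (e + Y). *)
    have diff: "c_inv e q - c_inv e (q + r *\<^sub>R e) = e - \<zeta> + ((norm v)\<^sup>2 / 2) *\<^sub>R (e + Y)"
    proof -
      define A B where "A = 1 / (r * (c\<^sup>2 * K)) - N * K / (4 * r) - (norm v)\<^sup>2 / 2"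
        and "B = 1 + N * K / (4 * r) + (norm v)\<^sup>2 / 2 - \<rho>"
      have Kr: "K / r = 2 * \<theta> * (1 - \<theta>)"
        using K th0 th1 by (simp add: r_def)
      have cK: "c * K = 1 - \<theta>"
        using K by (simp add: c_def)
      have Na: "N * a = N * s - 2 + 2 * \<rho>"
      proof -
        have "N * a = (norm \<zeta>)\<^sup>2 - 1" "N * s = N - 4 * \<rho>"
          using N by (simp_all add: a_def s field_simps)
        then show ?thesis
          by (simp add: N_def)
      qed
      have quad: "N * K / (4 * r) + (norm v)\<^sup>2 / 2 = N * (\<theta> - s) / 2"
      proof -
        have "N * K / (4 * r) = N / 4 * (K / r)"
          by simp
        then show ?thesis
          unfolding Kr nv by (simp add: power2_eq_square field_simps)
      qed
      have A: "A * c = N / 2"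
      proof -
        have "1 / (r * (c\<^sup>2 * K)) * c = 2 * \<theta> / K"
          using c rc by (simp add: power2_eq_square field_simps)
        moreover have "A = 1 / (r * (c\<^sup>2 * K)) - N * (\<theta> - s) / 2"
          unfolding A_def using quad by linarith
        ultimately have "A * c = 2 * \<theta> / K - N * (\<theta> - s) / 2 * c"
          by (simp add: left_diff_distrib)
        then have "A * c * K = 2 * \<theta> - N * (\<theta> - s) / 2 * (1 - \<theta>)"
          using K by (simp add: left_diff_distrib cK mult.assoc)
        also have "\<dots> = N / 2 * K"
        proof -
          have "4 = N * (1 - 2 * a + s)"
            using a N by (simp add: field_simps)
          then have "2 * \<theta> = \<theta> / 2 * (N * (1 - 2 * a + s))"
            by simp
          then show ?thesis
            by (simp add: K_def power2_eq_square field_simps)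
        qed
        finally show ?thesis
          using K by simp
      qed
      have B: "A * c * (\<theta> - a) = B"
      proof -
        have "N / 2 * (\<theta> - a) = 1 + N * (\<theta> - s) / 2 - \<rho>"
          using Na by (simp add: field_simps)
        then show ?thesis
          unfolding A B_def using quad by linarith
      qed
      have "A *\<^sub>R Y = B *\<^sub>R e - (N / 2) *\<^sub>R \<iota>"
        using A B by (simp add: Y_def algebra_simps flip: A B)
      then show ?thesis
        unfolding inv_q inv_qr by (subst \<zeta>) (simp add: A_def B_def algebra_simps)
    qed
    have base: "heis Z (- X) (e, 0) = (c_inv e q, - X)"
    proof -
      have "fst (heis Z (- X) (e, 0)) = c_re e (c_inv e q) *\<^sub>R e + Z"
        by (simp add: heis_def beta_simps re_q algebra_simps)
      then show ?thesis
        using c_decomp[of "c_inv e q"] by (simp add: heis_def Z_def prod_eq_iff)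
    qed
    have other: "heis Z (- X) w = (c_inv e (q + r *\<^sub>R e), v - X)"
    proof -
      have bX: "beta2 J v X = (norm v)\<^sup>2 *\<^sub>R (e + Y)"
        by (simp add: X_def beta_simps beta_same beta_J_right y_def algebra_simps)
      have "fst (heis Z (- X) w) = fst (heis Z (- X) (e, 0)) - e + \<zeta> - (1/2) *\<^sub>R beta2 J v X"
        by (simp add: heis_def beta_simps w')
      also have "\<dots> = c_inv e (q + r *\<^sub>R e)"
        using diff by (simp add: base bX algebra_simps)
      finally show ?thesis
        by (simp add: heis_def w' prod_eq_iff)
    qed
    have "geo (heis Z (- X) w) = up r (geo (heis Z (- X) (e, 0)))"
    proof -
      have "- J (q + r *\<^sub>R e) (v - X) = J q X"
        by (simp add: X_def q_def J_simps algebra_simps)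
      then show ?thesis
        by (simp add: base other geo_def up_def J_simps)
    qed
    then show ?thesis
      using r by (intro disjI2 bexI[of _ Z] exI[of _ "- X"] exI[of _ r]) (simp_all add: Z_def C_prime_iff)
  qed
qed

lemma normalise_to_base:
  assumes "z \<in> D_dom e"
  shows "heis (c_im e (fst z)) (snd z) (dil (ht e z) (e, 0)) = z"
  using assms c_decomp[of "fst z"]
  by (simp add: heis_def dil_def beta_simps prod_eq_iff ht_eq algebra_simps)
   

text \<open>
  The vertical case for arbitrary pairs follows by normalising \<open>z\<close> to the base point with an element of \<open>AN\<close>;
  the conjugate of a translation by this element is again a translation.
\<close>

proposition ray_to_boundary:
  assumes z: "z \<in> D_dom e" and w: "w \<in> D_dom e" "w \<noteq> z"
  shows "(\<exists>r>0. w = up r z) \<or>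
    (\<exists>Z\<in>C_prime e. \<exists>X. \<exists>r>0. geo (heis Z X w) = up r (geo (heis Z X z)))"
proof -
  define t Z0 X0 where "t = ht e z" and "Z0 = c_im e (fst z)" and "X0 = snd z"
  have t: "t > 0"
    using z by (simp add: t_def D_iff)
  have Z0: "Z0 \<in> C_prime e"
    by (simp add: Z0_def C_prime_iff)
  define w' where "w' = dil (1 / t) (heis (- Z0) (- X0) w)"
  have ww': "heis Z0 X0 (dil t w') = w"
    using t by (simp add: w'_def dil_inverse heis_minus)
  have zz': "heis Z0 X0 (dil t (e, 0)) = z"
    using normalise_to_base[OF z] by (simp add: t_def Z0_def X0_def)
  have "w' \<in> D_dom e"
    using t w Z0 by (simp add: w'_def dil_D heis_D neg_C_prime)
  moreover have "w' \<noteq> (e, 0)"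
    using w(2) ww' zz' by auto
  ultimately consider r where "r > 0" "w' = up r (e, 0)"
    | Z X r where "Z \<in> C_prime e" "r > 0" "geo (heis Z X w') = up r (geo (heis Z X (e, 0)))"
    using ray_to_boundary_from_base by blast
  then show ?thesis
  proof cases
    case 1
    then have "w = up (t * r) z"
      using ww' zz' by (simp add: up_dil up_heis)
    then show ?thesis
      using 1 t by (intro disjI1 exI[of _ "t * r"]) simp
  next
    case 2
    define Z1 X1 where "Z1 = t *\<^sub>R Z - Z0 - (1/2) *\<^sub>R c_im e (beta2 J X0 (sqrt t *\<^sub>R X))"
      and "X1 = sqrt t *\<^sub>R X - X0"
    have conj: "heis Z1 X1 (heis Z0 X0 (dil t y)) = dil t (heis Z X y)" for y
    proof -
      have "heis (t *\<^sub>R Z) (sqrt t *\<^sub>R X) (heis (- Z0) (- X0) x) = heis Z1 X1 x" for x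
        by (simp add: heis_heis Z1_def X1_def beta_simps c_simps)
      then show ?thesis
        using t by (simp add: dil_heis heis_minus flip: \<open>\<And>x. heis (t *\<^sub>R Z) (sqrt t *\<^sub>R X) (heis (- Z0) (- X0) x) = heis Z1 X1 x\<close>)
    qed
    have "geo (heis Z1 X1 w) = dil (1 / t) (geo (heis Z X w'))"
      using conj[of w'] t by (simp add: ww' geo_dil)
    also have "\<dots> = up (r / t) (dil (1 / t) (geo (heis Z X (e, 0))))"
      using 2 by (simp add: up_dil)
    also have "dil (1 / t) (geo (heis Z X (e, 0))) = geo (heis Z1 X1 z)"
      using conj[of "(e, 0)"] t by (simp add: zz' geo_dil)
    finally have "geo (heis Z1 X1 w) = up (r / t) (geo (heis Z1 X1 z))" .
    moreover have "Z1 \<in> C_prime e"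
      using 2 Z0 by (simp add: Z1_def C_prime_iff c_simps)
    ultimately show ?thesis
      using 2 t by (intro disjI2 bexI[of _ Z1] exI[of _ X1] exI[of _ "r / t"]) simp_all
  qed
qed


section \<open>The Riemannian metric in coordinates\<close>

lemma bounded_linear_c_im: "bounded_linear (c_im e)"
  unfolding c_im_def c_re_def by (intro bounded_linear_intros)

text \<open>
  The chart \<open>S \<rightarrow> D\<close> is inverted by height, imaginary part and second coordinate.
\<close>

lemma S_to_D_image:
  fixes z :: "'c \<times> 'v"
  assumes "z \<in> D_dom e"
  shows "inv_into (S_carrier e) (S_to_D e) z = (ht e z, c_im e (fst z), snd z)"
proof (rule inv_into_f_eq)
  show "inj_on (S_to_D e) (S_carrier e :: (real \<times> 'c \<times> 'v) set)"
  proof (rule inj_onI)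
    fix p p' :: "real \<times> 'c \<times> 'v"
    assume p: "p \<in> S_carrier e" "p' \<in> S_carrier e" "S_to_D e p = S_to_D e p'"
    obtain t Z X t' Z' X' where "p = (t, Z, X)" "p' = (t', Z', X')"
      by (metis prod.exhaust)
    then have Z: "Z \<bullet> e = 0" "Z' \<bullet> e = 0" and X: "X = X'"
      and eq: "(t + (norm X)\<^sup>2 / 4) *\<^sub>R e + Z = (t' + (norm X')\<^sup>2 / 4) *\<^sub>R e + Z'"
      using p by (auto simp: S_carrier_def C_prime_def S_to_D_def)
    have "t = t'"
      using arg_cong[OF eq, of "\<lambda>x. x \<bullet> e"] Z X by (simp add: inner_simps)
    then show "p = p'"
      using eq X \<open>p = _\<close> \<open>p' = _\<close> by simp
  qed
  show "(ht e z, c_im e (fst z), snd z) \<in> S_carrier e"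
    using assms by (simp add: S_carrier_def D_iff C_prime_iff)
  show "S_to_D e (ht e z, c_im e (fst z), snd z) = z"
    using c_decomp[of "fst z"] by (simp add: S_to_D_def ht_eq prod_eq_iff)
qed

lemma D_frame_eq:
  "D_frame e J (t, Z, X) (\<tau>, W, Y)
   = (t *\<^sub>R (\<tau> *\<^sub>R e + W) + (sqrt t / 2) *\<^sub>R beta2 J Y X, sqrt t *\<^sub>R Y)"
proof -
  define f where "f p = ((t * fst p + (X + sqrt t *\<^sub>R snd (snd p)) \<bullet> (X + sqrt t *\<^sub>R snd (snd p)) / 4) *\<^sub>R e
      + (Z + t *\<^sub>R fst (snd p) + (sqrt t / 2) *\<^sub>R c_im e (beta2 J (snd (snd p)) X)),
      X + sqrt t *\<^sub>R snd (snd p))" for p :: "real \<times> 'c \<times> 'v"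
  define F where "F p = ((t * fst p + (2 * (sqrt t * (X \<bullet> snd (snd p)))) / 4) *\<^sub>R e
      + (t *\<^sub>R fst (snd p) + (sqrt t / 2) *\<^sub>R c_im e (beta2 J (snd (snd p)) X)),
      sqrt t *\<^sub>R snd (snd p))" for p :: "real \<times> 'c \<times> 'v"
  have "S_to_D e \<circ> S_mult e J (t, Z, X) = f"
    by (rule ext) (auto simp: f_def S_to_D_def S_mult_def bracket_eq power2_norm_eq_inner)
  moreover have "(f has_derivative F) (at (1, 0, 0))"
  proof -
    have "((\<lambda>p::real \<times> 'c \<times> 'v. c_im e (beta2 J (snd (snd p)) X)) has_derivative
        (\<lambda>p. c_im e (beta2 J (snd (snd p)) X))) (at (1, 0, 0))"
      by (intro bounded_linear_imp_has_derivative
          bounded_linear_compose[OF bounded_linear_c_im]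
          bounded_linear_compose[OF beta.bounded_linear_left]
          bounded_linear_compose[OF bounded_linear_snd] bounded_linear_snd)
    note [derivative_intros] = this
    show ?thesis
      unfolding f_def F_def
      by (rule derivative_eq_intros refl | simp add: inner_commute)+
  qed
  ultimately have "D_frame e J (t, Z, X) = F"
    unfolding D_frame_def by (metis frechet_derivative_at)
  moreover have "beta2 J Y X = (X \<bullet> Y) *\<^sub>R e + c_im e (beta2 J Y X)"
    using c_decomp[of "beta2 J Y X"] by (simp add: c_re_beta)
  then have "(sqrt t / 2) *\<^sub>R beta2 J Y X = (sqrt t / 2 * (X \<bullet> Y)) *\<^sub>R e + (sqrt t / 2) *\<^sub>R c_im e (beta2 J Y X)"
    by (metis scaleR_add_right scaleR_scaleR)
  ultimately show ?thesis
    by (simp add: F_def algebra_simps)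
qed

text \<open>
  The square length of a tangent vector.  Left translation of \<open>S\<close> is affine in these coordinates, with linear part
  \<open>(a, b) \<mapsto> (t a + \<surd>t/2 beta2 b v, \<surd>t b)\<close>; the formula is the standard norm after inverting it.
\<close>

definition riem :: "'c \<times> 'v \<Rightarrow> 'c \<times> 'v \<Rightarrow> real" where
  "riem z \<xi> = (norm (fst \<xi> - (1/2) *\<^sub>R beta2 J (snd \<xi>) (snd z)))\<^sup>2 / (ht e z)\<^sup>2 + (norm (snd \<xi>))\<^sup>2 / ht e z"

lemma D_metric_eq:
  assumes z: "z \<in> D_dom e"
  shows "D_metric e J z \<xi> \<xi> = riem z \<xi>"
proof -
  obtain \<zeta> v where zz: "z = (\<zeta>, v)" by force
  obtain a b where \<xi>: "\<xi> = (a, b)" by force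
  define t where "t = ht e z"
  have t: "t > 0"
    using z by (simp add: t_def D_iff)
  define s where "s = (t, c_im e \<zeta>, v)"
  define g where "g = (1 / t) *\<^sub>R (a - (1/2) *\<^sub>R beta2 J b v)"
  have inv: "inv_into (S_tangent e) (D_frame e J s) \<xi> = (c_re e g, c_im e g, (1 / sqrt t) *\<^sub>R b)"
  proof (rule inv_into_f_eq)
    show "inj_on (D_frame e J s) (S_tangent e)"
    proof (rule inj_onI)
      fix p p' :: "real \<times> 'c \<times> 'v"
      assume p: "p \<in> S_tangent e" "p' \<in> S_tangent e" "D_frame e J s p = D_frame e J s p'"
      obtain \<tau> W Y \<tau>' W' Y' where pp: "p = (\<tau>, W, Y)" "p' = (\<tau>', W', Y')"
        by (metis prod.exhaust)
      then have W: "W \<bullet> e = 0" "W' \<bullet> e = 0" and Y: "Y = Y'"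
        and eq: "\<tau> *\<^sub>R e + W = \<tau>' *\<^sub>R e + W'"
        using p t by (auto simp: S_tangent_def C_prime_def s_def D_frame_eq)
      have "\<tau> = \<tau>'"
        using arg_cong[OF eq, of "\<lambda>x. x \<bullet> e"] W by (simp add: inner_simps)
      then show "p = p'"
        using eq Y pp by simp
    qed
    show "(c_re e g, c_im e g, (1 / sqrt t) *\<^sub>R b) \<in> S_tangent e"
      by (simp add: S_tangent_def C_prime_iff)
    have "t *\<^sub>R g = a - (1/2) *\<^sub>R beta2 J b v"
      using t by (simp add: g_def)
    then show "D_frame e J s (c_re e g, c_im e g, (1 / sqrt t) *\<^sub>R b) = \<xi>"
      using t c_decomp[of g] by (simp add: s_def D_frame_eq \<xi> beta_simps)
  qed
  have "D_metric e J z \<xi> \<xi> = (c_re e g)\<^sup>2 + (norm (c_im e g))\<^sup>2 + (norm ((1 / sqrt t) *\<^sub>R b))\<^sup>2"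
  proof -
    have sq: "(x, y, w) \<bullet> (x, y, w) = x\<^sup>2 + (norm y)\<^sup>2 + (norm w)\<^sup>2" for x :: real and y :: 'c and w :: 'v
      unfolding power2_norm_eq_inner by (simp add: power2_eq_square)
    have s: "inv_into (S_carrier e) (S_to_D e) z = s"
      using S_to_D_image[OF z] by (simp add: s_def t_def zz)
    show ?thesis
      unfolding D_metric_def Let_def s inv by (rule sq)
  qed
  also have "\<dots> = (norm g)\<^sup>2 + (norm b)\<^sup>2 / t"
    using t by (simp add: norm_c_decomp[of g] power_divide)
  also have "\<dots> = riem z \<xi>"
    using t by (simp add: riem_def zz[symmetric] \<xi> g_def t_def[symmetric] power_divide) (simp add: zz)
  finally show ?thesis .
qed

lemma continuous_ht: "continuous_on UNIV (ht e :: 'c \<times> 'v \<Rightarrow> real)"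
  unfolding ht_eq[abs_def] c_re_def by (intro continuous_intros) auto

lemma open_D: "open (D_dom e :: ('c \<times> 'v) set)"
proof -
  have "D_dom e = ht e -` {0<..} \<inter> (UNIV :: ('c \<times> 'v) set)"
    by (auto simp: D_iff)
  then show ?thesis
    using continuous_ht by (metis open_UNIV open_greaterThan continuous_on_open_vimage)
qed

text \<open>
  Only the square lengths at single points are recorded, since this is all that comparing
  distances along a curve requires.
\<close>

definition metric_preserving :: "('c \<times> 'v \<Rightarrow> 'c \<times> 'v) \<Rightarrow> bool" where
  "metric_preserving f \<longleftrightarrow> (\<forall>z\<in>D_dom e. f z \<in> D_dom e \<and>
     (\<exists>f'. (f has_derivative f') (at z) \<and> (\<forall>\<xi>. riem (f z) (f' \<xi>) = riem z \<xi>)))"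

lemma metric_preserving_compose:
  assumes f: "metric_preserving f" and g: "metric_preserving g"
  shows "metric_preserving (g \<circ> f)"
  unfolding metric_preserving_def
proof (intro ballI conjI)
  fix z :: "'c \<times> 'v" assume z: "z \<in> D_dom e"
  obtain f' where f': "f z \<in> D_dom e" "(f has_derivative f') (at z)" "\<And>\<xi>. riem (f z) (f' \<xi>) = riem z \<xi>"
    using f z unfolding metric_preserving_def by blast
  obtain g' where g': "g (f z) \<in> D_dom e" "(g has_derivative g') (at (f z))"
      "\<And>\<xi>. riem (g (f z)) (g' \<xi>) = riem (f z) \<xi>"
    using g f'(1) unfolding metric_preserving_def by blast
  show "(g \<circ> f) z \<in> D_dom e"
    using g' by simp
  show "\<exists>h. (g \<circ> f has_derivative h) (at z) \<and> (\<forall>\<xi>. riem ((g \<circ> f) z) (h \<xi>) = riem z \<xi>)"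
    using diff_chain_at[OF f'(2) g'(2)] f'(3) g'(3) by (intro exI[of _ "g' \<circ> f'"]) auto
qed

section \<open>Distance and metric\<close>

lemma has_vector_derivative_quotient:
  fixes f :: "real \<Rightarrow> 'a::real_normed_vector"
  assumes "(f has_vector_derivative d) (at s)"
  shows "((\<lambda>x. (1 / (x - s)) *\<^sub>R (f x - f s)) \<longlongrightarrow> d) (at s)"
proof -
  have "((\<lambda>x. (1 / norm (x - s)) *\<^sub>R (f x - f s - (x - s) *\<^sub>R d)) \<longlongrightarrow> 0) (at s)"
    using assms unfolding has_vector_derivative_def has_derivative_at2 by (simp add: diff_diff_eq)
  then have "((\<lambda>x. norm ((1 / norm (x - s)) *\<^sub>R (f x - f s - (x - s) *\<^sub>R d))) \<longlongrightarrow> 0) (at s)"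
    by (rule tendsto_norm_zero)
  moreover have "\<forall>\<^sub>F x in at s. norm ((1 / norm (x - s)) *\<^sub>R (f x - f s - (x - s) *\<^sub>R d))
      = norm ((1 / (x - s)) *\<^sub>R (f x - f s) - d)"
  proof (rule eventually_mono[OF eventually_neq_at_within[of s]])
    fix x :: real assume "x \<noteq> s"
    then have "(1 / (x - s)) *\<^sub>R (f x - f s) - d = (1 / (x - s)) *\<^sub>R (f x - f s - (x - s) *\<^sub>R d)"
      by (simp add: scaleR_diff_right)
    then show "norm ((1 / norm (x - s)) *\<^sub>R (f x - f s - (x - s) *\<^sub>R d)) = norm ((1 / (x - s)) *\<^sub>R (f x - f s) - d)"
      by simp
  qed
  ultimately have "((\<lambda>x. norm ((1 / (x - s)) *\<^sub>R (f x - f s) - d)) \<longlongrightarrow> 0) (at s)"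
    by (simp add: tendsto_cong)
  then show ?thesis
    by (simp add: tendsto_norm_zero_iff Lim_null[of _ d])
qed

lemma ht_hvd:
  assumes "(c has_vector_derivative \<xi>) (at s)"
  shows "((\<lambda>x. ht e (c x)) has_vector_derivative
     c_re e (fst \<xi> - (1/2) *\<^sub>R beta2 J (snd \<xi>) (snd (c s)))) (at s)"
proof -
  define u v where "u x = fst (c x)" and "v x = snd (c x)" for x
  have "(u has_vector_derivative fst \<xi>) (at s)" "(v has_vector_derivative snd \<xi>) (at s)"
    unfolding u_def v_def
    using bounded_linear.has_vector_derivative[OF bounded_linear_fst assms]
      bounded_linear.has_vector_derivative[OF bounded_linear_snd assms] by auto
  then have "((\<lambda>x. u x \<bullet> e - (v x \<bullet> v x) / 4) has_vector_derivative
      fst \<xi> \<bullet> e - (v s \<bullet> snd \<xi> + snd \<xi> \<bullet> v s) / 4) (at s)"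
    unfolding has_vector_derivative_def
    by (auto intro!: derivative_eq_intros simp: inner_simps algebra_simps)
  moreover have "fst \<xi> \<bullet> e - (v s \<bullet> snd \<xi> + snd \<xi> \<bullet> v s) / 4
      = c_re e (fst \<xi> - (1/2) *\<^sub>R beta2 J (snd \<xi>) (snd (c s)))"
    by (simp add: c_simps c_re_beta c_re_def[of e "fst \<xi>"] inner_commute v_def)
  ultimately show ?thesis
    by (simp add: ht_eq c_re_def[of e "fst (c _)"] power2_norm_eq_inner u_def v_def)
qed

lemma polar_ht_hvd:
  assumes "(c has_vector_derivative \<xi>) (at s)"
  shows "((\<lambda>x. polar_ht (c x) w) has_vector_derivative (fst \<xi> - (1/2) *\<^sub>R beta2 J (snd \<xi>) (snd w))) (at s)"
proof -
  have "((\<lambda>x. fst (c x)) has_vector_derivative fst \<xi>) (at s)"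
       "((\<lambda>x. beta2 J (snd (c x)) (snd w)) has_vector_derivative beta2 J (snd \<xi>) (snd w)) (at s)"
    using bounded_linear.has_vector_derivative[OF bounded_linear_fst assms]
      bounded_linear.has_vector_derivative[OF bounded_linear_compose[OF beta.bounded_linear_left bounded_linear_snd] assms]
    by auto
  then show ?thesis
    unfolding polar_ht_def by (auto intro!: derivative_eq_intros)
qed

text \<open>
  To second order \<open>cosh\<^sup>2 (d/2) - 1\<close> is \<open>d\<^sup>2/4\<close>, so the metric can be recovered from \<open>cosh_sq\<close>.  In this
  way no derivative of the inversion is ever computed: that it is differentiable and preserves \<open>cosh_sq\<close> suffices.
\<close>

lemma speed_limit:
  assumes c: "(c has_vector_derivative \<xi>) (at s)" and D: "c s \<in> D_dom e"
  shows "((\<lambda>x. (cosh_sq (c x) (c s) - 1) / (x - s)\<^sup>2) \<longlongrightarrow> riem (c s) \<xi> / 4) (at s)"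
proof -
  define \<alpha> where "\<alpha> = fst \<xi> - (1/2) *\<^sub>R beta2 J (snd \<xi>) (snd (c s))"
  define h where "h x = ht e (c x)" for x
  define A where "A x = (1 / (x - s)) *\<^sub>R (h x - h s)" for x
  define I where "I x = c_im e ((1 / (x - s)) *\<^sub>R (polar_ht (c x) (c s) - polar_ht (c s) (c s)))" for x
  define B where "B x = (1 / (x - s)) *\<^sub>R (snd (c x) - snd (c s))" for x
  have h0: "h s > 0"
    using D by (simp add: h_def D_iff)
  have hd: "(h has_vector_derivative c_re e \<alpha>) (at s)"
    unfolding h_def \<alpha>_def by (rule ht_hvd[OF c])
  have lh: "(h \<longlongrightarrow> h s) (at s)"
    using has_vector_derivative_continuous[OF hd] by (simp add: continuous_at)
  have lA: "(A \<longlongrightarrow> c_re e \<alpha>) (at s)"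
    unfolding A_def using has_vector_derivative_quotient[OF hd] .
  have lI: "(I \<longlongrightarrow> c_im e \<alpha>) (at s)"
    unfolding I_def \<alpha>_def
    by (rule bounded_linear.tendsto[OF bounded_linear_c_im has_vector_derivative_quotient[OF polar_ht_hvd[OF c]]])
  have lB: "(B \<longlongrightarrow> snd \<xi>) (at s)"
    unfolding B_def
    using has_vector_derivative_quotient[OF bounded_linear.has_vector_derivative[OF bounded_linear_snd c]] .
  have "((\<lambda>x. ((A x)\<^sup>2 + (norm (I x))\<^sup>2 + (h x + h s) / 2 * (norm (B x))\<^sup>2
      + (x - s)\<^sup>2 * (norm (B x))^4 / 16) / (4 * h x * h s)) \<longlongrightarrow>
     ((c_re e \<alpha>)\<^sup>2 + (norm (c_im e \<alpha>))\<^sup>2 + (h s + h s) / 2 * (norm (snd \<xi>))\<^sup>2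
      + (s - s)\<^sup>2 * (norm (snd \<xi>))^4 / 16) / (4 * h s * h s)) (at s)"
    using h0 by (intro tendsto_intros lA lI lB lh) auto
  also have "((c_re e \<alpha>)\<^sup>2 + (norm (c_im e \<alpha>))\<^sup>2 + (h s + h s) / 2 * (norm (snd \<xi>))\<^sup>2
      + (s - s)\<^sup>2 * (norm (snd \<xi>))^4 / 16) / (4 * h s * h s) = riem (c s) \<xi> / 4"
    using h0 by (simp add: riem_def norm_c_decomp[of \<alpha>, symmetric] h_def[symmetric] \<alpha>_def[symmetric]
        power2_eq_square[of "h s"] add_divide_distrib)
  finally have lim: "((\<lambda>x. ((A x)\<^sup>2 + (norm (I x))\<^sup>2 + (h x + h s) / 2 * (norm (B x))\<^sup>2
      + (x - s)\<^sup>2 * (norm (B x))^4 / 16) / (4 * h x * h s)) \<longlongrightarrow> riem (c s) \<xi> / 4) (at s)" .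
  have "\<forall>\<^sub>F x in at s. 0 < h x"
    using order_tendstoD(1)[OF lh h0] .
  then have "\<forall>\<^sub>F x in at s. ((A x)\<^sup>2 + (norm (I x))\<^sup>2 + (h x + h s) / 2 * (norm (B x))\<^sup>2
      + (x - s)\<^sup>2 * (norm (B x))^4 / 16) / (4 * h x * h s) = (cosh_sq (c x) (c s) - 1) / (x - s)\<^sup>2"
    using eventually_neq_at_within[of s]
  proof eventually_elim
    case (elim x)
    define d where "d = x - s"
    have d: "d \<noteq> 0"
      using elim by (simp add: d_def)
    have eqs: "h x - h s = d * A x" "snd (c x) - snd (c s) = d *\<^sub>R B x"
        "c_im e (polar_ht (c x) (c s)) = d *\<^sub>R I x"
      using d by (simp_all add: A_def B_def I_def d_def[symmetric] c_simps polar_ht_self)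
    have "(norm (polar_ht (c x) (c s)))\<^sup>2 = (h x + h s + d\<^sup>2 * (norm (B x))\<^sup>2 / 4)\<^sup>2 + d\<^sup>2 * (norm (I x))\<^sup>2"
      unfolding norm_polar_ht eqs h_def[symmetric] by (simp add: power_mult_distrib)
    (* (h + k + m)\<^sup>2 - 4 h k = (h - k)\<^sup>2 + 2 (h + k) m + m\<^sup>2 with m = |B|\<^sup>2 d\<^sup>2 / 4;
       each summand is divisible by d\<^sup>2. *)
    also have "\<dots> - 4 * h x * h s = (h x - h s)\<^sup>2 + d\<^sup>2 * (norm (I x))\<^sup>2
        + d\<^sup>2 * ((h x + h s) / 2 * (norm (B x))\<^sup>2) + d\<^sup>2 * (d\<^sup>2 * (norm (B x))^4 / 16)"
      by (simp add: power2_eq_square power4_eq_xxxx field_simps)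
    also have "\<dots> = d\<^sup>2 * ((A x)\<^sup>2 + (norm (I x))\<^sup>2 + (h x + h s) / 2 * (norm (B x))\<^sup>2 + d\<^sup>2 * (norm (B x))^4 / 16)"
      unfolding eqs by (simp add: power_mult_distrib algebra_simps)
    finally have eq: "(norm (polar_ht (c x) (c s)))\<^sup>2 - 4 * h x * h s = \<dots>" .
    have "cosh_sq (c x) (c s) - 1 = ((norm (polar_ht (c x) (c s)))\<^sup>2 - 4 * h x * h s) / (4 * h x * h s)"
      using elim h0 by (simp add: cosh_sq_def h_def[symmetric] diff_divide_distrib)
    then show ?case
      unfolding eq using d by (simp add: d_def[symmetric])
  qed
  then show ?thesis
    by (rule Lim_transform_eventually[OF lim])
qed

lemma metric_preserving_if_cosh_sq:
  assumes D: "\<And>z. z \<in> D_dom e \<Longrightarrow> f z \<in> D_dom e"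
    and q: "\<And>z w. z \<in> D_dom e \<Longrightarrow> w \<in> D_dom e \<Longrightarrow> cosh_sq (f z) (f w) = cosh_sq z w"
    and diff: "\<And>z. z \<in> D_dom e \<Longrightarrow> f differentiable (at z)"
  shows "metric_preserving f"
  unfolding metric_preserving_def
proof (intro ballI conjI)
  fix z :: "'c \<times> 'v" assume z: "z \<in> D_dom e"
  show fz: "f z \<in> D_dom e"
    by (rule D[OF z])
  obtain f' where f': "(f has_derivative f') (at z)"
    using diff[OF z] by (auto simp: differentiable_def)
  have "riem (f z) (f' \<xi>) = riem z \<xi>" for \<xi>
  proof -
    define c where "c x = z + x *\<^sub>R \<xi>" for x :: real
    have c0 [simp]: "c 0 = z"
      by (simp add: c_def)
    have c: "(c has_vector_derivative \<xi>) (at 0)"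
      unfolding c_def by (auto intro!: derivative_eq_intros)
    have fc: "((\<lambda>x. f (c x)) has_vector_derivative f' \<xi>) (at 0)"
      using vector_derivative_diff_chain_within[OF c, of f f'] f'
      by (simp add: o_def has_derivative_at_withinI)
    have "(c \<longlongrightarrow> z) (at 0)"
      using has_vector_derivative_continuous[OF c] by (simp add: continuous_at)
    then have "\<forall>\<^sub>F x in at 0. c x \<in> D_dom e"
      using open_D z by (rule topological_tendstoD)
    then have ev: "\<forall>\<^sub>F x in at 0. (cosh_sq (f (c x)) (f (c 0)) - 1) / (x - 0)\<^sup>2 = (cosh_sq (c x) (c 0) - 1) / (x - 0)\<^sup>2"
      by eventually_elim (simp add: q z)
    have "((\<lambda>x. (cosh_sq (f (c x)) (f (c 0)) - 1) / (x - 0)\<^sup>2) \<longlongrightarrow> riem (f z) (f' \<xi>) / 4) (at 0)"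
      using speed_limit[OF fc] fz by simp
    from Lim_transform_eventually[OF this ev]
    have "((\<lambda>x. (cosh_sq (c x) (c 0) - 1) / (x - 0)\<^sup>2) \<longlongrightarrow> riem (f z) (f' \<xi>) / 4) (at 0)"
      .
    moreover have "((\<lambda>x. (cosh_sq (c x) (c 0) - 1) / (x - 0)\<^sup>2) \<longlongrightarrow> riem z \<xi> / 4) (at 0)"
      using speed_limit[OF c] z by simp
    ultimately have "riem (f z) (f' \<xi>) / 4 = riem z \<xi> / 4"
      by (rule tendsto_unique[OF trivial_limit_at])
    then show ?thesis by simp
  qed
  then show "\<exists>f'. (f has_derivative f') (at z) \<and> (\<forall>\<xi>. riem (f z) (f' \<xi>) = riem z \<xi>)"
    using f' by blast
qed

end


section \<open>Isometries preserve the distance\<close>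

lemma frechet_derivative_cong_open:
  assumes "open U" "x \<in> U" "\<And>y. y \<in> U \<Longrightarrow> f y = g y"
  shows "f differentiable (at x) \<longleftrightarrow> g differentiable (at x)"
    and "frechet_derivative f (at x) = frechet_derivative g (at x)"
proof -
  have "(f has_derivative f') (at x) \<longleftrightarrow> (g has_derivative f') (at x)" for f'
    using has_derivative_transform_within_open[of f f' x UNIV U g]
      has_derivative_transform_within_open[of g f' x UNIV U f] assms by auto
  then show "f differentiable (at x) \<longleftrightarrow> g differentiable (at x)"
    and "frechet_derivative f (at x) = frechet_derivative g (at x)"
    by (simp_all add: differentiable_def frechet_derivative_def)
qed

lemma Ck_on_cong:
  assumes "open U" "\<And>y. y \<in> U \<Longrightarrow> f y = g y"
  shows "Ck_on k f U \<longleftrightarrow> Ck_on k g U"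
  using assms(2)
proof (induction k arbitrary: f g)
  case 0
  then show ?case
    using continuous_on_cong[OF refl, of U f g] by simp
next
  case (Suc k)
  have "Ck_on k (\<lambda>x. frechet_derivative f (at x) h) U \<longleftrightarrow> Ck_on k (\<lambda>x. frechet_derivative g (at x) h) U" for h
  proof (rule Suc.IH)
    fix y assume "y \<in> U"
    from frechet_derivative_cong_open(2)[OF assms(1) this, of f g] Suc.prems
    show "frechet_derivative f (at y) h = frechet_derivative g (at y) h"
      by simp
  qed
  moreover have "f differentiable (at x) \<longleftrightarrow> g differentiable (at x)" if "x \<in> U" for x
    by (rule frechet_derivative_cong_open(1)[OF assms(1) that Suc.prems])
  ultimately show ?case by simp
qed

lemma smooth_on_cong:
  assumes "open U" "\<And>y. y \<in> U \<Longrightarrow> f y = g y"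
  shows "smooth_on f U \<longleftrightarrow> smooth_on g U"
  using Ck_on_cong[OF assms] by (simp add: smooth_on_def)

lemma smooth_on_differentiable: "smooth_on f U \<Longrightarrow> x \<in> U \<Longrightarrow> f differentiable (at x)"
  using Ck_on.simps(2)[of 0 f U] unfolding smooth_on_def by blast

lemma weighted_cauchy_schwarz:
  fixes x a :: "'a::real_inner" and y b :: "'b::real_inner" and h :: real
  assumes "h > 0"
  shows "(x \<bullet> a + y \<bullet> b)\<^sup>2 \<le> (h\<^sup>2 * (norm x)\<^sup>2 + h * (norm y)\<^sup>2) * ((norm a)\<^sup>2 / h\<^sup>2 + (norm b)\<^sup>2 / h)"
proof -
  define p q where "p = (h *\<^sub>R x, sqrt h *\<^sub>R y)" and "q = ((1 / h) *\<^sub>R a, (1 / sqrt h) *\<^sub>R b)"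
  have "x \<bullet> a + y \<bullet> b = p \<bullet> q"
    using assms by (simp add: p_def q_def)
  moreover have "p \<bullet> p = h\<^sup>2 * (norm x)\<^sup>2 + h * (norm y)\<^sup>2" "q \<bullet> q = (norm a)\<^sup>2 / h\<^sup>2 + (norm b)\<^sup>2 / h"
    using assms unfolding power2_norm_eq_inner
    by (simp_all add: p_def q_def power2_eq_square)
  ultimately show ?thesis
    using Cauchy_Schwarz_ineq[of p q] by simp
qed

context j2c
begin

text \<open>
  The eikonal inequality: a distance function has gradient of norm at most \<open>1\<close>, which for
  \<open>q = cosh\<^sup>2 (d/2)\<close> reads \<open>|\<nabla>q|\<^sup>2 \<le> q (q - 1)\<close>.  The logarithmic derivative of \<open>cosh_sq\<close> is an
  inner product with the vector \<open>(x, y)\<close>, whose square norm is exactly \<open>1 - 1/q\<close>.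
\<close>

lemma cosh_sq_derivative_le:
  assumes c: "(c has_vector_derivative \<xi>) (at s)" and D: "c s \<in> D_dom e" "w \<in> D_dom e"
  obtains d where "((\<lambda>x. cosh_sq (c x) w) has_real_derivative d) (at s)"
    and "d\<^sup>2 \<le> cosh_sq (c s) w * (cosh_sq (c s) w - 1) * riem (c s) \<xi>"
proof -
  define a b where "a = fst \<xi> - (1/2) *\<^sub>R beta2 J (snd \<xi>) (snd (c s))" and "b = snd \<xi>"
  define u where "u = snd (c s) - snd w"
  define F where "F x = polar_ht (c x) w" for x
  define P where "P = F s"
  define P' where "P' = fst \<xi> - (1/2) *\<^sub>R beta2 J b (snd w)"
  define N where "N = (norm P)\<^sup>2"
  define H where "H x = ht e (c x)" for x
  define h k where "h = H s" and "k = ht e w"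
  define q where "q = cosh_sq (c s) w"
  have hk: "h > 0" "k > 0"
    using D by (simp_all add: h_def H_def k_def D_iff)
  have q1: "q \<ge> 1"
    using cosh_sq_ge_1[OF D] by (simp add: q_def)
  have q: "q = N / (4 * h * k)"
    by (simp add: q_def cosh_sq_def N_def P_def F_def h_def H_def k_def)
  have N: "N > 0"
  proof -
    have "N \<noteq> 0"
      using q1 q by auto
    then show ?thesis
      by (simp add: N_def)
  qed
  have dF: "(F has_derivative (\<lambda>x. x *\<^sub>R P')) (at s)"
    using polar_ht_hvd[OF c, of w] by (simp add: F_def[abs_def] P'_def b_def has_vector_derivative_def)
  have dH: "(H has_derivative (\<lambda>x. x *\<^sub>R c_re e a)) (at s)"
    using ht_hvd[OF c] by (simp add: H_def[abs_def] a_def has_vector_derivative_def)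
  define L where "L = 2 * (P \<bullet> P') / N - c_re e a / h"
  have "((\<lambda>x. F x \<bullet> F x) has_derivative (\<lambda>x. P \<bullet> (x *\<^sub>R P') + (x *\<^sub>R P') \<bullet> P)) (at s)"
    unfolding P_def by (rule has_derivative_inner[OF dF dF])
  moreover have "(\<lambda>x. P \<bullet> (x *\<^sub>R P') + (x *\<^sub>R P') \<bullet> P) = (*) (2 * (P \<bullet> P'))"
    by (auto simp: inner_commute)
  ultimately have dN: "((\<lambda>x. F x \<bullet> F x) has_real_derivative 2 * (P \<bullet> P')) (at s)"
    by (simp add: has_field_derivative_def)
  have "(H has_real_derivative c_re e a) (at s)"
    using dH by (simp add: has_field_derivative_def mult.commute[of _ "c_re e a"])
  then have dH': "((\<lambda>x. 4 * k * H x) has_real_derivative 4 * k * c_re e a) (at s)"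
    by (rule DERIV_cmult)
  have NF: "F s \<bullet> F s = N"
    by (simp add: N_def P_def power2_norm_eq_inner)
  have "4 * k * H s \<noteq> 0"
    using hk by (simp add: h_def)
  from DERIV_divide[OF dN dH' this]
  have "((\<lambda>x. (F x \<bullet> F x) / (4 * k * H x)) has_real_derivative (q * L)) (at s)"
  proof (rule DERIV_cong)
    show "(2 * (P \<bullet> P') * (4 * k * H s) - F s \<bullet> F s * (4 * k * c_re e a)) / (4 * k * H s * (4 * k * H s)) = q * L"
      using hk N unfolding NF h_def[symmetric] q L_def by (simp add: field_simps)
  qed
  then have deriv: "((\<lambda>x. cosh_sq (c x) w) has_real_derivative (q * L)) (at s)"
    by (simp add: cosh_sq_def power2_norm_eq_inner F_def H_def k_def mult.commute mult.left_commute)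
  define x y where "x = (2 / N) *\<^sub>R P - (1 / h) *\<^sub>R e" and "y = (1 / N) *\<^sub>R J P u"
  have L: "L = x \<bullet> a + y \<bullet> b"
  proof -
    have "P' = a + (1/2) *\<^sub>R beta2 J b u"
      by (simp add: P'_def a_def b_def u_def beta_simps algebra_simps)
    then have "P \<bullet> P' = P \<bullet> a + (J P u \<bullet> b) / 2"
      using beta_inner[of b u P] by (simp add: inner_simps inner_commute)
    then show ?thesis
      by (simp add: L_def x_def y_def c_re_def inner_simps inner_commute[of e a] add_divide_distrib distrib_left)
  qed
  have "h\<^sup>2 * (norm x)\<^sup>2 + h * (norm y)\<^sup>2 = 1 - 1 / q"
  proof -
    have reP: "c_re e P = h + k + (norm u)\<^sup>2 / 4"
      by (simp add: P_def F_def re_polar_ht h_def H_def k_def u_def)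
    have PP: "P \<bullet> P = N"
      by (simp add: N_def power2_norm_eq_inner)
    have "(norm x)\<^sup>2 = 4 / N - 4 * c_re e P / (h * N) + 1 / h\<^sup>2"
      unfolding power2_norm_eq_inner using N hk PP
      by (simp add: x_def inner_simps inner_commute[of e P] c_re_def power2_eq_square field_simps)
    moreover have "(norm y)\<^sup>2 = (norm u)\<^sup>2 / N"
      using N by (simp add: y_def norm_J power_mult_distrib N_def[symmetric] power_divide power2_eq_square[of N])
    ultimately have "h\<^sup>2 * (norm x)\<^sup>2 + h * (norm y)\<^sup>2
        = h\<^sup>2 * (4 / N - 4 * c_re e P / (h * N) + 1 / h\<^sup>2) + h * ((norm u)\<^sup>2 / N)"
      by simp
    also have "\<dots> = 1 + (4 * h\<^sup>2 - 4 * h * c_re e P + h * (norm u)\<^sup>2) / N"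
      using N hk by (simp add: field_simps power2_eq_square)
    also have "4 * h\<^sup>2 - 4 * h * c_re e P + h * (norm u)\<^sup>2 = - (4 * h * k)"
      by (simp add: reP power2_eq_square algebra_simps)
    also have "1 + - (4 * h * k) / N = 1 - 1 / q"
      by (simp add: q)
    finally show ?thesis .
  qed
  moreover have "riem (c s) \<xi> = (norm a)\<^sup>2 / h\<^sup>2 + (norm b)\<^sup>2 / h"
    by (simp add: riem_def a_def b_def h_def H_def)
  ultimately have "L\<^sup>2 \<le> (1 - 1 / q) * riem (c s) \<xi>"
    using weighted_cauchy_schwarz[OF hk(1), of x a y b] unfolding L by simp
  then have "q\<^sup>2 * L\<^sup>2 \<le> q\<^sup>2 * ((1 - 1 / q) * riem (c s) \<xi>)"
    by (intro mult_left_mono) auto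
  also have "\<dots> = q * (q - 1) * riem (c s) \<xi>"
    using q1 by (simp add: power2_eq_square field_simps)
  finally show ?thesis
    using deriv that by (simp add: q_def power_mult_distrib)
qed

lemma cosh_sq_self: "z \<in> D_dom e \<Longrightarrow> cosh_sq z z = 1"
  by (simp add: cosh_sq_def polar_ht_self D_iff power2_eq_square)

text \<open>
  The function \<open>arcosh y\<close> grows with slope at most \<open>1\<close>, but it is not differentiable where \<open>y = 1\<close>.  Multiplying
  \<open>y\<close> by \<open>cosh \<epsilon> > 1\<close> keeps the bound on the slope and moves the argument away from \<open>1\<close>.
\<close>

lemma cosh_growth:
  fixes y :: "real \<Rightarrow> real"
  assumes T: "T \<ge> 0" and y0: "y 0 = 1" and y1: "\<And>s. 1 \<le> y s"
    and dy: "\<And>s. \<exists>d. (y has_real_derivative d) (at s) \<and> d\<^sup>2 \<le> (y s)\<^sup>2 - 1"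
  shows "y T \<le> cosh T"
proof -
  have *: "cosh \<epsilon> * y T \<le> cosh (T + \<epsilon>)" if "\<epsilon> > 0" for \<epsilon>
  proof -
    define l where "l = cosh \<epsilon>"
    have l: "l > 1"
      using that by (simp add: l_def cosh_real_strict_mono[of 0 \<epsilon>, simplified])
    have ly: "l * y s > 1" for s
      using mult_mono[of 1 l 1 "y s"] mult_strict_right_mono[of 1 l "y s"] l y1[of s] by linarith
    have "arcosh (l * y T) - T \<le> arcosh (l * y 0) - 0"
    proof (rule DERIV_nonpos_imp_nonincreasing[OF T])
      fix s :: real
      obtain d where d: "(y has_real_derivative d) (at s)" "d\<^sup>2 \<le> (y s)\<^sup>2 - 1"
        using dy by blast
      have "((\<lambda>s. arcosh (l * y s) - s) has_real_derivative (l * d) / sqrt ((l * y s)\<^sup>2 - 1) - 1) (at s)"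
        using DERIV_diff[OF DERIV_chain2[OF arcosh_real_has_field_derivative[OF ly[of s]] DERIV_cmult[OF d(1), of l]]
            DERIV_ident]
        by simp
      moreover have "(l * d) / sqrt ((l * y s)\<^sup>2 - 1) \<le> 1"
      proof -
        have "(l * d)\<^sup>2 \<le> l\<^sup>2 * ((y s)\<^sup>2 - 1)"
          using d(2) by (simp add: power_mult_distrib mult_left_mono)
        also have "\<dots> \<le> (l * y s)\<^sup>2 - 1"
          using l by (simp add: power_mult_distrib right_diff_distrib one_le_power)
        finally have "\<bar>l * d\<bar> \<le> sqrt ((l * y s)\<^sup>2 - 1)"
          by (metis real_sqrt_abs real_sqrt_le_mono)
        moreover have "0 < sqrt ((l * y s)\<^sup>2 - 1)"
          using ly[of s] by (simp add: one_less_power)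
        ultimately show ?thesis
          by simp
      qed
      ultimately show "\<exists>D. ((\<lambda>s. arcosh (l * y s) - s) has_real_derivative D) (at s) \<and> D \<le> 0"
        by (intro exI[of _ "(l * d) / sqrt ((l * y s)\<^sup>2 - 1) - 1"]) simp
    qed
    also have "arcosh (l * y 0) = \<epsilon>"
      using that by (simp add: y0 l_def arcosh_cosh_real)
    finally have "arcosh (l * y T) \<le> T + \<epsilon>"
      by simp
    moreover have "0 \<le> arcosh (l * y T)"
      using ly[of T] by simp
    ultimately have "cosh (arcosh (l * y T)) \<le> cosh (T + \<epsilon>)"
      using cosh_real_nonneg_le_iff T that by force
    then show ?thesis
      using ly[of T] by (simp add: l_def)
  qed
  have "((\<lambda>\<epsilon>. cosh \<epsilon> * y T) \<longlongrightarrow> cosh 0 * y T) (at_right 0)"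
    "((\<lambda>\<epsilon>. cosh (T + \<epsilon>)) \<longlongrightarrow> cosh (T + 0)) (at_right 0)"
    by (intro tendsto_intros)+
  moreover have "\<forall>\<^sub>F \<epsilon> in at_right 0. cosh \<epsilon> * y T \<le> cosh (T + \<epsilon>)"
    using eventually_at_right_less[of "0::real"] by eventually_elim (rule *)
  ultimately have "cosh 0 * y T \<le> cosh (T + 0)"
    by (intro tendsto_le[OF trivial_limit_at_right_real])
  then show ?thesis by simp
qed

text \<open>
  The vertical segment from \<open>z\<close>, with heights growing exponentially, has unit speed and length equal
  to the distance of its end points.  Its image under \<open>f\<close> has unit speed as well.
\<close>

lemma vertical_contraction:
  assumes f: "metric_preserving f" and z: "z \<in> D_dom e" and r: "r > 0"
  shows "cosh_sq (f (up r z)) (f z) \<le> cosh_sq (up r z) z"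
proof -
  define h where "h = ht e z"
  have h: "h > 0"
    using z by (simp add: h_def D_iff)
  define T where "T = ln ((h + r) / h)"
  have T: "T \<ge> 0" and eT: "exp T = (h + r) / h"
    using h r by (simp_all add: T_def)
  define c where "c s = up (h * (exp s - 1)) z" for s
  have c: "(c has_vector_derivative ((h * exp s) *\<^sub>R e, 0)) (at s)" for s
  proof -
    have "((\<lambda>s. (fst z + (h * (exp s - 1)) *\<^sub>R e, snd z)) has_vector_derivative ((h * exp s) *\<^sub>R e, 0)) (at s)"
      unfolding has_vector_derivative_def by (auto intro!: derivative_eq_intros)
    then show ?thesis
      by (simp add: c_def[abs_def] up_def)
  qed
  have hc: "ht e (c s) = h * exp s" for s
    by (simp add: c_def ht_up h_def[symmetric] algebra_simps)
  have cD: "c s \<in> D_dom e" for s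
    using h by (simp add: D_iff hc)
  have speed: "riem (c s) ((h * exp s) *\<^sub>R e, 0) = 1" for s
    using h by (simp add: riem_def hc beta_simps power_mult_distrib)
  define y where "y s = 2 * cosh_sq (f (c s)) (f (c 0)) - 1" for s
  have fD: "f (c s) \<in> D_dom e" for s
    using f cD unfolding metric_preserving_def by blast
  have "y T \<le> cosh T"
  proof (rule cosh_growth[OF T])
    show "y 0 = 1"
      by (simp add: y_def cosh_sq_self fD)
    show "1 \<le> y s" for s
      using cosh_sq_ge_1[OF fD fD, of s 0] by (simp add: y_def)
    show "\<exists>d. (y has_real_derivative d) (at s) \<and> d\<^sup>2 \<le> (y s)\<^sup>2 - 1" for s
    proof -
      obtain f' where f': "(f has_derivative f') (at (c s))" "\<And>\<xi>. riem (f (c s)) (f' \<xi>) = riem (c s) \<xi>"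
        using f cD unfolding metric_preserving_def by blast
      have "((\<lambda>s. f (c s)) has_vector_derivative f' ((h * exp s) *\<^sub>R e, 0)) (at s)"
        using vector_derivative_diff_chain_within[OF c, of f f'] f'(1)
        by (simp add: o_def has_derivative_at_withinI)
      from cosh_sq_derivative_le[OF this fD fD, of 0]
      obtain d where d: "((\<lambda>x. cosh_sq (f (c x)) (f (c 0))) has_real_derivative d) (at s)"
        "d\<^sup>2 \<le> cosh_sq (f (c s)) (f (c 0)) * (cosh_sq (f (c s)) (f (c 0)) - 1) * riem (f (c s)) (f' ((h * exp s) *\<^sub>R e, 0))"
        by blast
      have "(y has_real_derivative (2 * d)) (at s)"
        unfolding y_def by (auto intro!: derivative_eq_intros d(1))
      moreover have "(2 * d)\<^sup>2 \<le> (y s)\<^sup>2 - 1"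
        using d(2) by (simp add: f'(2) speed y_def power_mult_distrib) (simp add: power2_eq_square algebra_simps)
      ultimately show ?thesis by blast
    qed
  qed
  moreover have "c 0 = z" "c T = up r z"
  proof -
    have "h * (exp T - 1) = r"
      using h by (simp add: eT field_simps)
    then show "c T = up r z"
      by (simp add: c_def)
  qed (simp add: c_def up_def)
  moreover have "cosh T = 2 * cosh_sq (up r z) z - 1"
  proof -
    have "norm (polar_ht (up r z) z) = 2 * h + r"
      using h r by (simp add: polar_ht_up polar_ht_self h_def[symmetric] flip: scaleR_add_left)
    moreover have "ht e (up r z) = h + r"
      by (simp add: ht_up h_def)
    ultimately have "2 * cosh_sq (up r z) z - 1 = 2 * ((2 * h + r)\<^sup>2 / (4 * (h + r) * h)) - 1"
      by (simp add: cosh_sq_def h_def[symmetric])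
    moreover have "2 * ((2 * h + r)\<^sup>2 / (4 * (h + r) * h)) - 1 = ((h + r) / h + h / (h + r)) / 2"
    proof -
      define k where "k = h + r"
      have k: "k > 0" "2 * h + r = h + k"
        using h r by (simp_all add: k_def)
      have "2 * ((h + k)\<^sup>2 / (4 * k * h)) - 1 = (k / h + h / k) / 2"
        using h k(1) by (simp add: field_simps power2_eq_square)
      then show ?thesis
        unfolding k(2) k_def[symmetric] .
    qed
    moreover have "cosh T = ((h + r) / h + h / (h + r)) / 2"
      by (simp add: cosh_def exp_minus eT)
    ultimately show ?thesis
      by simp
  qed
  ultimately show ?thesis
    by (simp add: y_def)
qed

lemma heis_differentiable: "heis Z X differentiable (at z)"
proof -
  have "bounded_linear (\<lambda>z::'c \<times> 'v. fst z + (1/2) *\<^sub>R beta2 J (snd z) X)"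
    by (intro bounded_linear_add bounded_linear_fst bounded_linear_scaleR_right[THEN bounded_linear_compose]
        bounded_linear_compose[OF beta.bounded_linear_left bounded_linear_snd])
  then have "((\<lambda>z::'c \<times> 'v. fst z + (1/2) *\<^sub>R beta2 J (snd z) X) has_derivative
      (\<lambda>z. fst z + (1/2) *\<^sub>R beta2 J (snd z) X)) (at z)"
    by (rule bounded_linear_imp_has_derivative)
  then have "((\<lambda>z::'c \<times> 'v. (((norm X)\<^sup>2 / 4) *\<^sub>R e + Z + (fst z + (1/2) *\<^sub>R beta2 J (snd z) X), X + snd z))
      has_derivative (\<lambda>z. (0 + (fst z + (1/2) *\<^sub>R beta2 J (snd z) X), 0 + snd z))) (at z)"
    by (rule has_derivative_Pair[OF has_derivative_add[OF has_derivative_const]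
        has_derivative_add[OF has_derivative_const bounded_linear_imp_has_derivative[OF bounded_linear_snd]]])
  then show ?thesis
    unfolding heis_def[abs_def] add.assoc by (rule differentiableI)
qed

lemma geo_differentiable:
  assumes "fst z \<noteq> 0"
  shows "geo differentiable (at z)"
proof -
  have "bounded_linear (\<lambda>z::'c \<times> 'v. c_conj e (fst z))"
    unfolding c_conj_def c_re_def
    by (intro bounded_linear_intros bounded_linear_compose[OF bounded_linear_c_im])
  then have 1: "((\<lambda>z::'c \<times> 'v. c_conj e (fst z)) has_derivative (\<lambda>z. c_conj e (fst z))) (at z)"
    by (rule bounded_linear_imp_has_derivative)
  have d: "(\<lambda>z::'c \<times> 'v. fst z) differentiable (at z)"
    by (rule bounded_linear_imp_differentiable[OF bounded_linear_fst])
  have "(\<lambda>z::'c \<times> 'v. 1 / (fst z \<bullet> fst z)) differentiable (at z)"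
    using assms by (intro differentiable_divide[OF differentiable_const differentiable_inner[OF d d]]) auto
  then obtain f where 2: "((\<lambda>z::'c \<times> 'v. 1 / (fst z \<bullet> fst z)) has_derivative f) (at z)"
    by (auto simp: differentiable_def)
  define g where "g w = (1 / (fst z \<bullet> fst z)) *\<^sub>R c_conj e (fst w) + f w *\<^sub>R c_conj e (fst z)" for w :: "'c \<times> 'v"
  have "(\<lambda>z::'c \<times> 'v. c_inv e (fst z)) = (\<lambda>z. (1 / (fst z \<bullet> fst z)) *\<^sub>R c_conj e (fst z))"
    by (simp add: c_inv_def power2_norm_eq_inner)
  then have 3: "((\<lambda>z::'c \<times> 'v. c_inv e (fst z)) has_derivative g) (at z)"
    unfolding g_def using has_derivative_scaleR[OF 2 1] by (simp only:)
  have "((\<lambda>z::'c \<times> 'v. (c_inv e (fst z), - J (c_inv e (fst z)) (snd z))) has_derivative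
     (\<lambda>w. (g w, - (J (c_inv e (fst z)) (snd w) + J (g w) (snd z))))) (at z)"
    by (rule has_derivative_Pair[OF 3 has_derivative_minus[OF J.FDERIV[OF 3
          bounded_linear_imp_has_derivative[OF bounded_linear_snd]]]])
  then show ?thesis
    unfolding geo_def[abs_def] by (rule differentiableI)
qed

lemma metric_preserving_heis: "Z \<in> C_prime e \<Longrightarrow> metric_preserving (heis Z X)"
  by (rule metric_preserving_if_cosh_sq) (simp_all add: heis_D cosh_sq_heis heis_differentiable)

lemma metric_preserving_geo: "metric_preserving geo"
  by (rule metric_preserving_if_cosh_sq) (simp_all add: geo_D cosh_sq_geo geo_differentiable fst_D_nonzero)

text \<open>
  Every pair of points is the image of a vertical pair under a composition of known distance
  preserving maps, which preserve the metric too; precompose \<open>f\<close> with it.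
\<close>

proposition metric_preserving_contraction:
  assumes f: "metric_preserving f" and zw: "z \<in> D_dom e" "w \<in> D_dom e"
  shows "cosh_sq (f z) (f w) \<le> cosh_sq z w"
proof (cases "z = w")
  case True
  then show ?thesis
    using f zw unfolding metric_preserving_def by (simp add: cosh_sq_self)
next
  case False
  then consider r where "r > 0" "z = up r w"
    | Z X r where "Z \<in> C_prime e" "r > 0" "geo (heis Z X z) = up r (geo (heis Z X w))"
    using ray_to_boundary[OF zw(2,1)] by blast
  then show ?thesis
  proof cases
    case 1
    then show ?thesis
      using vertical_contraction[OF f zw(2)] by simp
  next
    case 2
    define k where "k = heis (- Z) (- X) \<circ> geo"
    have k: "metric_preserving (f \<circ> k)"
      unfolding k_def
      by (intro metric_preserving_compose f metric_preserving_heis metric_preserving_geo neg_C_prime 2)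
    define y where "y = geo (heis Z X w)"
    have hD: "heis Z X z \<in> D_dom e" "heis Z X w \<in> D_dom e"
      using 2 zw by (simp_all add: heis_D)
    have y: "y \<in> D_dom e"
      using hD by (simp add: y_def geo_D)
    have "k y = w" "k (up r y) = z"
      using 2 hD by (simp_all add: k_def y_def geo_geo fst_D_nonzero heis_minus flip: 2(3))
    then have "cosh_sq (f z) (f w) \<le> cosh_sq (up r y) y"
      using vertical_contraction[OF k y 2(2)] by simp
    also have "\<dots> = cosh_sq z w"
      using 2 hD by (simp add: y_def cosh_sq_geo cosh_sq_heis flip: 2(3))
    finally show ?thesis .
  qed
qed

lemma isometry_metric_preserving:
  assumes "g \<in> D_isometries e J"
  shows "metric_preserving g"
  unfolding metric_preserving_def
proof (intro ballI conjI)
  fix z :: "'c \<times> 'v" assume z: "z \<in> D_dom e"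
  have g: "g \<in> Bij (D_dom e)" "smooth_on g (D_dom e)"
    using assms by (auto simp: D_isometries_def)
  show gz: "g z \<in> D_dom e"
    using g(1) z Bij_imp_funcset by blast
  have "(g has_derivative frechet_derivative g (at z)) (at z)"
    using smooth_on_differentiable[OF g(2) z] frechet_derivative_works by blast
  moreover have "riem (g z) (frechet_derivative g (at z) \<xi>) = riem z \<xi>" for \<xi>
  proof -
    have "\<forall>z\<in>D_dom e. \<forall>\<xi> \<eta>. D_metric e J (g z) (frechet_derivative g (at z) \<xi>) (frechet_derivative g (at z) \<eta>)
        = D_metric e J z \<xi> \<eta>"
      using assms unfolding D_isometries_def by blast
    then show ?thesis
      using z gz D_metric_eq by metis
  qed
  ultimately show "\<exists>f'. (g has_derivative f') (at z) \<and> (\<forall>\<xi>. riem (g z) (f' \<xi>) = riem z \<xi>)"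
    by blast
qed

lemma isometry_inverse:
  assumes "g \<in> D_isometries e J"
  shows "restrict (inv_into (D_dom e) g) (D_dom e) \<in> D_isometries e J"
proof -
  define k where "k = restrict (inv_into (D_dom e) g) (D_dom e)"
  have g: "g \<in> Bij (D_dom e)" "smooth_on g (D_dom e)" "smooth_on (inv_into (D_dom e) g) (D_dom e)"
    and gm: "\<And>z \<xi> \<eta>. z \<in> D_dom e \<Longrightarrow>
      D_metric e J (g z) (frechet_derivative g (at z) \<xi>) (frechet_derivative g (at z) \<eta>) = D_metric e J z \<xi> \<eta>"
    using assms unfolding D_isometries_def by blast+
  have k: "k \<in> Bij (D_dom e)"
    unfolding k_def by (rule restrict_inv_into_Bij[OF g(1)])
  have bij: "bij_betw g (D_dom e) (D_dom e)"
    using g(1) by (simp add: Bij_def)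
  have kD: "k z \<in> D_dom e" if "z \<in> D_dom e" for z
    using Bij_imp_funcset[OF k] that by blast
  have gk: "g (k z) = z" and kg: "k (g z) = z" and gD: "g z \<in> D_dom e"
    if "z \<in> D_dom e" for z
    using that bij
    by (auto simp: k_def bij_betw_inv_into_right bij_betw_inv_into_left bij_betwE)
  have sk: "smooth_on k (D_dom e)"
    using g(3) smooth_on_cong[OF open_D, of k "inv_into (D_dom e) g"] by (simp add: k_def)
  have "inv_into (D_dom e) k z = g z" if "z \<in> D_dom e" for z
    using that k by (intro inv_into_f_eq) (auto simp: kg gD Bij_def bij_betw_def)
  then have sg: "smooth_on (inv_into (D_dom e) k) (D_dom e)"
    using g(2) smooth_on_cong[OF open_D, of "inv_into (D_dom e) k" g] by simp
  have "D_metric e J (k w) (frechet_derivative k (at w) \<xi>) (frechet_derivative k (at w) \<eta>) = D_metric e J w \<xi> \<eta>"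
    if w: "w \<in> D_dom e" for w \<xi> \<eta>
  proof -
    have dk: "(k has_derivative frechet_derivative k (at w)) (at w)"
      using smooth_on_differentiable[OF sk w] frechet_derivative_works by blast
    have "(g has_derivative frechet_derivative g (at (k w))) (at (k w))"
      using smooth_on_differentiable[OF g(2) kD[OF w]] frechet_derivative_works by blast
    from diff_chain_at[OF dk this]
    have "((\<lambda>z. z) has_derivative (frechet_derivative g (at (k w)) \<circ> frechet_derivative k (at w))) (at w)"
      using has_derivative_transform_within_open[OF _ open_D w, of "g \<circ> k" _ UNIV "\<lambda>z. z"] gk by simp
    then have "frechet_derivative g (at (k w)) \<circ> frechet_derivative k (at w) = (\<lambda>z. z)"
      using has_derivative_unique[OF _ has_derivative_ident] by blast
    then have "frechet_derivative g (at (k w)) (frechet_derivative k (at w) \<xi>) = \<xi>" for \<xi>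
      by (metis comp_apply)
    then show ?thesis
      using gm[OF kD[OF w], of "frechet_derivative k (at w) \<xi>" "frechet_derivative k (at w) \<eta>"] gk[OF w]
      by simp
  qed
  then show ?thesis
    using k sk sg by (simp add: D_isometries_def k_def)
qed

proposition isometry_cosh_sq:
  assumes g: "g \<in> D_isometries e J" and zw: "z \<in> D_dom e" "w \<in> D_dom e"
  shows "cosh_sq (g z) (g w) = cosh_sq z w"
proof (rule antisym)
  show "cosh_sq (g z) (g w) \<le> cosh_sq z w"
    by (rule metric_preserving_contraction[OF isometry_metric_preserving[OF g] zw])
  define k where "k = restrict (inv_into (D_dom e) g) (D_dom e)"
  have bij: "bij_betw g (D_dom e) (D_dom e)"
    using g by (simp add: D_isometries_def Bij_def)
  then have gD: "g z \<in> D_dom e" "g w \<in> D_dom e"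
    using zw bij_betwE by blast+
  have "cosh_sq (k (g z)) (k (g w)) \<le> cosh_sq (g z) (g w)"
    unfolding k_def
    by (rule metric_preserving_contraction[OF isometry_metric_preserving[OF isometry_inverse[OF g]] gD])
  then show "cosh_sq z w \<le> cosh_sq (g z) (g w)"
    using bij zw gD by (simp add: k_def bij_betw_inv_into_left)
qed


section \<open>The Bruhat decomposition\<close>

lemma polar_ht_axis: "polar_ht x (s *\<^sub>R e, 0) = fst x + s *\<^sub>R e"
  by (simp add: polar_ht_def c_simps beta_simps)

lemma ht_axis [simp]: "ht e (s *\<^sub>R e, 0 :: 'v) = s"
  by (simp add: ht_eq c_simps)

lemma cosh_sq_axis: "cosh_sq x (s *\<^sub>R e, 0) = ((norm (fst x))\<^sup>2 + 2 * s * c_re e (fst x) + s\<^sup>2) / (4 * s * ht e x)"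
proof -
  have "(norm (fst x + s *\<^sub>R e))\<^sup>2 = (norm (fst x))\<^sup>2 + 2 * s * c_re e (fst x) + s\<^sup>2"
    unfolding power2_norm_eq_inner by (simp add: inner_simps c_re_def inner_commute power2_eq_square)
  then show ?thesis
    by (simp add: cosh_sq_def polar_ht_axis mult.commute mult.left_commute)
qed

text \<open>
  Two points of the vertical geodesic through the base point determine by their distances each
  point of this geodesic, because the triangle inequality becomes an equality there.  In coordinates: the
  difference of the two equations gives \<open>s \<le> h\<close> from \<open>h \<le> \<rho>\<close>, and then \<open>h\<^sup>2 \<le> |\<zeta>|\<^sup>2\<close> gives \<open>h \<le> s\<close>.
\<close>

lemma axis_point_unique:
  assumes x: "x \<in> D_dom e" and s: "s > 0"
    and q1: "cosh_sq x (1 *\<^sub>R e, 0) = cosh_sq (s *\<^sub>R e, 0) (1 *\<^sub>R e, 0)"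
    and q2: "cosh_sq x (2 *\<^sub>R e, 0) = cosh_sq (s *\<^sub>R e, 0) (2 *\<^sub>R e, 0)"
  shows "x = (s *\<^sub>R e, 0)"
proof -
  define h \<rho> n where "h = ht e x" and "\<rho> = c_re e (fst x)" and "n = (norm (fst x))\<^sup>2"
  have h: "h > 0"
    using x by (simp add: h_def D_iff)
  have h\<rho>: "h = \<rho> - (norm (snd x))\<^sup>2 / 4"
    by (simp add: h_def \<rho>_def ht_eq)
  have n: "n = \<rho>\<^sup>2 + (norm (c_im e (fst x)))\<^sup>2"
    unfolding n_def \<rho>_def by (rule norm_c_decomp)
  have le1: "h \<le> \<rho>"
    unfolding h\<rho> by simp
  moreover have "\<rho>\<^sup>2 \<le> n"
    unfolding n by simp
  ultimately have le: "h \<le> \<rho>" "h\<^sup>2 \<le> n"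
    using power_mono[OF le1, of 2] h by linarith+
  have "(n + 2 * \<rho> + 1) / (4 * h) = (s\<^sup>2 + 2 * s + 1) / (4 * s)"
    "(n + 4 * \<rho> + 4) / (8 * h) = (s\<^sup>2 + 4 * s + 4) / (8 * s)"
    using q1 q2 unfolding cosh_sq_axis by (simp_all add: n_def \<rho>_def h_def c_simps)
  then have E1: "s * (n + 2 * \<rho> + 1) = h * (s\<^sup>2 + 2 * s + 1)"
    and E2: "s * (n + 4 * \<rho> + 4) = h * (s\<^sup>2 + 4 * s + 4)"
    using s h by (simp_all add: field_simps)
  have d: "2 * (s * \<rho>) + 3 * s = 2 * (s * h) + 3 * h"
    using E1 E2 by (simp add: algebra_simps)
  moreover have "s * h \<le> s * \<rho>"
    using le s by simp
  ultimately have hs: "s \<le> h"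
    by linarith
  have "s * n = h * s\<^sup>2 - 2 * (h - s)"
    using E1 d by (simp add: algebra_simps)
  moreover have "s * h\<^sup>2 \<le> s * n"
    using le s by simp
  ultimately have "s * h * (h - s) \<le> - 2 * (h - s)"
    by (simp add: power2_eq_square algebra_simps)
  then have "(s * h + 2) * (h - s) \<le> 0"
    by (simp add: algebra_simps)
  moreover have "s * h + 2 > 0"
    using s h by (simp add: add_pos_pos)
  ultimately have h_eq: "h = s"
    using hs by (simp add: mult_le_0_iff)
  then have "\<rho> = s"
    using d s by simp
  then have "snd x = 0"
    using h\<rho> h_eq by simp
  have "s * n = s * s\<^sup>2"
    using \<open>s * n = _\<close> h_eq by simp
  then have "c_im e (fst x) = 0"
    using n \<open>\<rho> = s\<close> s by simp
  then show ?thesis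
    using \<open>snd x = 0\<close> \<open>\<rho> = s\<close> by (subst pair_eq_iff) (simp add: \<rho>_def c_simps)
qed

definition dist_preserving :: "('c \<times> 'v \<Rightarrow> 'c \<times> 'v) \<Rightarrow> bool" where
  "dist_preserving f \<longleftrightarrow> (\<forall>z\<in>D_dom e. f z \<in> D_dom e) \<and> (\<forall>z\<in>D_dom e. \<forall>w\<in>D_dom e. cosh_sq (f z) (f w) = cosh_sq z w)"

lemma dist_preservingD: "dist_preserving f \<Longrightarrow> z \<in> D_dom e \<Longrightarrow> f z \<in> D_dom e"
    "dist_preserving f \<Longrightarrow> z \<in> D_dom e \<Longrightarrow> w \<in> D_dom e \<Longrightarrow> cosh_sq (f z) (f w) = cosh_sq z w"
  by (auto simp: dist_preserving_def)

lemma axis_D: "0 < s \<Longrightarrow> (s *\<^sub>R e, 0 :: 'v) \<in> D_dom e"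
  by (simp add: D_iff)

text \<open>
  Up to sign and a constant the logarithm of the height is the Busemann function of the fixed geodesic.  Instead
  of a limit along the geodesic one compares leading coefficients: \<open>4 s cosh_sq z (s e, 0)\<close> is a
  polynomial in \<open>s\<close> with leading coefficient \<open>1 / ht z\<close>.
\<close>

lemma ht_preserved_if_axis_fixed:
  assumes h: "dist_preserving h" and fix1: "h (1 *\<^sub>R e, 0) = (1 *\<^sub>R e, 0)" and fix2: "h (2 *\<^sub>R e, 0) = (2 *\<^sub>R e, 0)"
    and z: "z \<in> D_dom e"
  shows "ht e (h z) = ht e z"
proof -
  have fix_axis: "h (s *\<^sub>R e, 0) = (s *\<^sub>R e, 0)" if s: "s > 0" for s
  proof (rule axis_point_unique[OF dist_preservingD(1)[OF h axis_D[OF s]] s])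
    show "cosh_sq (h (s *\<^sub>R e, 0)) (1 *\<^sub>R e, 0) = cosh_sq (s *\<^sub>R e, 0) (1 *\<^sub>R e, 0)"
      using dist_preservingD(2)[OF h axis_D[OF s] axis_D[of 1]] unfolding fix1 by simp
    show "cosh_sq (h (s *\<^sub>R e, 0)) (2 *\<^sub>R e, 0) = cosh_sq (s *\<^sub>R e, 0) (2 *\<^sub>R e, 0)"
      using dist_preservingD(2)[OF h axis_D[OF s] axis_D[of 2]] unfolding fix2 by simp
  qed
  define n' \<rho>' k' n \<rho> k where "n' = (norm (fst (h z)))\<^sup>2" and "\<rho>' = c_re e (fst (h z))" and "k' = ht e (h z)"
    and "n = (norm (fst z))\<^sup>2" and "\<rho> = c_re e (fst z)" and "k = ht e z"
  have k: "k > 0" "k' > 0"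
    using z dist_preservingD(1)[OF h z] by (simp_all add: k_def k'_def D_iff)
  have eq: "k * (n' + 2 * s * \<rho>' + s\<^sup>2) = k' * (n + 2 * s * \<rho> + s\<^sup>2)" if s: "s > 0" for s
  proof -
    have "cosh_sq (h z) (s *\<^sub>R e, 0) = cosh_sq z (s *\<^sub>R e, 0)"
      using dist_preservingD(2)[OF h z axis_D[OF s]] fix_axis[OF s] by simp
    then have "(n' + 2 * s * \<rho>' + s\<^sup>2) / (4 * s * k') = (n + 2 * s * \<rho> + s\<^sup>2) / (4 * s * k)"
      unfolding cosh_sq_axis by (simp add: n'_def n_def \<rho>'_def \<rho>_def k'_def k_def)
    then show ?thesis
      using k s by (simp add: frac_eq_eq) (simp add: mult.commute)
  qed
  have "k = k'"
    using eq[of 1] eq[of 2] eq[of 3] by (simp add: algebra_simps)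
  then show ?thesis
    by (simp add: k_def k'_def)
qed

lemma dist_preserving_compose: "dist_preserving f \<Longrightarrow> dist_preserving g \<Longrightarrow> dist_preserving (g \<circ> f)"
  by (simp add: dist_preserving_def)

lemma dist_preserving_heis: "Z \<in> C_prime e \<Longrightarrow> dist_preserving (heis Z X)"
  and dist_preserving_dil: "0 < t \<Longrightarrow> dist_preserving (dil t)"
  and dist_preserving_geo: "dist_preserving geo"
  by (simp_all add: dist_preserving_def heis_D cosh_sq_heis dil_D cosh_sq_dil geo_D cosh_sq_geo)

lemma to_base:
  assumes "z \<in> D_dom e"
  shows "dil (1 / ht e z) (heis (- c_im e (fst z)) (- snd z) z) = (1 *\<^sub>R e, 0)"
proof -
  have h: "0 < ht e z"
    using assms by (simp add: D_iff)
  have "heis (- c_im e (fst z)) (- snd z) z = dil (ht e z) (e, 0)"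
    by (subst normalise_to_base[OF assms, symmetric]) (rule heis_minus)
  then show ?thesis
    using h by (simp add: dil_inverse)
qed

text \<open>
  An element of \<open>AN\<close> moves the image of \<open>(e, 0)\<close> back, and distances leave only two positions for the image of
  \<open>(2 e, 0)\<close> on the axis, of which one is below \<open>(e, 0)\<close>.
\<close>

lemma ht_scaled_if_vertical:
  assumes f: "dist_preserving f" and r: "r > 0" and v: "f (2 *\<^sub>R e, 0) = up r (f (1 *\<^sub>R e, 0))"
  obtains c where "c > 0" and "\<And>z. z \<in> D_dom e \<Longrightarrow> ht e (f z) = c * ht e z"
proof -
  define y where "y = f (1 *\<^sub>R e, 0)"
  have y: "y \<in> D_dom e"
    unfolding y_def by (rule dist_preservingD(1)[OF f axis_D]) simp
  define k where "k = ht e y"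
  have k: "k > 0"
    using y by (simp add: k_def D_iff)
  define j where "j = dil (1 / k) \<circ> heis (- c_im e (fst y)) (- snd y)"
  have Im: "- c_im e (fst y) \<in> C_prime e"
    by (simp add: C_prime_iff c_simps)
  have j: "dist_preserving j"
    unfolding j_def using k by (intro dist_preserving_compose dist_preserving_heis dist_preserving_dil Im) auto
  define h where "h = j \<circ> f"
  have h: "dist_preserving h"
    unfolding h_def by (rule dist_preserving_compose[OF f j])
  have fix1: "h (1 *\<^sub>R e, 0) = (1 *\<^sub>R e, 0)"
    using to_base[OF y] by (simp add: h_def j_def k_def y_def)
  define u where "u = 1 + r / k"
  have u: "u > 1"
    using r k by (simp add: u_def)
  have hu: "h (2 *\<^sub>R e, 0) = (u *\<^sub>R e, 0)"
  proof -
    have "h (2 *\<^sub>R e, 0) = up (r / k) (j y)"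
      by (simp add: h_def v y_def j_def up_heis up_dil)
    also have "j y = (1 *\<^sub>R e, 0)"
      using fix1 by (simp add: h_def y_def)
    finally show ?thesis
      by (simp add: up_def u_def algebra_simps)
  qed
  have "cosh_sq (u *\<^sub>R e, 0) (1 *\<^sub>R e, 0) = cosh_sq (2 *\<^sub>R e, 0) (1 *\<^sub>R e, 0)"
    using dist_preservingD(2)[OF h axis_D[of 2] axis_D[of 1]] unfolding fix1 hu by simp
  then have "(u\<^sup>2 + 2 * u + 1) / (4 * u) = 9 / 8"
    unfolding cosh_sq_axis by (simp add: c_simps)
  then have "2 * u\<^sup>2 - 5 * u + 2 = 0"
    using u by (simp add: field_simps)
  then have "(2 * u - 1) * (u - 2) = 0"
    by (simp add: power2_eq_square algebra_simps)
  then have fix2: "h (2 *\<^sub>R e, 0) = (2 *\<^sub>R e, 0)"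
    using u hu by auto
  have "ht e (f z) = k * ht e z" if "z \<in> D_dom e" for z
  proof -
    have "ht e z = ht e (h z)"
      by (rule ht_preserved_if_axis_fixed[OF h fix1 fix2 that, symmetric])
    also have "\<dots> = ht e (f z) / k"
      using k by (simp add: h_def j_def ht_dil ht_heis[OF Im])
    finally show ?thesis
      using k by simp
  qed
  then show ?thesis
    using that k by blast
qed

definition module_aut :: "('c \<Rightarrow> 'c) \<Rightarrow> ('v \<Rightarrow> 'v) \<Rightarrow> bool" where
  "module_aut \<phi> \<psi> \<longleftrightarrow> orthogonal_transformation \<phi> \<and> orthogonal_transformation \<psi> \<and> \<phi> e = e \<and>
     (\<forall>\<zeta> v. \<psi> (J \<zeta> v) = J (\<phi> \<zeta>) (\<psi> v))"

text \<open>
  Distances and heights together give the norm of \<open>polar_ht\<close>.  The map commutes with vertical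
  translation, and raising one argument shows that the real part and the norm of the imaginary part of \<open>polar_ht\<close>
  are preserved separately.  The real part shows that the second coordinate of the image is an isometry \<open>\<psi>\<close>
  of the second coordinate; comparison with points over \<open>0\<close> shows that the imaginary part of the first coordinate
  is an isometry of the imaginary part.  Pairs for which \<open>polar_ht\<close> is real then
  give \<open>beta2 (\<psi> u) (\<psi> v) = \<phi> (beta2 u v)\<close>, hence compatibility with \<open>J\<close>.
\<close>

lemma module_aut_if_ht_preserved:
  assumes h: "dist_preserving h" and fix1: "h (e, 0) = (e, 0)"
    and ht: "\<And>z. z \<in> D_dom e \<Longrightarrow> ht e (h z) = ht e z"
  obtains \<phi> \<psi> where "module_aut \<phi> \<psi>"
    and "\<And>z. z \<in> D_dom e \<Longrightarrow> h z = (\<phi> (fst z), \<psi> (snd z))"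
proof -
  have hD: "h z \<in> D_dom e" if "z \<in> D_dom e" for z
    using dist_preservingD(1)[OF h that] .
  have nf: "norm (polar_ht (h z) (h w)) = norm (polar_ht z w)" if zw: "z \<in> D_dom e" "w \<in> D_dom e" for z w
  proof -
    have "(norm (polar_ht (h z) (h w)))\<^sup>2 = (norm (polar_ht z w))\<^sup>2"
      using dist_preservingD(2)[OF h zw] zw by (simp add: cosh_sq_def ht D_iff)
    then show ?thesis by simp
  qed
  (* Among the points of height ht z + 1 the point up 1 z is the one nearest to z. *)
  have h_up: "h (up 1 z) = up 1 (h z)" if z: "z \<in> D_dom e" for z
  proof -
    define w y where "w = h (up 1 z)" and "y = h z"
    have uz: "up 1 z \<in> D_dom e"
      using z by (simp add: up_D)
    have k: "ht e y = ht e z" "ht e w = ht e z + 1" "ht e z > 0"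
      using z uz by (simp_all add: w_def y_def ht ht_up D_iff)
    have "polar_ht (up 1 z) z = (2 * ht e z + 1) *\<^sub>R e"
      by (simp add: polar_ht_up polar_ht_self scaleR_add_left)
    then have "norm (polar_ht w y) = 2 * ht e z + 1"
      using nf[OF uz z] k by (simp add: w_def y_def)
    then have "(2 * ht e z + 1)\<^sup>2 = (2 * ht e z + 1 + (norm (snd w - snd y))\<^sup>2 / 4)\<^sup>2 + (norm (c_im e (polar_ht w y)))\<^sup>2"
      using norm_polar_ht[of w y] k by (simp add: algebra_simps)
    moreover have "(2 * ht e z + 1)\<^sup>2 + ((norm (snd w - snd y))\<^sup>2 / 4)\<^sup>2 \<le> (2 * ht e z + 1 + (norm (snd w - snd y))\<^sup>2 / 4)\<^sup>2"
      using k by (simp add: power2_sum)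
    ultimately have "((norm (snd w - snd y))\<^sup>2 / 4)\<^sup>2 + (norm (c_im e (polar_ht w y)))\<^sup>2 \<le> 0"
      by linarith
    then have "snd w = snd y" "c_im e (polar_ht w y) = 0"
      by (simp_all add: sum_power2_le_zero_iff)
    moreover from this have "c_im e (fst w) = c_im e (fst y)"
      by (simp add: im_polar_ht beta_same c_simps)
    ultimately show ?thesis
      unfolding w_def[symmetric] y_def[symmetric] using k
      by (subst point_eq_iff) (simp add: ht_up, simp add: up_def c_simps)
  qed
  have re: "c_re e (polar_ht (h z) (h w)) = c_re e (polar_ht z w)" if zw: "z \<in> D_dom e" "w \<in> D_dom e" for z w
  proof -
    have "norm (polar_ht (h z) (h w) + e) = norm (polar_ht z w + e)"
      using nf[OF up_D[OF zw(1)] zw(2), of 1] zw by (simp add: h_up polar_ht_up)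
    moreover have "(norm (a + e))\<^sup>2 = (norm a)\<^sup>2 + 2 * c_re e a + 1" for a
      unfolding power2_norm_eq_inner by (simp add: inner_simps c_re_def inner_commute)
    ultimately show ?thesis
      using nf[OF zw] by (metis add_left_cancel add_right_cancel mult_cancel_left zero_neq_numeral)
  qed
  have dv: "norm (snd (h z) - snd (h w)) = norm (snd z - snd w)" if zw: "z \<in> D_dom e" "w \<in> D_dom e" for z w
  proof -
    have "(norm (snd (h z) - snd (h w)))\<^sup>2 = (norm (snd z - snd w))\<^sup>2"
      using re[OF zw] zw by (simp add: re_polar_ht ht)
    then show ?thesis by simp
  qed
  have im: "norm (c_im e (polar_ht (h z) (h w))) = norm (c_im e (polar_ht z w))"
    if zw: "z \<in> D_dom e" "w \<in> D_dom e" for z w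
  proof -
    have "(norm (c_im e (polar_ht (h z) (h w))))\<^sup>2 = (norm (c_im e (polar_ht z w)))\<^sup>2"
      using norm_c_decomp[of "polar_ht (h z) (h w)"] norm_c_decomp[of "polar_ht z w"] re[OF zw] nf[OF zw] by simp
    then show ?thesis by simp
  qed
  define pz where "pz a = (e + c_im e a, 0 :: 'v)" for a
  define pv where "pv v = ((1 + (norm v)\<^sup>2 / 4) *\<^sub>R e, v)" for v :: 'v
  have pz: "pz a \<in> D_dom e" and pv: "pv v \<in> D_dom e" for a v
    by (simp_all add: pz_def pv_def D_iff ht_eq c_simps)
  have e0: "pz 0 = (e, 0)" "pv 0 = (e, 0)"
    by (simp_all add: pz_def pv_def c_simps)
  define \<psi> where "\<psi> v = snd (h (pv v))" for v
  define \<phi> where "\<phi> a = c_re e a *\<^sub>R e + c_im e (fst (h (pz a)))" for a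
  have \<phi>_re: "c_re e (\<phi> a) = c_re e a" and \<phi>_im: "c_im e (\<phi> a) = c_im e (fst (h (pz a)))" for a
    by (simp_all add: \<phi>_def c_simps)
  have snd_h: "snd (h z) = \<psi> (snd z)" if "z \<in> D_dom e" for z
    using dv[OF that pv, of "snd z"] by (simp add: \<psi>_def pv_def)
  have \<psi>0: "\<psi> 0 = 0"
    by (simp add: \<psi>_def e0 fix1)
  have \<psi>_dist: "norm (\<psi> v - \<psi> w) = norm (v - w)" for v w
    using dv[OF pv pv, of v w] by (simp add: \<psi>_def pv_def)
  have \<psi>: "orthogonal_transformation \<psi>"
    unfolding orthogonal_transformation_isometry by (simp add: \<psi>0 dist_norm \<psi>_dist)
  have im_h: "c_im e (fst (h z)) = c_im e (\<phi> (fst z))" if z: "z \<in> D_dom e" for z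
  proof -
    have "snd (h (pz (fst z))) = 0"
      using snd_h[OF pz] \<psi>0 by (simp add: pz_def)
    then have "norm (c_im e (fst (h z)) - c_im e (\<phi> (fst z))) = norm (c_im e (polar_ht (h z) (h (pz (fst z)))))"
      by (simp add: im_polar_ht beta_simps c_simps \<phi>_im)
    also have "\<dots> = norm (c_im e (polar_ht z (pz (fst z))))"
      by (rule im[OF z pz])
    also have "\<dots> = 0"
      by (simp add: im_polar_ht pz_def beta_simps c_simps)
    finally show ?thesis by simp
  qed
  have \<phi>_dist: "norm (\<phi> a - \<phi> b) = norm (a - b)" for a b
  proof -
    have "snd (h (pz c)) = 0" for c
      using snd_h[OF pz] \<psi>0 by (simp add: pz_def)
    then have "norm (c_im e (\<phi> a - \<phi> b)) = norm (c_im e (polar_ht (h (pz a)) (h (pz b))))"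
      by (simp add: im_polar_ht beta_simps c_simps \<phi>_im)
    also have "\<dots> = norm (c_im e (a - b))"
      unfolding im[OF pz pz] by (simp add: im_polar_ht pz_def beta_simps c_simps)
    finally have "(norm (\<phi> a - \<phi> b))\<^sup>2 = (norm (a - b))\<^sup>2"
      unfolding norm_c_decomp[of "\<phi> a - \<phi> b"] norm_c_decomp[of "a - b"] by (simp add: c_simps \<phi>_re)
    then show ?thesis by simp
  qed
  have \<phi>0: "\<phi> 0 = 0"
    by (simp add: \<phi>_def e0 fix1 c_simps)
  have \<phi>: "orthogonal_transformation \<phi>"
    unfolding orthogonal_transformation_isometry by (simp add: \<phi>0 dist_norm \<phi>_dist)
  have \<phi>e: "\<phi> e = e"
    using e0(1) by (simp add: \<phi>_def c_simps pz_def fix1)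
  have form: "h z = (\<phi> (fst z), \<psi> (snd z))" if z: "z \<in> D_dom e" for z
  proof -
    have "norm (\<psi> (snd z)) = norm (snd z)"
      using \<psi>_dist[of "snd z" 0] by (simp add: \<psi>0)
    then show ?thesis
      using im_h[OF z] snd_h[OF z] ht[OF z]
      by (subst pair_eq_iff) (simp add: \<phi>_re ht_eq)
  qed
  have lin: "linear \<phi>" "linear \<psi>"
    using \<phi> \<psi> by (simp_all add: orthogonal_transformation_def)
  have \<phi>_im': "\<phi> (c_im e a) = c_im e (\<phi> a)" for a
    by (simp add: c_im_def linear_diff[OF lin(1)] linear_scale[OF lin(1)] \<phi>e \<phi>_re)
  have \<beta>: "beta2 J (\<psi> u) (\<psi> v) = \<phi> (beta2 J u v)" for u v
  proof -
    define z where "z = ((1 + (norm u)\<^sup>2 / 4) *\<^sub>R e + (1/2) *\<^sub>R c_im e (beta2 J u v), u)"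
    have z: "z \<in> D_dom e"
      by (simp add: z_def D_iff ht_eq c_simps)
    have "c_im e (polar_ht z (pv v)) = 0"
      by (simp add: z_def pv_def im_polar_ht c_simps)
    then have "c_im e (polar_ht (h z) (h (pv v))) = 0"
      using im[OF z pv, of v] by simp
    then have "c_im e (\<phi> (fst z)) - c_im e (\<phi> (fst (pv v))) = (1/2) *\<^sub>R c_im e (beta2 J (\<psi> u) (\<psi> v))"
      by (simp add: im_polar_ht form[OF z] form[OF pv]) (simp add: z_def pv_def)
    moreover have "c_im e (\<phi> (fst z)) = (1/2) *\<^sub>R c_im e (\<phi> (beta2 J u v))"
      by (simp add: z_def linear_add[OF lin(1)] linear_scale[OF lin(1)] \<phi>e \<phi>_im' c_simps)
    moreover have "c_im e (\<phi> (fst (pv v))) = 0"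
      by (simp add: pv_def linear_scale[OF lin(1)] \<phi>e c_simps)
    ultimately have "c_im e (\<phi> (beta2 J u v)) = c_im e (beta2 J (\<psi> u) (\<psi> v))"
      by simp
    moreover have "\<psi> v \<bullet> \<psi> u = v \<bullet> u"
      using \<psi> by (simp add: orthogonal_transformation_def)
    then have "c_re e (\<phi> (beta2 J u v)) = c_re e (beta2 J (\<psi> u) (\<psi> v))"
      by (simp add: \<phi>_re c_re_beta)
    ultimately show ?thesis
      by (metis c_decomp)
  qed
  have compat: "\<psi> (J \<zeta> v) = J (\<phi> \<zeta>) (\<psi> v)" for \<zeta> v
  proof -
    define x y where "x = J (\<phi> \<zeta>) (\<psi> v)" and "y = \<psi> (J \<zeta> v)"
    have n: "norm x = norm \<zeta> * norm v" "norm y = norm \<zeta> * norm v"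
      using \<phi>_dist[of \<zeta> 0] \<psi>_dist[of v 0] \<psi>_dist[of "J \<zeta> v" 0] by (simp_all add: x_def y_def norm_J \<phi>0 \<psi>0)
    have "x \<bullet> y = beta2 J (\<psi> (J \<zeta> v)) (\<psi> v) \<bullet> \<phi> \<zeta>"
      by (simp add: x_def y_def beta_inner)
    also have "\<dots> = beta2 J (J \<zeta> v) v \<bullet> \<zeta>"
      using \<phi> by (simp add: \<beta> orthogonal_transformation_def)
    also have "\<dots> = (norm (J \<zeta> v))\<^sup>2"
      by (simp add: beta_inner power2_norm_eq_inner)
    finally have "x \<bullet> y = (norm \<zeta> * norm v)\<^sup>2"
      by (simp add: norm_J)
    (* Equality holds in the Cauchy-Schwarz inequality for x and y. *)
    then have "(norm (y - x))\<^sup>2 = 0"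
      using n by (simp add: power2_norm_eq_inner inner_simps inner_commute) (simp add: dot_square_norm)
    then show ?thesis
      by (simp add: x_def y_def)
  qed
  show ?thesis
    using that form \<phi> \<psi> \<phi>e compat unfolding module_aut_def by blast
qed

definition MAN_map :: "('c \<Rightarrow> 'c) \<Rightarrow> ('v \<Rightarrow> 'v) \<Rightarrow> real \<Rightarrow> 'c \<Rightarrow> 'v \<Rightarrow> 'c \<times> 'v \<Rightarrow> 'c \<times> 'v" where
  "MAN_map \<phi> \<psi> t Z X z = (\<phi> (fst (dil t (heis Z X z))), \<psi> (snd (dil t (heis Z X z))))"

text \<open>
  Precomposing with the element of \<open>N A\<close> that moves the base point to its preimage reduces the claim to a map
  that fixes the base point and preserves heights.
\<close>

lemma MAN_if_ht_scaled:
  assumes f: "dist_preserving f" and surj: "(e, 0) \<in> f ` D_dom e" and c: "c > 0"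
    and ht: "\<And>z. z \<in> D_dom e \<Longrightarrow> ht e (f z) = c * ht e z"
  obtains \<phi> \<psi> Z X where "module_aut \<phi> \<psi>" "Z \<in> C_prime e"
    and "\<And>z. z \<in> D_dom e \<Longrightarrow> f z = MAN_map \<phi> \<psi> c Z X z"
proof -
  obtain z0 where z0: "z0 \<in> D_dom e" "f z0 = (e, 0)"
    using surj by force
  define Z X where "Z = - c_im e (fst z0)" and "X = - snd z0"
  have Z: "Z \<in> C_prime e"
    by (simp add: Z_def C_prime_iff c_simps)
  have "1 = c * ht e z0"
    using ht[OF z0(1)] z0(2) ht_axis[of 1] by simp
  then have h0: "1 / ht e z0 = c"
    by (cases "ht e z0 = 0") (auto simp: field_simps)
  define j where "j z = dil c (heis Z X z)" for z
  define k where "k = heis (- Z) (- X) \<circ> dil (1 / c)"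
  have kj: "k (j z) = z" and jk: "j (k z) = z" for z
    using c by (simp_all add: j_def k_def dil_inverse heis_minus)
  have k: "dist_preserving k"
    unfolding k_def using c by (intro dist_preserving_compose dist_preserving_heis dist_preserving_dil neg_C_prime Z) auto
  have jz0: "j z0 = (e, 0)"
    using to_base[OF z0(1)] by (simp add: j_def Z_def X_def h0)
  define h where "h = f \<circ> k"
  have h: "dist_preserving h"
    unfolding h_def by (rule dist_preserving_compose[OF k f])
  have "h (e, 0) = (e, 0)"
    using kj[of z0] by (simp add: h_def jz0 z0(2))
  moreover have "ht e (h z) = ht e z" if "z \<in> D_dom e" for z
    using c by (simp add: h_def ht[OF dist_preservingD(1)[OF k that]]) (simp add: k_def ht_heis neg_C_prime Z ht_dil)
  ultimately obtain \<phi> \<psi> where \<phi>: "module_aut \<phi> \<psi>"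
      "\<And>z. z \<in> D_dom e \<Longrightarrow> h z = (\<phi> (fst z), \<psi> (snd z))"
    using module_aut_if_ht_preserved[OF h] by blast
  have "f z = MAN_map \<phi> \<psi> c Z X z" if "z \<in> D_dom e" for z
  proof -
    have "j z \<in> D_dom e"
      using that c Z by (simp add: j_def dil_D heis_D)
    then show ?thesis
      using \<phi>(2)[of "j z"] by (simp add: h_def kj MAN_map_def j_def[symmetric])
  qed
  then show ?thesis
    using that \<phi>(1) Z by blast
qed

text \<open>
  Apply \<open>ray_to_boundary\<close> to the images of two points of the axis.  If the ray through them ends at
  infinity, then \<open>g\<close> scales heights and lies in \<open>MAN\<close>; otherwise a translation followed by the
  inversion moves its end to infinity, and the composition with \<open>g\<close> lies in \<open>MAN\<close>.
\<close>

proposition bruhat: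
  assumes g: "g \<in> D_isometries e J"
  shows "(\<exists>\<phi> \<psi> t Z X. module_aut \<phi> \<psi> \<and> t > 0 \<and> Z \<in> C_prime e \<and>
      (\<forall>z\<in>D_dom e. g z = MAN_map \<phi> \<psi> t Z X z)) \<or>
    (\<exists>W Y \<phi> \<psi> t Z X. module_aut \<phi> \<psi> \<and> t > 0 \<and> Z \<in> C_prime e \<and> W \<in> C_prime e \<and>
      (\<forall>z\<in>D_dom e. g z = heis W Y (geo (MAN_map \<phi> \<psi> t Z X z))))"
proof -
  have bij: "bij_betw g (D_dom e) (D_dom e)"
    using g by (simp add: D_isometries_def Bij_def)
  have q: "dist_preserving g"
    using bij isometry_cosh_sq[OF g] bij_betwE[OF bij] by (simp add: dist_preserving_def)
  define z1 z2 where "z1 = g (1 *\<^sub>R e, 0)" and "z2 = g (2 *\<^sub>R e, 0)"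
  have D: "z1 \<in> D_dom e" "z2 \<in> D_dom e"
    unfolding z1_def z2_def by (intro dist_preservingD(1)[OF q] axis_D; simp)+
  have "(2 *\<^sub>R e, 0 :: 'v) \<noteq> (1 *\<^sub>R e, 0)"
    using norm_e by (metis Pair_inject scaleR_cancel_right norm_zero zero_neq_one numeral_eq_one_iff verit_eq_simplify(10))
  then have "z2 \<noteq> z1"
    using bij axis_D[of 1] axis_D[of 2] unfolding z1_def z2_def bij_betw_def inj_on_def by force
  then consider r where "r > 0" "z2 = up r z1"
    | W Y r where "W \<in> C_prime e" "r > 0" "geo (heis W Y z2) = up r (geo (heis W Y z1))"
    using ray_to_boundary[OF D] by blast
  then show ?thesis
  proof cases
    case 1
    obtain c where c: "c > 0" "\<And>z. z \<in> D_dom e \<Longrightarrow> ht e (g z) = c * ht e z"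
      using ht_scaled_if_vertical[OF q 1(1)] 1(2) unfolding z1_def z2_def by blast
    have "(e, 0) \<in> g ` D_dom e"
      using bij axis_D[of 1] by (simp add: bij_betw_imp_surj_on)
    then show ?thesis
      using MAN_if_ht_scaled[OF q _ c] c(1) by metis
  next
    case 2
    define f where "f = geo \<circ> (heis W Y \<circ> g)"
    have f: "dist_preserving f"
      unfolding f_def by (intro dist_preserving_compose dist_preserving_heis dist_preserving_geo q 2)
    obtain c where c: "c > 0" "\<And>z. z \<in> D_dom e \<Longrightarrow> ht e (f z) = c * ht e z"
      using ht_scaled_if_vertical[OF f 2(2)] 2(3) unfolding z1_def z2_def f_def by auto
    have e1: "(e, 0 :: 'v) \<in> D_dom e"
      using axis_D[of 1] by simp
    define y where "y = heis (- W) (- Y) (geo (e, 0))"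
    have "y \<in> D_dom e"
      using 2(1) e1 by (simp add: y_def heis_D neg_C_prime geo_D)
    then obtain x where x: "x \<in> D_dom e" "g x = y"
      using bij by (metis bij_betw_def imageE)
    then have "f x = (e, 0)"
      by (simp add: f_def y_def heis_minus geo_geo[OF fst_D_nonzero[OF e1]])
    then have surj: "(e, 0) \<in> f ` D_dom e"
      using x by force
    obtain \<phi> \<psi> Z X where *: "module_aut \<phi> \<psi>" "Z \<in> C_prime e"
        "\<And>z. z \<in> D_dom e \<Longrightarrow> f z = MAN_map \<phi> \<psi> c Z X z"
      using MAN_if_ht_scaled[OF f surj c] by blast
    have "g z = heis (- W) (- Y) (geo (MAN_map \<phi> \<psi> c Z X z))" if z: "z \<in> D_dom e" for z
    proof -
      have "heis W Y (g z) \<in> D_dom e"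
        using 2(1) dist_preservingD(1)[OF q z] by (simp add: heis_D)
      then have "geo (f z) = heis W Y (g z)"
        by (simp add: f_def geo_geo fst_D_nonzero)
      then show ?thesis
        using *(3)[OF z] by (simp add: heis_minus)
    qed
    then show ?thesis
      using * c(1) neg_C_prime[OF 2(1)] by blast
  qed
qed

end


section \<open>Finite-dimensional real inner product spaces\<close>

text \<open>
  Gram-Schmidt orthogonalisation.  It is carried out for a finite spanning set of an inner product
  space since \<open>V\<close>, which may be zero, is not an instance of \<open>euclidean_space\<close>.
\<close>

lemma finite_orthonormal_span:
  fixes B :: "'a::real_inner set"
  assumes "finite B"
  shows "\<exists>U. finite U \<and> (\<forall>u\<in>U. norm u = 1) \<and> (\<forall>u\<in>U. \<forall>w\<in>U. u \<noteq> w \<longrightarrow> u \<bullet> w = 0) \<and> span U = span B"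
  using assms
proof (induction B)
  case empty
  show ?case by (intro exI[of _ "{}"]) simp
next
  case (insert b B)
  obtain U where U: "finite U" "\<forall>u\<in>U. norm u = 1" "\<forall>u\<in>U. \<forall>w\<in>U. u \<noteq> w \<longrightarrow> u \<bullet> w = 0" "span U = span B"
    using insert.IH by blast
  define p where "p = (\<Sum>u\<in>U. (b \<bullet> u) *\<^sub>R u)"
  define c where "c = b - p"
  have p: "p \<in> span U"
    unfolding p_def by (intro span_sum span_scale span_base)
  have orth: "c \<bullet> w = 0" if w: "w \<in> U" for w
  proof -
    have "p \<bullet> w = (\<Sum>u\<in>U. if u = w then b \<bullet> w else 0)"
      unfolding p_def inner_sum_left
      by (rule sum.cong) (use U w in \<open>auto simp: dot_square_norm\<close>)
    then show ?thesis
      using U(1) w by (simp add: c_def inner_diff_left)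
  qed
  have span_b: "span (insert b B) = span (insert c U)"
  proof -
    have "b \<in> span (insert c U)"
    proof -
      have "b = c + p"
        by (simp add: c_def)
      then show ?thesis
        using p by (metis span_add span_base insertI1 span_mono subset_insertI subsetD)
    qed
    moreover have "c \<in> span (insert b B)"
      using p unfolding c_def U(4)
      by (metis span_diff span_base insertI1 span_mono subset_insertI subsetD)
    moreover have "B \<subseteq> span (insert c U)"
      by (metis U(4) order_trans span_mono span_superset subset_insertI)
    moreover have "U \<subseteq> span (insert b B)"
      by (metis U(4) order_trans span_mono span_superset subset_insertI)
    ultimately show ?thesis
      by (intro antisym span_minimal subspace_span) auto
  qed
  show ?case
  proof (cases "c = 0")
    case True
    then have "span (insert b B) = span U"
      using span_b by (simp add: span_insert_0)
    then show ?thesis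
      using U by blast
  next
    case False
    define d where "d = (1 / norm c) *\<^sub>R c"
    have "span (insert c U) = span (insert d U)"
    proof -
      have "d \<in> span (insert c U)"
        unfolding d_def by (intro span_scale span_base) simp
      moreover have "c = norm c *\<^sub>R d"
        using False by (simp add: d_def)
      then have "c \<in> span (insert d U)"
        by (metis span_scale span_base insertI1)
      moreover have "U \<subseteq> span (insert c U)" "U \<subseteq> span (insert d U)"
        by (auto intro: span_base)
      ultimately show ?thesis
        by (intro antisym span_minimal subspace_span) auto
    qed
    moreover have "norm d = 1" "\<forall>w\<in>U. d \<bullet> w = 0"
      using False orth by (simp_all add: d_def)
    ultimately show ?thesis
      using U span_b by (intro exI[of _ "insert d U"]) (auto simp: inner_commute)
  qed
qed

lemma compact_bounded_combinations:
  fixes U :: "'a::real_normed_vector set"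
  assumes "finite U"
  shows "compact {\<Sum>u\<in>U. c u *\<^sub>R u | c. \<forall>u\<in>U. \<bar>c u\<bar> \<le> r}"
  using assms
proof (induction U)
  case empty
  then show ?case by simp
next
  case (insert a U)
  define S where "S = (\<lambda>x. x *\<^sub>R a) ` {- r..r}"
  define T where "T = {\<Sum>u\<in>U. c u *\<^sub>R u | c. \<forall>u\<in>U. \<bar>c u\<bar> \<le> r}"
  have "compact S"
    unfolding S_def by (intro compact_continuous_image continuous_intros compact_Icc)
  moreover have "compact T"
    unfolding T_def by (rule insert.IH)
  ultimately have "compact {x + y | x y. x \<in> S \<and> y \<in> T}"
    by (rule compact_sums)
  also have "{x + y | x y. x \<in> S \<and> y \<in> T} = {\<Sum>u\<in>insert a U. c u *\<^sub>R u | c. \<forall>u\<in>insert a U. \<bar>c u\<bar> \<le> r}"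
    (is "?L = ?R")
  proof (intro antisym subsetI)
    fix z assume "z \<in> ?L"
    then obtain x c where xc: "z = x *\<^sub>R a + (\<Sum>u\<in>U. c u *\<^sub>R u)" "\<bar>x\<bar> \<le> r" "\<forall>u\<in>U. \<bar>c u\<bar> \<le> r"
      by (auto simp: S_def T_def)
    have "(\<Sum>u\<in>U. c u *\<^sub>R u) = (\<Sum>u\<in>U. (c(a := x)) u *\<^sub>R u)"
      using insert.hyps by (intro sum.cong) auto
    then have "z = (\<Sum>u\<in>insert a U. (c(a := x)) u *\<^sub>R u)"
      using insert.hyps xc(1) by simp
    then show "z \<in> ?R"
      using xc(2,3) by (intro CollectI exI[of _ "c(a := x)"]) auto
  next
    fix z assume "z \<in> ?R"
    then obtain c where c: "z = (\<Sum>u\<in>insert a U. c u *\<^sub>R u)" "\<forall>u\<in>insert a U. \<bar>c u\<bar> \<le> r"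
      by blast
    then have "c a *\<^sub>R a \<in> S" "(\<Sum>u\<in>U. c u *\<^sub>R u) \<in> T" "z = c a *\<^sub>R a + (\<Sum>u\<in>U. c u *\<^sub>R u)"
      using insert.hyps by (auto simp: S_def T_def abs_le_iff)
    then show "z \<in> ?L"
      by blast
  qed
  finally show ?case .
qed

text \<open>
  The coordinates with respect to an orthonormal basis are bounded by the norm, so the ball is a closed
  subset of a compact set of combinations with bounded coefficients.
\<close>

lemma compact_cball_if_finite_span:
  fixes B :: "'a::real_inner set"
  assumes "finite B" "span B = UNIV"
  shows "compact (cball (0::'a) r)"
proof -
  obtain U :: "'a set" where U: "finite U" "\<forall>u\<in>U. norm u = 1" "\<forall>u\<in>U. \<forall>w\<in>U. u \<noteq> w \<longrightarrow> u \<bullet> w = 0" "span U = UNIV"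
    using finite_orthonormal_span[OF assms(1)] assms(2) by auto
  have expand: "x = (\<Sum>u\<in>U. (x \<bullet> u) *\<^sub>R u)" for x
  proof -
    have "x \<in> span U"
      using U(4) by simp
    then show ?thesis
    proof (induction rule: span_induct)
      case base
      show ?case
      proof (rule subspaceI)
        fix x y :: 'a and r :: real
        assume x: "x \<in> {x. x = (\<Sum>u\<in>U. (x \<bullet> u) *\<^sub>R u)}" and y: "y \<in> {x. x = (\<Sum>u\<in>U. (x \<bullet> u) *\<^sub>R u)}"
        have "(\<Sum>u\<in>U. ((x + y) \<bullet> u) *\<^sub>R u) = (\<Sum>u\<in>U. (x \<bullet> u) *\<^sub>R u) + (\<Sum>u\<in>U. (y \<bullet> u) *\<^sub>R u)"
          by (simp add: inner_add_left scaleR_add_left sum.distrib)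
        then show "x + y \<in> {x. x = (\<Sum>u\<in>U. (x \<bullet> u) *\<^sub>R u)}"
          using x y by simp
        have "(\<Sum>u\<in>U. ((r *\<^sub>R x) \<bullet> u) *\<^sub>R u) = r *\<^sub>R (\<Sum>u\<in>U. (x \<bullet> u) *\<^sub>R u)"
          by (simp add: scaleR_right.sum)
        then show "r *\<^sub>R x \<in> {x. x = (\<Sum>u\<in>U. (x \<bullet> u) *\<^sub>R u)}"
          using x by simp
      qed simp
    next
      case (step w)
      have "(\<Sum>u\<in>U. (w \<bullet> u) *\<^sub>R u) = (\<Sum>u\<in>U. if u = w then w else 0)"
        using U step by (intro sum.cong) (auto simp: dot_square_norm)
      then show ?case
        using U(1) step by simp
    qed
  qed
  have "cball 0 r \<subseteq> {\<Sum>u\<in>U. c u *\<^sub>R u | c. \<forall>u\<in>U. \<bar>c u\<bar> \<le> r}"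
  proof
    fix x :: 'a assume "x \<in> cball 0 r"
    then have "\<forall>u\<in>U. \<bar>x \<bullet> u\<bar> \<le> r"
      using Cauchy_Schwarz_ineq2[of x] U(2) by (metis mem_cball_0 mult.right_neutral order_trans)
    then show "x \<in> {\<Sum>u\<in>U. c u *\<^sub>R u | c. \<forall>u\<in>U. \<bar>c u\<bar> \<le> r}"
      using expand[of x] by blast
  qed
  then have eq: "{\<Sum>u\<in>U. c u *\<^sub>R u | c. \<forall>u\<in>U. \<bar>c u\<bar> \<le> r} \<inter> cball 0 r = cball 0 r"
    by (rule Int_absorb1)
  show ?thesis
    using compact_Int_closed[OF compact_bounded_combinations[OF U(1)] closed_cball, of r 0 r] unfolding eq .
qed

lemma isometry_surj_if_finite_span:
  fixes f :: "'a::real_inner \<Rightarrow> 'a"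
  assumes f: "orthogonal_transformation f" and B: "finite B" "span B = (UNIV :: 'a set)"
  shows "surj f"
proof -
  obtain C where C: "C \<subseteq> B" "independent C" "B \<subseteq> span C"
    using maximal_independent_subset[of B] by blast
  have fin: "finite C" and spanC: "span C = UNIV"
    using finite_subset[OF C(1) B(1)] span_minimal[OF C(3) subspace_span] B(2) by auto
  have lin: "linear f"
    using f by (simp add: orthogonal_transformation_def)
  have inj: "inj f"
    using f by (auto simp: inj_on_def orthogonal_transformation_isometry) (metis dist_eq_0_iff)
  have ind: "independent (f ` C)"
    using linear_independent_injective_image[OF lin C(2)] inj by (simp add: inj_on_def)
  have card: "card (f ` C) = card C"
    using inj by (intro card_image) (simp add: inj_on_def)
  have "span (f ` C) = UNIV"
  proof (rule ccontr)
    assume "span (f ` C) \<noteq> UNIV"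
    then obtain y where y: "y \<notin> span (f ` C)"
      by blast
    then have "independent (insert y (f ` C))"
      using ind by (simp add: independent_insertI)
    then have "card (insert y (f ` C)) \<le> card C"
      using independent_span_bound[OF fin, of "insert y (f ` C)"] spanC by blast
    moreover have "y \<notin> f ` C"
      using y span_base[of y "f ` C"] by blast
    ultimately show False
      using fin card by simp
  qed
  then have "f ` span C = UNIV"
    by (simp add: linear_span_image[OF lin])
  then show ?thesis
    by (simp add: spanC)
qed

context j2c
begin

section \<open>Extension to the boundary\<close>

lemma V_finite_span: obtains B :: "'v set" where "finite B" "span B = UNIV"
  using module by (auto simp: J2C_module_def)

lemma compact_cball_prod: "compact (cball (0 :: 'c \<times> 'v) r)"
proof -
  obtain B :: "'v set" where B: "finite B" "span B = UNIV"
    by (rule V_finite_span)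
  have cpt: "compact (cball (0::'c) r \<times> cball (0::'v) r)"
    by (intro compact_Times compact_cball compact_cball_if_finite_span[OF B])
  have eq: "cball (0 :: 'c \<times> 'v) r = (cball (0::'c) r \<times> cball (0::'v) r) \<inter> cball 0 r"
    by (auto intro: order_trans[OF norm_fst_le] order_trans[OF norm_snd_le])
  show ?thesis
    by (subst eq) (rule compact_Int_closed[OF cpt closed_cball])
qed

abbreviation alex :: "('c \<times> 'v) option topology" where
  "alex \<equiv> Alexandroff_compactification euclidean"

lemma Hausdorff_alex: "Hausdorff_space alex"
proof -
  have "locally_compact_space (euclidean :: ('c \<times> 'v) topology)"
    unfolding locally_compact_space_def
  proof
    fix x :: "'c \<times> 'v"
    show "\<exists>U K. openin euclidean U \<and> compactin euclidean K \<and> x \<in> U \<and> U \<subseteq> K"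
      using compact_cball_prod
      by (intro exI[of _ "ball 0 (norm x + 1)"] exI[of _ "cball 0 (norm x + 1)"]) auto
  qed
  then show ?thesis
    unfolding Hausdorff_space_Alexandroff_compactification by simp
qed

text \<open>
  A neighbourhood base of the one-point compactification indexed by radii, so that
  continuity can be checked with radii also at infinity.
\<close>

definition obc_ball :: "('c \<times> 'v) option \<Rightarrow> real \<Rightarrow> ('c \<times> 'v) option set" where
  "obc_ball x r = (case x of None \<Rightarrow> insert None (Some ` {y. 1 / r < norm y}) | Some z \<Rightarrow> Some ` ball z r)"

lemma obc_ball_simps:
  "None \<in> obc_ball None r" "Some y \<in> obc_ball None r \<longleftrightarrow> 1 / r < norm y"
  "None \<notin> obc_ball (Some z) r" "Some y \<in> obc_ball (Some z) r \<longleftrightarrow> dist z y < r"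
  by (auto simp: obc_ball_def)

lemma openin_obc_ball: "openin alex (obc_ball x r)"
proof (cases x)
  case None
  have "- cball (0 :: 'c \<times> 'v) (1 / r) = {y. 1 / r < norm y}"
    by auto
  then have "obc_ball None r = insert None (Some ` (topspace euclidean - cball 0 (1 / r)))"
    by (simp add: obc_ball_def Compl_eq_Diff_UNIV)
  moreover have "compactin euclidean (cball (0 :: 'c \<times> 'v) (1 / r))" "closedin euclidean (cball (0 :: 'c \<times> 'v) (1 / r))"
    using compact_cball_prod by simp_all
  ultimately show ?thesis
    unfolding openin_Alexandroff_compactification None by blast
qed (simp add: obc_ball_def)

lemma obc_ball_subset:
  assumes W: "openin alex W" and x: "x \<in> W"
  obtains r where "r > 0" "obc_ball x r \<subseteq> W"
proof -
  consider U where "open U" "W = Some ` U"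
    | C where "compact C" "W = insert None (Some ` (UNIV - C))"
    using W unfolding openin_Alexandroff_compactification by auto
  then show ?thesis
  proof cases
    case 1
    then obtain z where z: "x = Some z" "z \<in> U"
      using x by blast
    then obtain r where "r > 0" "ball z r \<subseteq> U"
      using 1(1) open_contains_ball by blast
    then show ?thesis
      using that[of r] 1 z by (auto simp: obc_ball_def)
  next
    case 2
    show ?thesis
    proof (cases x)
      case None
      obtain b where b: "b > 0" "\<And>y. y \<in> C \<Longrightarrow> norm y \<le> b"
        using compact_imp_bounded[OF 2(1)] bounded_pos by blast
      have "obc_ball x (1 / b) \<subseteq> W"
      proof
        fix y assume y: "y \<in> obc_ball x (1 / b)"
        show "y \<in> W"
        proof (cases y)
          case (Some w)
          then have "b < norm w"
            using y None by (simp add: obc_ball_simps)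
          then have "w \<notin> C"
            using b(2)[of w] by auto
          then show ?thesis
            using Some by (simp add: 2)
        qed (simp add: 2)
      qed
      then show ?thesis
        using that[of "1 / b"] b(1) by simp
    next
      case (Some z)
      then have "z \<in> - C" "open (- C)"
        using x 2 compact_imp_closed by auto
      then obtain r where "r > 0" "ball z r \<subseteq> - C"
        using open_contains_ball by blast
      then show ?thesis
        using that[of r] 2 Some by (auto simp: obc_ball_def)
    qed
  qed
qed

lemma D_bar_Some: "Some z \<in> D_bar e \<longleftrightarrow> 0 \<le> ht e z"
  by (cases z) (auto simp: D_bar_def ht_def)

lemma D_bar_None: "None \<in> D_bar e"
  by (simp add: D_bar_def)

lemma topspace_D_bar: "topspace (D_bar_top e) = (D_bar e :: ('c \<times> 'v) option set)"
  by (auto simp: D_bar_top_def D_bar_def)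

lemma continuous_map_D_barI:
  fixes h :: "('c \<times> 'v) option \<Rightarrow> ('c \<times> 'v) option"
  assumes maps: "\<And>x. x \<in> D_bar e \<Longrightarrow> h x \<in> D_bar e"
    and near: "\<And>x r. x \<in> D_bar e \<Longrightarrow> r > 0 \<Longrightarrow> \<exists>r'>0. \<forall>y\<in>D_bar e \<inter> obc_ball x r'. h y \<in> obc_ball (h x) r"
  shows "continuous_map (D_bar_top e) (D_bar_top e) h"
proof -
  have "continuous_map (D_bar_top e) alex h"
    unfolding continuous_map_def
  proof (intro conjI allI impI)
    show "h \<in> topspace (D_bar_top e) \<rightarrow> topspace alex"
      using option.exhaust by (auto simp: topspace_D_bar)
    fix W assume W: "openin alex W"
    show "openin (D_bar_top e) {x \<in> topspace (D_bar_top e). h x \<in> W}"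
      unfolding topspace_D_bar
    proof (subst openin_subopen, intro ballI)
      fix x assume x: "x \<in> {x \<in> D_bar e. h x \<in> W}"
      then obtain r where r: "r > 0" "obc_ball (h x) r \<subseteq> W"
        using obc_ball_subset[OF W] by blast
      then obtain r' where r': "r' > 0" "\<forall>y\<in>D_bar e \<inter> obc_ball x r'. h y \<in> obc_ball (h x) r"
        using near x by blast
      have "openin (D_bar_top e) (D_bar e \<inter> obc_ball x r')"
        unfolding D_bar_top_def by (metis openin_subtopology_Int2 openin_obc_ball)
      moreover have "x \<in> D_bar e \<inter> obc_ball x r'"
        using x r'(1) by (cases x) (auto simp: obc_ball_simps)
      moreover have "D_bar e \<inter> obc_ball x r' \<subseteq> {x \<in> D_bar e. h x \<in> W}"
        using r r' by blast
      ultimately show "\<exists>T. openin (D_bar_top e) T \<and> x \<in> T \<and> T \<subseteq> {x \<in> D_bar e. h x \<in> W}"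
        by blast
    qed
  qed
  then show ?thesis
    unfolding D_bar_top_def[of e] using maps topspace_D_bar
    by (simp add: continuous_map_in_subtopology image_subset_iff_funcset Pi_iff)
qed

text \<open>
  Vertical translations approach every boundary point from inside \<open>D\<close>, and the axis tends to infinity.
\<close>

lemma dense_D:
  assumes "x \<in> D_bar e"
  shows "x \<in> D_bar_top e closure_of (Some ` (D_dom e :: ('c \<times> 'v) set))"
  unfolding in_closure_of topspace_D_bar
proof (intro conjI allI impI, rule assms)
  fix T :: "('c \<times> 'v) option set" assume T: "x \<in> T \<and> openin (D_bar_top e) T"
  then obtain W where W: "openin alex W" "T = W \<inter> D_bar e"
    unfolding D_bar_top_def openin_subtopology by blast
  then obtain r where r: "r > 0" "obc_ball x r \<subseteq> W"
    using T obc_ball_subset by blast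
  have "\<exists>z. z \<in> D_dom e \<and> Some z \<in> obc_ball x r"
  proof (cases x)
    case None
    define s where "s = 1 / r + 1"
    have "s > 0" "norm (s *\<^sub>R e, 0 :: 'v) > 1 / r"
      using r(1) by (simp_all add: s_def norm_prod_def add_pos_pos)
    then show ?thesis
      using axis_D[of s] None by (intro exI[of _ "(s *\<^sub>R e, 0)"]) (simp add: obc_ball_simps)
  next
    case (Some z)
    have "dist z (up (r / 2) z) = r / 2"
      using r(1) by (simp add: up_def dist_norm norm_prod_def minus_prod_def)
    moreover have "up (r / 2) z \<in> D_dom e"
      using assms Some r(1) by (simp add: D_iff ht_up D_bar_Some add_nonneg_pos)
    ultimately show ?thesis
      using Some r(1) by (intro exI[of _ "up (r / 2) z"]) (simp add: obc_ball_simps)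
  qed
  then obtain z where z: "z \<in> D_dom e" "Some z \<in> obc_ball x r"
    by blast
  have "Some z \<in> D_bar e"
    using z(1) by (simp add: D_bar_Some D_iff)
  then show "\<exists>y. y \<in> Some ` D_dom e \<and> y \<in> T"
    using z r W by blast
qed

text \<open>
  The extension is unique because \<open>D\<close> is dense and the compactification is Hausdorff.
\<close>

proposition bar_ext_eq:
  fixes h :: "('c \<times> 'v) option \<Rightarrow> ('c \<times> 'v) option"
  assumes h: "continuous_map (D_bar_top e) (D_bar_top e) h"
    and hg: "\<And>z. z \<in> D_dom e \<Longrightarrow> h (Some z) = Some (g z)"
    and x: "x \<in> D_bar e"
  shows "bar_ext e g x = h x"
proof -
  have D_sub: "Some z \<in> D_bar e" if "z \<in> D_dom e" for z :: "'c \<times> 'v"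
    using that by (simp add: D_bar_Some D_iff)
  have "bar_ext e g = restrict h (D_bar e)"
    unfolding bar_ext_def
  proof (rule the_equality)
    have "continuous_map (D_bar_top e) (D_bar_top e) (restrict h (D_bar e))"
      using h by (rule continuous_map_eq) (simp add: topspace_D_bar)
    then show "restrict h (D_bar e) \<in> extensional (D_bar e) \<and>
        continuous_map (D_bar_top e) (D_bar_top e) (restrict h (D_bar e)) \<and>
        (\<forall>z\<in>D_dom e. restrict h (D_bar e) (Some z) = Some (g z))"
      using hg D_sub by simp
  next
    fix k assume k: "k \<in> extensional (D_bar e) \<and> continuous_map (D_bar_top e) (D_bar_top e) k \<and>
        (\<forall>z\<in>D_dom e. k (Some z) = Some (g z))"
    have "Hausdorff_space (D_bar_top e :: ('c \<times> 'v) option topology)"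
      unfolding D_bar_top_def by (rule Hausdorff_space_subtopology[OF Hausdorff_alex])
    have "k y = h y" if y: "y \<in> D_bar e" for y
      by (rule forall_in_closure_of_eq[OF dense_D[OF y] \<open>Hausdorff_space _\<close>]) (use k h hg in auto)
    then show "k = restrict h (D_bar e)"
      using k by (intro extensionalityI[of k "D_bar e"]) auto
  qed
  then show ?thesis
    using x by simp
qed

lemma continuous_map_affine_ext:
  fixes H :: "'c \<times> 'v \<Rightarrow> 'c \<times> 'v"
  assumes cont: "continuous_on UNIV H"
    and proper: "\<And>R. \<exists>R'. \<forall>z. norm (H z) \<le> R \<longrightarrow> norm z \<le> R'"
    and maps: "\<And>z. 0 \<le> ht e z \<Longrightarrow> 0 \<le> ht e (H z)"
  shows "continuous_map (D_bar_top e) (D_bar_top e) (map_option H)"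
proof (rule continuous_map_D_barI)
  show "map_option H x \<in> D_bar e" if "x \<in> D_bar e" for x
    using that maps by (cases x) (simp_all add: D_bar_Some D_bar_None)
  fix x :: "('c \<times> 'v) option" and r :: real
  assume x: "x \<in> D_bar e" and r: "r > 0"
  show "\<exists>r'>0. \<forall>y\<in>D_bar e \<inter> obc_ball x r'. map_option H y \<in> obc_ball (map_option H x) r"
  proof (cases x)
    case None
    obtain R where R: "\<And>z. norm (H z) \<le> 1 / r \<Longrightarrow> norm z \<le> R"
      using proper by blast
    define r' where "r' = 1 / max R 1"
    have "map_option H y \<in> obc_ball None r" if "y \<in> obc_ball None r'" for y
    proof (cases y)
      case (Some z)
      then have "max R 1 < norm z"
        using that by (simp add: obc_ball_simps r'_def)
      then show ?thesis
        using R[of z] Some by (force simp: obc_ball_simps)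
    qed (simp add: obc_ball_simps)
    moreover have "r' > 0"
      by (simp add: r'_def)
    ultimately show ?thesis
      using None by (intro exI[of _ r']) auto
  next
    case (Some z)
    have "continuous (at z) H"
      using cont continuous_on_eq_continuous_at[OF open_UNIV] by blast
    then obtain d where d: "d > 0" "\<And>y. dist y z < d \<Longrightarrow> dist (H y) (H z) < r"
      using r unfolding continuous_at_eps_delta by blast
    have "map_option H y \<in> obc_ball (Some (H z)) r" if "y \<in> obc_ball (Some z) d" for y
      using that d(2) by (cases y) (simp_all add: obc_ball_simps dist_commute)
    then show ?thesis
      using d(1) Some by (intro exI[of _ d]) auto
  qed
qed

text \<open>
  On the closure of \<open>D\<close> the condition \<open>fst z = 0\<close> singles out the point \<open>0\<close>.
\<close>

definition geo_bar :: "('c \<times> 'v) option \<Rightarrow> ('c \<times> 'v) option" where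
  "geo_bar x = (case x of None \<Rightarrow> Some 0 | Some z \<Rightarrow> if fst z = 0 then None else Some (geo z))"

lemma D_bar_snd_le:
  assumes "0 \<le> ht e z"
  shows "norm (snd z) \<le> 2 * sqrt (norm (fst z))"
proof -
  have "(norm (snd z))\<^sup>2 \<le> 4 * norm (fst z)"
    using assms c_re_le_norm[of "fst z"] by (simp add: ht_eq)
  then have "sqrt ((norm (snd z))\<^sup>2) \<le> sqrt (4 * norm (fst z))"
    by (rule real_sqrt_le_mono)
  then show ?thesis
    by (simp add: real_sqrt_mult)
qed

lemma norm_geo_fst: "norm (fst (geo z)) = 1 / norm (fst z)"
  and norm_geo_snd: "norm (snd (geo z)) = norm (snd z) / norm (fst z)"
  by (simp_all add: geo_def norm_inv norm_J)

text \<open>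
  On the closure of \<open>D\<close> one has \<open>|v| \<le> 2 \<surd>|\<zeta>|\<close>.  Hence a point tends to infinity only if
  \<open>|\<zeta>|\<close> does, and then \<open>|\<zeta>|\<^sup>-\<^sup>1 + |v| / |\<zeta>| \<le> 3 / \<surd>|\<zeta>|\<close> as soon as \<open>|\<zeta>| \<ge> 1\<close>.
\<close>

lemma continuous_map_geo_bar: "continuous_map (D_bar_top e) (D_bar_top e) geo_bar"
proof (rule continuous_map_D_barI)
  show "geo_bar x \<in> D_bar e" if "x \<in> D_bar e" for x
  proof -
    have "ht e (0 :: 'c \<times> 'v) = 0"
      by (simp add: ht_eq c_simps)
    then show ?thesis
      using that by (cases x) (simp_all add: geo_bar_def D_bar_Some D_bar_None ht_geo)
  qed
  fix x :: "('c \<times> 'v) option" and r :: real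
  assume x: "x \<in> D_bar e" and r: "r > 0"
  show "\<exists>r'>0. \<forall>y\<in>D_bar e \<inter> obc_ball x r'. geo_bar y \<in> obc_ball (geo_bar x) r"
  proof (cases x)
    case None
    define L where "L = max 1 (4 / r)"
    have L: "L \<ge> 1" "4 / r \<le> L"
      by (simp_all add: L_def)
    have L3: "3 / L < r"
      using L r by (simp add: field_simps)
    define r' where "r' = 1 / (L\<^sup>2 + 2 * L)"
    have r': "r' > 0"
      using L by (simp add: r'_def add_pos_pos)
    have "geo_bar y \<in> obc_ball (Some 0) r" if y: "y \<in> D_bar e" "y \<in> obc_ball None r'" for y
    proof (cases y)
      case None
      then show ?thesis
        using r by (simp add: geo_bar_def obc_ball_simps)
    next
      case (Some z)
      then have nz: "L\<^sup>2 + 2 * L < norm z" and hz: "0 \<le> ht e z"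
        using y by (simp_all add: obc_ball_simps r'_def D_bar_Some)
      have big: "L\<^sup>2 < norm (fst z)"
      proof (rule ccontr)
        assume "\<not> L\<^sup>2 < norm (fst z)"
        then have "norm (fst z) \<le> L\<^sup>2"
          by simp
        then have "sqrt (norm (fst z)) \<le> L"
          using L by (intro real_le_lsqrt) auto
        then have "norm (snd z) \<le> 2 * L"
          using D_bar_snd_le[OF hz] by linarith
        moreover have "norm z \<le> norm (fst z) + norm (snd z)"
          using norm_Pair_le[of "fst z" "snd z"] by simp
        ultimately show False
          using nz \<open>norm (fst z) \<le> L\<^sup>2\<close> by linarith
      qed
      define m where "m = sqrt (norm (fst z))"
      have m: "m > L" "norm (fst z) = m\<^sup>2"
        using big L by (simp_all add: m_def real_less_rsqrt)
      have "norm (fst (geo z)) \<le> 1 / m"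
        using m L unfolding norm_geo_fst m(2) by (simp add: power2_eq_square field_simps)
      moreover have "norm (snd (geo z)) \<le> 2 * m / m\<^sup>2"
        unfolding norm_geo_snd m(2) using D_bar_snd_le[OF hz] m L
        by (intro divide_right_mono) (simp_all add: m_def[symmetric])
      moreover have "norm (geo z) \<le> norm (fst (geo z)) + norm (snd (geo z))"
        using norm_Pair_le[of "fst (geo z)" "snd (geo z)"] by simp
      moreover have "1 / m + 2 * m / m\<^sup>2 = 3 / m"
        using m L by (simp add: power2_eq_square field_simps)
      moreover have "3 / m \<le> 3 / L"
        using m L by (intro divide_left_mono) auto
      ultimately have "norm (geo z) < r"
        using L3 by linarith
      moreover have "fst z \<noteq> 0"
        using big by auto
      ultimately show ?thesis
        using Some by (simp add: geo_bar_def obc_ball_simps)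
    qed
    then show ?thesis
      using r' None by (intro exI[of _ r']) (auto simp: geo_bar_def)
  next
    case (Some z)
    show ?thesis
    proof (cases "fst z = 0")
      case True
      then have "z = 0"
        using x Some by (simp add: D_bar_Some ht_eq c_simps prod_eq_iff)
      have "geo_bar y \<in> obc_ball None r" if y: "y \<in> obc_ball (Some z) r" for y
      proof (cases y)
        case None
        then show ?thesis
          using y by (simp add: obc_ball_simps)
      next
        case (Some w)
        then have w: "norm w < r"
          using y by (simp add: obc_ball_simps \<open>z = 0\<close>)
        show ?thesis
        proof (cases "fst w = 0")
          case False
          have "norm (fst w) < r"
            using w norm_fst_le[of "fst w" "snd w"] by simp
          then have "1 / r < norm (fst (geo w))"
            unfolding norm_geo_fst using False r by (simp add: field_simps)
          also have "\<dots> \<le> norm (geo w)"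
            using norm_fst_le[of "fst (geo w)" "snd (geo w)"] by simp
          finally show ?thesis
            using Some False by (simp add: geo_bar_def obc_ball_simps)
        qed (simp add: Some geo_bar_def obc_ball_simps)
      qed
      then show ?thesis
        using True Some r by (intro exI[of _ r]) (auto simp: geo_bar_def)
    next
      case False
      have "continuous (at z) geo"
        by (rule differentiable_imp_continuous_within[OF geo_differentiable[OF False]])
      then obtain d where d: "d > 0" "\<And>y. dist y z < d \<Longrightarrow> dist (geo y) (geo z) < r"
        using r unfolding continuous_at_eps_delta by blast
      define d' where "d' = min d (norm (fst z))"
      have "geo_bar y \<in> obc_ball (Some (geo z)) r" if y: "y \<in> obc_ball (Some z) d'" for y
      proof (cases y)
        case None
        then show ?thesis
          using y by (simp add: obc_ball_simps)
      next
        case (Some w)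
        then have w: "dist z w < d" "dist z w < norm (fst z)"
          using y by (simp_all add: obc_ball_simps d'_def)
        have "dist (fst z) (fst w) < norm (fst z)"
          using w(2) dist_fst_le[of z w] by linarith
        then have "fst w \<noteq> 0"
          by auto
        then show ?thesis
          using d(2)[of w] w(1) Some by (simp add: geo_bar_def obc_ball_simps dist_commute)
      qed
      moreover have "d' > 0"
        using d False by (simp add: d'_def)
      ultimately show ?thesis
        using Some False by (intro exI[of _ d']) (auto simp: geo_bar_def)
    qed
  qed
qed


section \<open>Isometric spheres and the change of height\<close>

lemma norm_aut:
  assumes "module_aut \<phi> \<psi>"
  shows "norm (\<phi> \<zeta>) = norm \<zeta>" "norm (\<psi> v) = norm v"
  using assms by (simp_all add: module_aut_def orthogonal_transformation)

lemma ht_aut: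
  assumes "module_aut \<phi> \<psi>"
  shows "ht e (\<phi> (fst z), \<psi> (snd z)) = ht e z"
proof -
  have "\<phi> (fst z) \<bullet> \<phi> e = fst z \<bullet> e" and e: "\<phi> e = e"
    using assms unfolding module_aut_def orthogonal_transformation_def by blast+
  then have "\<phi> (fst z) \<bullet> e = fst z \<bullet> e"
    unfolding e by simp
  then show ?thesis
    by (simp add: ht_eq c_re_def norm_aut[OF assms])
qed

lemma orthogonal_transformation_inverse:
  fixes f g :: "'a::real_inner \<Rightarrow> 'a"
  assumes f: "orthogonal_transformation f" and fg: "\<And>x. f (g x) = x"
  shows "orthogonal_transformation g"
proof -
  have d: "dist (f x) (f y) = dist x y" and f0: "f 0 = 0" for x y
    using f by (simp_all add: orthogonal_transformation_isometry)
  then have "dist (g x) (g y) = dist x y" for x y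
    using d[of "g x" "g y"] by (simp add: fg)
  moreover have "dist (g 0) 0 = 0"
    using d[of "g 0" 0] by (simp add: fg f0)
  ultimately show ?thesis
    by (simp add: orthogonal_transformation_isometry)
qed

definition aut_act :: "('c \<Rightarrow> 'c) \<Rightarrow> ('v \<Rightarrow> 'v) \<Rightarrow> 'c \<times> 'v \<Rightarrow> 'c \<times> 'v" where
  "aut_act \<phi> \<psi> z = (\<phi> (fst z), \<psi> (snd z))"

text \<open>
  Linear isometries of \<open>C\<close> and of \<open>V\<close> are bijective by finite dimension.
\<close>

lemma module_aut_inverse:
  assumes aut: "module_aut \<phi> \<psi>"
  shows "\<exists>\<phi>' \<psi>'. module_aut \<phi>' \<psi>' \<and> (\<forall>z. aut_act \<phi>' \<psi>' (aut_act \<phi> \<psi> z) = z) \<and>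
    (\<forall>z. aut_act \<phi> \<psi> (aut_act \<phi>' \<psi>' z) = z)"
proof -
  have o: "orthogonal_transformation \<phi>" "orthogonal_transformation \<psi>" and "\<phi> e = e"
    and compat: "\<And>\<zeta> v. \<psi> (J \<zeta> v) = J (\<phi> \<zeta>) (\<psi> v)"
    using aut by (auto simp: module_aut_def)
  obtain B :: "'v set" where "finite B" "span B = UNIV"
    by (rule V_finite_span)
  then have "surj \<psi>"
    using isometry_surj_if_finite_span o(2) by blast
  moreover have "surj \<phi>"
    using isometry_surj_if_finite_span[OF o(1) finite_Basis span_Basis] .
  moreover have "inj \<phi>" "inj \<psi>"
    using o by (auto simp: inj_on_def orthogonal_transformation_isometry) (metis dist_eq_0_iff)+
  moreover define \<phi>' \<psi>' where "\<phi>' = inv_into UNIV \<phi>" and "\<psi>' = inv_into UNIV \<psi>"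
  ultimately have inv: "\<phi>' (\<phi> \<zeta>) = \<zeta>" "\<phi> (\<phi>' \<zeta>) = \<zeta>" "\<psi>' (\<psi> v) = v" "\<psi> (\<psi>' v) = v" for \<zeta> v
    by (simp_all add: surj_f_inv_f)
  have "\<psi>' (J \<zeta> v) = J (\<phi>' \<zeta>) (\<psi>' v)" for \<zeta> v
    using compat[of "\<phi>' \<zeta>" "\<psi>' v"] inv(3)[of "J (\<phi>' \<zeta>) (\<psi>' v)"] by (simp add: inv)
  moreover have "\<phi>' e = e"
    using inv(1)[of e] \<open>\<phi> e = e\<close> by simp
  ultimately have "module_aut (\<phi>') (\<psi>')"
    using orthogonal_transformation_inverse[OF o(1), of "\<phi>'"]
      orthogonal_transformation_inverse[OF o(2), of "\<psi>'"] inv by (simp add: module_aut_def)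
  moreover have "aut_act \<phi>' \<psi>' (aut_act \<phi> \<psi> z) = z" "aut_act \<phi> \<psi> (aut_act \<phi>' \<psi>' z) = z" for z
    by (simp_all add: aut_act_def inv)
  ultimately show ?thesis
    by blast
qed

lemma MAN_map_eq: "MAN_map \<phi> \<psi> t Z X z = aut_act \<phi> \<psi> (dil t (heis Z X z))"
  by (simp add: MAN_map_def aut_act_def)

lemma aut_act_D: "module_aut \<phi> \<psi> \<Longrightarrow> aut_act \<phi> \<psi> z \<in> D_dom e \<longleftrightarrow> z \<in> D_dom e"
  by (simp add: D_iff aut_act_def ht_aut)

lemma bij_heis: "Z \<in> C_prime e \<Longrightarrow> bij_betw (heis Z X) (D_dom e) (D_dom e)"
  by (rule bij_betw_byWitness[of _ "heis (- Z) (- X)"]) (auto simp: heis_minus heis_D neg_C_prime)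

lemma bij_dil: "0 < t \<Longrightarrow> bij_betw (dil t) (D_dom e) (D_dom e)"
  by (rule bij_betw_byWitness[of _ "dil (1 / t)"]) (auto simp: dil_inverse dil_D)

lemma bij_geo: "bij_betw geo (D_dom e) (D_dom e)"
  by (rule bij_betw_byWitness[of _ geo]) (auto simp: geo_geo fst_D_nonzero geo_D)

lemma bij_aut:
  assumes aut: "module_aut \<phi> \<psi>"
  shows "bij_betw (aut_act \<phi> \<psi>) (D_dom e) (D_dom e)"
proof -
  obtain \<phi>' \<psi>' where *: "module_aut \<phi>' \<psi>'" "\<forall>z. aut_act \<phi>' \<psi>' (aut_act \<phi> \<psi> z) = z"
    "\<forall>z. aut_act \<phi> \<psi> (aut_act \<phi>' \<psi>' z) = z"
    using module_aut_inverse[OF aut] by blast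
  have "aut_act \<phi>' \<psi>' (aut_act \<phi> \<psi> z) = z" "aut_act \<phi> \<psi> (aut_act \<phi>' \<psi>' z) = z" for z
    using * by blast+
  then show ?thesis
    using aut_act_D[OF aut] aut_act_D[OF *(1)]
    by (intro bij_betw_byWitness[of _ "aut_act \<phi>' \<psi>'"]) (auto simp del: split_paired_All split_paired_Ex)
qed

lemma restrict_mult:
  assumes F: "bij_betw F (D_dom e) (D_dom e)" and G: "bij_betw G (D_dom e) (D_dom e)"
  shows "restrict F (D_dom e) \<otimes>\<^bsub>G_grp e J\<^esub> restrict G (D_dom e) = restrict (F \<circ> G) (D_dom e)"
proof -
  have "restrict F (D_dom e) \<in> Bij (D_dom e)" "restrict G (D_dom e) \<in> Bij (D_dom e)"
    using F G by (simp_all add: Bij_def)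
  then have "restrict F (D_dom e) \<otimes>\<^bsub>G_grp e J\<^esub> restrict G (D_dom e)
      = compose (D_dom e) (restrict F (D_dom e)) (restrict G (D_dom e))"
    by (simp add: G_grp_def BijGroup_def)
  also have "\<dots> = restrict (F \<circ> G) (D_dom e)"
    using bij_betwE[OF G] by (auto simp: compose_def fun_eq_iff restrict_def)
  finally show ?thesis .
qed

lemma n_elt_eq: "n_elt e J Z X = restrict (heis Z X) (D_dom e)"
  and a_elt_eq: "a_elt e t = restrict (dil t) (D_dom e)"
  and geod_inversion_eq: "geod_inversion e J = restrict geo (D_dom e)"
  and m_elt_eq: "(\<lambda>(\<zeta>, v)\<in>D_dom e. (\<phi> \<zeta>, \<psi> v)) = restrict (aut_act \<phi> \<psi>) (D_dom e)"
  by (auto simp: n_elt_def heis_def a_elt_def dil_def geod_inversion_def geo_def aut_act_def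
      fun_eq_iff restrict_def split: prod.splits)

lemma N_grp_iff: "n \<in> N_grp e J \<longleftrightarrow> (\<exists>Z X. Z \<in> C_prime e \<and> n = restrict (heis Z X) (D_dom e))"
  by (auto simp: N_grp_def n_elt_eq)

lemma M_grp_iff: "m \<in> M_grp e J \<longleftrightarrow> (\<exists>\<phi> \<psi>. module_aut \<phi> \<psi> \<and> m = restrict (aut_act \<phi> \<psi>) (D_dom e))"
  by (auto simp: M_grp_def m_elt_eq module_aut_def)

definition cell_map :: "'c \<Rightarrow> 'v \<Rightarrow> ('c \<Rightarrow> 'c) \<Rightarrow> ('v \<Rightarrow> 'v) \<Rightarrow> real \<Rightarrow> 'c \<Rightarrow> 'v \<Rightarrow> 'c \<times> 'v \<Rightarrow> 'c \<times> 'v" where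
  "cell_map W Y \<phi> \<psi> t Z X z = heis W Y (geo (MAN_map \<phi> \<psi> t Z X z))"

lemma decomposition_product:
  assumes W: "W \<in> C_prime e" and aut: "module_aut \<phi> \<psi>" and t: "0 < t" and Z: "Z \<in> C_prime e"
  shows "restrict (heis W Y) (D_dom e) \<otimes>\<^bsub>G_grp e J\<^esub> geod_inversion e J \<otimes>\<^bsub>G_grp e J\<^esub> restrict (aut_act \<phi> \<psi>) (D_dom e)
     \<otimes>\<^bsub>G_grp e J\<^esub> a_elt e t \<otimes>\<^bsub>G_grp e J\<^esub> restrict (heis Z X) (D_dom e)
    = restrict (cell_map W Y \<phi> \<psi> t Z X) (D_dom e)"
proof -
  note b = bij_heis[OF W] bij_geo bij_aut[OF aut] bij_dil[OF t] bij_heis[OF Z]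
  note b2 = bij_betw_trans[OF b(2) b(1)]
  note b3 = bij_betw_trans[OF b(3) b2]
  note b4 = bij_betw_trans[OF b(4) b3]
  show ?thesis
    unfolding a_elt_eq geod_inversion_eq restrict_mult[OF b(1,2)] restrict_mult[OF b2 b(3)]
      restrict_mult[OF b3 b(4)] restrict_mult[OF b4 b(5)]
    by (simp add: cell_map_def[abs_def] MAN_map_eq comp_def)
qed

lemma ht_cell:
  assumes W: "W \<in> C_prime e" and aut: "module_aut \<phi> \<psi>" and t: "0 < t" and Z: "Z \<in> C_prime e"
  shows "ht e (cell_map W Y \<phi> \<psi> t Z X z) = ht e z / (t * (norm (polar_ht z (heis (- Z) (- X) 0)))\<^sup>2)"
proof -
  define y where "y = heis Z X z"
  have "ht e (cell_map W Y \<phi> \<psi> t Z X z) = ht e (aut_act \<phi> \<psi> (dil t y)) / (norm (fst (aut_act \<phi> \<psi> (dil t y))))\<^sup>2"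
    by (simp add: cell_map_def MAN_map_eq ht_heis[OF W] ht_geo y_def)
  also have "ht e (aut_act \<phi> \<psi> (dil t y)) = t * ht e z"
    using t by (simp add: aut_act_def ht_aut[OF aut] ht_dil y_def ht_heis[OF Z])
  also have "norm (fst (aut_act \<phi> \<psi> (dil t y))) = t * norm (polar_ht z (heis (- Z) (- X) 0))"
    using t by (simp add: aut_act_def norm_aut[OF aut] dil_def y_def fst_heis[OF Z])
  finally show ?thesis
    using t by (simp add: power_mult_distrib power2_eq_square[of t])
qed

text \<open>
  The parameter \<open>t\<close> is determined by the map: by \<open>ht_cell\<close> two decompositions give the same function
  \<open>t |polar_ht z p|\<^sup>2\<close>, and on the axis this is a quadratic polynomial in the height with leading coefficient \<open>t\<close>.
\<close>

lemma dilation_cell: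
  assumes W: "W \<in> C_prime e" and aut: "module_aut \<phi> \<psi>" and t: "0 < t" and Z: "Z \<in> C_prime e"
  shows "dilation e J (restrict (cell_map W Y \<phi> \<psi> t Z X) (D_dom e)) = t"
  unfolding dilation_def
proof (rule the_equality)
  show "0 < t \<and> (\<exists>n1\<in>N_grp e J. \<exists>m\<in>M_grp e J. \<exists>n2\<in>N_grp e J.
      restrict (cell_map W Y \<phi> \<psi> t Z X) (D_dom e)
      = n1 \<otimes>\<^bsub>G_grp e J\<^esub> geod_inversion e J \<otimes>\<^bsub>G_grp e J\<^esub> m \<otimes>\<^bsub>G_grp e J\<^esub> a_elt e t \<otimes>\<^bsub>G_grp e J\<^esub> n2)"
    using W aut t Z
    by (intro conjI bexI[of _ "restrict (heis W Y) (D_dom e)"] bexI[of _ "restrict (aut_act \<phi> \<psi>) (D_dom e)"]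
        bexI[of _ "restrict (heis Z X) (D_dom e)"] decomposition_product[symmetric])
      (auto simp: N_grp_iff M_grp_iff)
next
  fix t' assume t': "0 < t' \<and> (\<exists>n1\<in>N_grp e J. \<exists>m\<in>M_grp e J. \<exists>n2\<in>N_grp e J.
      restrict (cell_map W Y \<phi> \<psi> t Z X) (D_dom e)
      = n1 \<otimes>\<^bsub>G_grp e J\<^esub> geod_inversion e J \<otimes>\<^bsub>G_grp e J\<^esub> m \<otimes>\<^bsub>G_grp e J\<^esub> a_elt e t' \<otimes>\<^bsub>G_grp e J\<^esub> n2)"
  then obtain W' Y' \<phi>' \<psi>' Z' X' where t'0: "0 < t'" and W': "W' \<in> C_prime e" and aut': "module_aut \<phi>' \<psi>'"
    and Z': "Z' \<in> C_prime e"
    and eq: "restrict (cell_map W Y \<phi> \<psi> t Z X) (D_dom e) = restrict (cell_map W' Y' \<phi>' \<psi>' t' Z' X') (D_dom e)"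
  proof -
    obtain n1 m n2 where *: "n1 \<in> N_grp e J" "m \<in> M_grp e J" "n2 \<in> N_grp e J"
      "restrict (cell_map W Y \<phi> \<psi> t Z X) (D_dom e)
        = n1 \<otimes>\<^bsub>G_grp e J\<^esub> geod_inversion e J \<otimes>\<^bsub>G_grp e J\<^esub> m \<otimes>\<^bsub>G_grp e J\<^esub> a_elt e t' \<otimes>\<^bsub>G_grp e J\<^esub> n2"
      using t' by blast
    obtain W' Y' \<phi>' \<psi>' Z' X' where **: "W' \<in> C_prime e" "n1 = restrict (heis W' Y') (D_dom e)"
      "module_aut \<phi>' \<psi>'" "m = restrict (aut_act \<phi>' \<psi>') (D_dom e)"
      "Z' \<in> C_prime e" "n2 = restrict (heis Z' X') (D_dom e)"
      using *(1-3) unfolding N_grp_iff M_grp_iff by blast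
    show ?thesis
      using that[OF _ **(1,3,5)] t' *(4) decomposition_product[OF **(1,3) _ **(5)] unfolding **(2,4,6) by simp
  qed
  define p p' where "p = heis (- Z) (- X) 0" and "p' = heis (- Z') (- X') 0"
  have quad: "(norm (polar_ht (s *\<^sub>R e, 0) q))\<^sup>2 = s\<^sup>2 + 2 * s * c_re e (fst q) + (norm (fst q))\<^sup>2" for s and q :: "'c \<times> 'v"
  proof -
    have "polar_ht (s *\<^sub>R e, 0) q = s *\<^sub>R e + c_conj e (fst q)"
      by (simp add: polar_ht_def beta_simps)
    then have "(norm (polar_ht (s *\<^sub>R e, 0) q))\<^sup>2 = s\<^sup>2 + 2 * s * (e \<bullet> c_conj e (fst q)) + (norm (c_conj e (fst q)))\<^sup>2"
      unfolding power2_norm_eq_inner by (simp add: inner_simps inner_commute power2_eq_square)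
    moreover have "e \<bullet> c_conj e (fst q) = c_re e (fst q)"
      by (simp add: c_re_def c_conj_def inner_simps)
    ultimately show ?thesis by simp
  qed
  have main: "t * (norm (polar_ht z p))\<^sup>2 = t' * (norm (polar_ht z p'))\<^sup>2" if z: "z \<in> D_dom e" for z
  proof -
    have "cell_map W Y \<phi> \<psi> t Z X z = cell_map W' Y' \<phi>' \<psi>' t' Z' X' z"
      using fun_cong[OF eq, of z] z by simp
    then have "ht e (cell_map W Y \<phi> \<psi> t Z X z) = ht e (cell_map W' Y' \<phi>' \<psi>' t' Z' X' z)"
      by simp
    then have "ht e z / (t * (norm (polar_ht z p))\<^sup>2) = ht e z / (t' * (norm (polar_ht z p'))\<^sup>2)"
      unfolding ht_cell[OF W aut t Z] ht_cell[OF W' aut' t'0 Z'] p_def p'_def .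
    then show ?thesis
      using z by (simp add: D_iff divide_inverse flip: inverse_mult_distrib)
  qed
  have "t * (s\<^sup>2 + 2 * s * c_re e (fst p) + (norm (fst p))\<^sup>2)
      = t' * (s\<^sup>2 + 2 * s * c_re e (fst p') + (norm (fst p'))\<^sup>2)" if "s > 0" for s
    using main[OF axis_D[OF that]] by (simp add: quad)
  from this[of 1] this[of 2] this[of 3] show "t' = t"
    by (simp add: algebra_simps)
qed

lemma cygan_boundary:
  assumes "ht e p = 0" "0 \<le> ht e z"
  shows "cygan e J z p = sqrt (norm (polar_ht z p))"
proof -
  have "((norm (snd z))\<^sup>2 / 4 + (norm (snd p))\<^sup>2 / 4 + \<bar>ht e z - ht e p\<bar>) *\<^sub>R e
      + c_im e (fst z) - c_im e (fst p) - (1/2) *\<^sub>R beta2 J (snd z) (snd p) = polar_ht z p"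
  proof -
    have "(norm (snd z))\<^sup>2 / 4 + (norm (snd p))\<^sup>2 / 4 + \<bar>ht e z - ht e p\<bar> = c_re e (fst z) + c_re e (fst p)"
      using assms by (simp add: ht_eq)
    then show ?thesis
      by (simp add: polar_ht_def c_conj_def c_im_def algebra_simps)
  qed
  then show ?thesis
    by (simp add: cygan_def case_prod_unfold)
qed

lemma continuous_map_homeo_ext:
  fixes H H' :: "'c \<times> 'v \<Rightarrow> 'c \<times> 'v"
  assumes cont: "continuous_on UNIV H" "continuous_on UNIV H'" and inv: "\<And>z. H' (H z) = z"
    and maps: "\<And>z. 0 \<le> ht e z \<Longrightarrow> 0 \<le> ht e (H z)"
  shows "continuous_map (D_bar_top e) (D_bar_top e) (map_option H)"
proof (rule continuous_map_affine_ext[OF cont(1) _ maps])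
  fix R :: real
  have "compact (H' ` cball 0 R)"
    by (rule compact_continuous_image[OF continuous_on_subset[OF cont(2) subset_UNIV] compact_cball_prod])
  then have "bounded (H' ` cball 0 R)"
    by (rule compact_imp_bounded)
  then obtain b where b: "\<forall>y\<in>H' ` cball 0 R. norm y \<le> b"
    unfolding bounded_iff by blast
  have "norm z \<le> b" if z: "norm (H z) \<le> R" for z
  proof -
    have "H z \<in> cball 0 R"
      using z by simp
    then have "H' (H z) \<in> H' ` cball 0 R"
      by (rule imageI)
    then show ?thesis
      using b unfolding inv by (rule bspec[rotated])
  qed
  then show "\<exists>R'. \<forall>z. norm (H z) \<le> R \<longrightarrow> norm z \<le> R'"
    by blast
qed

lemma continuous_heis: "continuous_on UNIV (heis Z X)"
  using heis_differentiable differentiable_imp_continuous_within continuous_at_imp_continuous_on by blast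

lemma continuous_dil: "continuous_on UNIV (dil t :: 'c \<times> 'v \<Rightarrow> 'c \<times> 'v)"
  unfolding dil_def[abs_def] by (intro continuous_intros)

lemma continuous_aut:
  assumes "module_aut \<phi> \<psi>"
  shows "continuous_on UNIV (aut_act \<phi> \<psi>)"
proof -
  have lin: "linear \<phi>" "linear \<psi>"
    using assms by (simp_all add: module_aut_def orthogonal_transformation_def)
  have b1: "bounded_linear \<phi>"
    by (rule bounded_linear_intro[where K = 1])
      (simp_all add: norm_aut[OF assms] linear_add[OF lin(1)] linear_scale[OF lin(1)])
  have b2: "bounded_linear \<psi>"
    by (rule bounded_linear_intro[where K = 1])
      (simp_all add: norm_aut[OF assms] linear_add[OF lin(2)] linear_scale[OF lin(2)])
  show ?thesis
    unfolding aut_act_def[abs_def]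
    by (rule continuous_on_Pair[OF bounded_linear.continuous_on[OF b1 continuous_on_fst[OF continuous_on_id]]
          bounded_linear.continuous_on[OF b2 continuous_on_snd[OF continuous_on_id]]])
qed

lemma heis_bar: "Z \<in> C_prime e \<Longrightarrow> continuous_map (D_bar_top e) (D_bar_top e) (map_option (heis Z X))"
  by (rule continuous_map_homeo_ext[OF continuous_heis continuous_heis heis_minus(1)]) (simp add: ht_heis)

lemma dil_bar: "0 < t \<Longrightarrow> continuous_map (D_bar_top e) (D_bar_top e) (map_option (dil t :: 'c \<times> 'v \<Rightarrow> 'c \<times> 'v))"
  by (rule continuous_map_homeo_ext[OF continuous_dil continuous_dil dil_inverse(1)]) (simp_all add: ht_dil)

lemma aut_bar:
  assumes aut: "module_aut \<phi> \<psi>"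
  shows "continuous_map (D_bar_top e) (D_bar_top e) (map_option (aut_act \<phi> \<psi>))"
proof -
  obtain \<phi>' \<psi>' where *: "module_aut \<phi>' \<psi>'" "\<forall>z. aut_act \<phi>' \<psi>' (aut_act \<phi> \<psi> z) = z"
    "\<forall>z. aut_act \<phi> \<psi> (aut_act \<phi>' \<psi>' z) = z"
    using module_aut_inverse[OF aut] by blast
  have inv: "aut_act \<phi>' \<psi>' (aut_act \<phi> \<psi> z) = z" for z
    using * by blast
  show ?thesis
    by (rule continuous_map_homeo_ext[OF continuous_aut[OF aut] continuous_aut[OF *(1)] inv])
      (simp add: aut_act_def ht_aut[OF aut])
qed

lemma bar_ext_MAN:
  assumes aut: "module_aut \<phi> \<psi>" and t: "0 < t" and Z: "Z \<in> C_prime e"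
    and g: "\<And>z. z \<in> D_dom e \<Longrightarrow> g z = MAN_map \<phi> \<psi> t Z X z"
  shows "bar_ext e g None = None"
proof -
  define h where "h = map_option (aut_act \<phi> \<psi>) \<circ> (map_option (dil t) \<circ> map_option (heis Z X))"
  have "continuous_map (D_bar_top e) (D_bar_top e) h"
    unfolding h_def
    by (rule continuous_map_compose[OF continuous_map_compose[OF heis_bar[OF Z] dil_bar[OF t]] aut_bar[OF aut]])
  then have "bar_ext e g None = h None"
    by (rule bar_ext_eq) (simp_all add: h_def g MAN_map_eq D_bar_None)
  then show ?thesis
    by (simp add: h_def)
qed

text \<open>
  The inverse of \<open>n\<^sub>1 \<sigma> m a\<^sub>t n\<^sub>2\<close> sends infinity to \<open>n\<^sub>2\<^sup>-\<^sup>1 0\<close>, since \<open>n\<^sub>1\<close> fixes infinity, \<open>\<sigma>\<close> moves it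
  to \<open>0\<close>, and \<open>m\<close> and \<open>a\<^sub>t\<close> fix \<open>0\<close>.
\<close>

lemma bar_ext_cell_inverse:
  assumes W: "W \<in> C_prime e" and aut: "module_aut \<phi> \<psi>" and t: "0 < t" and Z: "Z \<in> C_prime e"
    and k: "\<And>z. z \<in> D_dom e \<Longrightarrow> k z \<in> D_dom e"
    and gk: "\<And>z. z \<in> D_dom e \<Longrightarrow> cell_map W Y \<phi> \<psi> t Z X (k z) = z"
  shows "bar_ext e k None = Some (heis (- Z) (- X) 0)"
proof -
  obtain \<phi>' \<psi>' where *: "module_aut \<phi>' \<psi>'" "\<forall>z. aut_act \<phi>' \<psi>' (aut_act \<phi> \<psi> z) = z"
    "\<forall>z. aut_act \<phi> \<psi> (aut_act \<phi>' \<psi>' z) = z"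
    using module_aut_inverse[OF aut] by blast
  define h where "h = map_option (heis (- Z) (- X)) \<circ> (map_option (dil (1 / t)) \<circ> (map_option (aut_act \<phi>' \<psi>') \<circ>
      (geo_bar \<circ> map_option (heis (- W) (- Y)))))"
  have t': "0 < 1 / t"
    using t by simp
  have "continuous_map (D_bar_top e) (D_bar_top e) h"
    unfolding h_def
    by (rule continuous_map_compose[OF continuous_map_compose[OF continuous_map_compose[OF
            continuous_map_compose[OF heis_bar[OF neg_C_prime[OF W]] continuous_map_geo_bar]
            aut_bar[OF *(1)]] dil_bar[OF t']] heis_bar[OF neg_C_prime[OF Z]]])
  moreover have "h (Some z) = Some (k z)" if z: "z \<in> D_dom e" for z
  proof -
    define x where "x = MAN_map \<phi> \<psi> t Z X (k z)"
    have "x \<in> D_dom e"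
      using k[OF z] aut t Z by (simp add: x_def MAN_map_eq aut_act_D dil_D heis_D)
    then have "fst (geo x) \<noteq> 0" "geo (geo x) = x"
      using geo_D fst_D_nonzero geo_geo by blast+
    moreover have "z = heis W Y (geo x)"
      using gk[OF z] by (simp add: cell_map_def x_def)
    then have "heis (- W) (- Y) z = geo x"
      by (simp add: heis_minus)
    moreover have "aut_act \<phi>' \<psi>' x = dil t (heis Z X (k z))"
      using * unfolding x_def MAN_map_eq by blast
    ultimately show ?thesis
      using t by (simp add: h_def geo_bar_def dil_inverse heis_minus)
  qed
  ultimately have "bar_ext e k None = h None"
    by (intro bar_ext_eq) (simp_all add: D_bar_None)
  moreover have "aut_act \<phi>' \<psi>' 0 = 0"
    using norm_aut[OF *(1), of 0] norm_aut(2)[OF *(1), of 0] by (simp add: aut_act_def zero_prod_def)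
  moreover have "dil (1 / t) 0 = 0"
    by (simp add: dil_def prod_eq_iff)
  ultimately show ?thesis
    by (simp add: h_def geo_bar_def)
qed

lemma carrier_G: "carrier (G_grp e J) = D_isometries e J"
  by (simp add: G_grp_def)

lemma one_G: "\<one>\<^bsub>G_grp e J\<^esub> = (\<lambda>z\<in>D_dom e. z)"
  by (simp add: G_grp_def BijGroup_def)

lemma mult_G:
  assumes "g \<in> D_isometries e J" "h \<in> D_isometries e J"
  shows "g \<otimes>\<^bsub>G_grp e J\<^esub> h = compose (D_dom e) g h"
  using assms by (simp add: G_grp_def BijGroup_def D_isometries_def)

lemma inv_G:
  assumes g: "g \<in> D_isometries e J"
  shows "inv\<^bsub>G_grp e J\<^esub> g = restrict (inv_into (D_dom e) g) (D_dom e)"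
proof -
  define k where "k = restrict (inv_into (D_dom e) g) (D_dom e)"
  have k: "k \<in> D_isometries e J"
    unfolding k_def by (rule isometry_inverse[OF g])
  have Bij: "g \<in> Bij (D_dom e)" "bij_betw g (D_dom e) (D_dom e)"
    using g by (simp_all add: D_isometries_def Bij_def)
  have "compose (D_dom e) k g = (\<lambda>z\<in>D_dom e. z)"
    unfolding k_def by (rule Bij_compose_restrict_eq[OF Bij(1)])
  moreover have "compose (D_dom e) g k = (\<lambda>z\<in>D_dom e. z)"
    using Bij(2) by (auto simp: compose_def fun_eq_iff k_def bij_betw_inv_into_right)
  moreover have "y = k" if y: "y \<in> D_isometries e J" "compose (D_dom e) g y = (\<lambda>z\<in>D_dom e. z)" for y
  proof (rule extensionalityI[of _ "D_dom e"])
    show "y \<in> extensional (D_dom e)"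
      using y(1) by (simp add: D_isometries_def Bij_def)
    show "k \<in> extensional (D_dom e)"
      by (simp add: k_def)
    fix z :: "'c \<times> 'v" assume z: "z \<in> D_dom e"
    have yz: "y z \<in> D_dom e"
      using y(1) z Bij_imp_funcset by (auto simp: D_isometries_def)
    have "g (y z) = z"
      using fun_cong[OF y(2), of z] z by (simp add: compose_def)
    then show "y z = k z"
      using Bij(2) yz z by (metis bij_betw_inv_into_left k_def restrict_apply')
  qed
  ultimately show ?thesis
    unfolding m_inv_def k_def[symmetric] carrier_G
    by (intro the_equality) (auto simp: mult_G g k one_G)
qed

text \<open>
  The exterior of the isometric sphere of \<open>g\<close> is the set of points whose height is lowered by \<open>g\<close>: the
  factor between the heights is the fourth power of the quotient of \<open>R(g)\<close> by the Cygan distance from \<open>p = g\<^sup>-\<^sup>1 \<infinity>\<close>.  An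
  element of \<open>MAN\<close> extends continuously by fixing infinity, so \<open>g\<close> lies in the big Bruhat cell.
\<close>

proposition isometric_sphere_heights:
  assumes g: "g \<in> D_isometries e J" and not_inf: "g \<notin> G_inf e J"
  obtains t p where "0 < t" "ht e p = 0"
    and "\<And>z. z \<in> D_dom e \<Longrightarrow> ht e (g z) = ht e z / (t * (norm (polar_ht z p))\<^sup>2)"
    and "\<And>z. z \<in> D_dom e \<Longrightarrow> z \<in> Ext_I e J g \<longleftrightarrow> 1 < t * (norm (polar_ht z p))\<^sup>2"
proof -
  have ext: "g \<in> extensional (D_dom e)" and bij: "bij_betw g (D_dom e) (D_dom e)"
    using g by (auto simp: D_isometries_def Bij_def)
  have "\<not> (\<exists>\<phi> \<psi> t Z X. module_aut \<phi> \<psi> \<and> t > 0 \<and> Z \<in> C_prime e \<and>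
      (\<forall>z\<in>D_dom e. g z = MAN_map \<phi> \<psi> t Z X z))"
  proof
    assume "\<exists>\<phi> \<psi> t Z X. module_aut \<phi> \<psi> \<and> t > 0 \<and> Z \<in> C_prime e \<and>
      (\<forall>z\<in>D_dom e. g z = MAN_map \<phi> \<psi> t Z X z)"
    then have "bar_ext e g None = None"
      using bar_ext_MAN by blast
    then show False
      using not_inf g by (simp add: G_inf_def carrier_G)
  qed
  then obtain W Y \<phi> \<psi> t Z X where aut: "module_aut \<phi> \<psi>" and t: "t > 0" and Z: "Z \<in> C_prime e"
    and W: "W \<in> C_prime e" and gz: "\<And>z. z \<in> D_dom e \<Longrightarrow> g z = cell_map W Y \<phi> \<psi> t Z X z"
    using bruhat[OF g] unfolding cell_map_def by blast
  define p where "p = heis (- Z) (- X) 0"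
  have p: "ht e p = 0"
    by (simp add: p_def ht_heis[OF neg_C_prime[OF Z]]) (simp add: ht_eq c_simps)
  have g_eq: "g = restrict (cell_map W Y \<phi> \<psi> t Z X) (D_dom e)"
    using ext gz by (intro extensionalityI[of _ "D_dom e"]) auto
  have dil: "dilation e J g = t"
    unfolding g_eq by (rule dilation_cell[OF W aut t Z])
  have "bar_ext e (inv\<^bsub>G_grp e J\<^esub> g) None = Some p"
    unfolding p_def
  proof (rule bar_ext_cell_inverse[OF W aut t Z])
    fix z :: "'c \<times> 'v" assume z: "z \<in> D_dom e"
    show k: "(inv\<^bsub>G_grp e J\<^esub> g) z \<in> D_dom e"
      unfolding inv_G[OF g] using z bij by (simp add: bij_betw_def inv_into_into)
    show "cell_map W Y \<phi> \<psi> t Z X ((inv\<^bsub>G_grp e J\<^esub> g) z) = z"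
      using gz[OF k] z bij unfolding inv_G[OF g] by (simp add: bij_betw_inv_into_right)
  qed
  then have centre: "centre e J g = p"
    by (simp add: centre_def)
  have heights: "ht e (g z) = ht e z / (t * (norm (polar_ht z p))\<^sup>2)" if "z \<in> D_dom e" for z
    unfolding gz[OF that] p_def by (rule ht_cell[OF W aut t Z])
  have "z \<in> Ext_I e J g \<longleftrightarrow> 1 < t * (norm (polar_ht z p))\<^sup>2" if z: "z \<in> D_dom e" for z
  proof -
    define n where "n = norm (polar_ht z p)"
    define R where "R = t powr (- 1 / 4)"
    have R0: "R > 0"
      using t by (simp add: R_def)
    have "R ^ 4 = R powr 4"
      using powr_realpow[OF R0, of 4] by simp
    also have "\<dots> = t powr (- 1)"
      by (simp add: R_def powr_powr)
    also have "\<dots> = 1 / t"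
      using t by (simp add: powr_minus_divide)
    finally have R: "R > 0" "R ^ 4 = 1 / t"
      using R0 by simp_all
    have "z \<in> Ext_I e J g \<longleftrightarrow> R < sqrt n"
      using z p by (simp add: Ext_I_def centre cygan_boundary D_iff iso_radius_def dil R_def n_def)
    also have "\<dots> \<longleftrightarrow> R ^ 4 < (sqrt n) ^ 4"
    proof -
      have "(sqrt n) ^ 4 \<le> R ^ 4 \<longleftrightarrow> sqrt n \<le> R"
        using R(1) by (intro power_mono_iff) (auto simp: n_def)
      then show ?thesis
        by linarith
    qed
    also have "(sqrt n) ^ 4 = n\<^sup>2"
    proof -
      have "(sqrt n) ^ 4 = ((sqrt n)\<^sup>2)\<^sup>2"
        by simp
      then show ?thesis
        by (simp add: n_def)
    qed
    also have "R ^ 4 < n\<^sup>2 \<longleftrightarrow> 1 < t * n\<^sup>2"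
      using t by (simp add: R(2) divide_less_eq mult.commute)
    finally show ?thesis
      by (simp add: n_def)
  qed
  then show ?thesis
    using that t p heights by blast
qed

end

section \<open>The fundamental region\<close>

theorem corollary3p20:
  fixes e :: "'c::euclidean_space"
    and J :: "'c \<Rightarrow> 'v::real_inner \<Rightarrow> 'v"
    and \<Gamma> :: "('c \<times> 'v \<Rightarrow> 'c \<times> 'v) set"
  assumes "J2C_module e J"
    and "\<not> ((UNIV :: 'c set) = range (\<lambda>a::real. a *\<^sub>R e) \<and> (UNIV :: 'v set) = {0})"
    and "subgroup \<Gamma> (G_grp e J)"
    and "type_O e J \<Gamma>"
    and "stab_inf e J \<Gamma> = {\<one>\<^bsub>G_grp e J\<^esub>}"
    and "type_F e J (\<Gamma> - stab_inf e J \<Gamma>)"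
  shows "fundamental_region e \<Gamma> (D_dom e \<inter> (\<Inter>g\<in>\<Gamma> - stab_inf e J \<Gamma>. Ext_I e J g))"
proof -
  interpret j2c e J
    by unfold_locales (rule assms(1))
  define D where "D = (D_dom e :: ('c \<times> 'v) set)"
  define F where "F = D \<inter> (\<Inter>g\<in>\<Gamma> - stab_inf e J \<Gamma>. Ext_I e J g)"
  interpret sub: subgroup \<Gamma> "G_grp e J"
    by (rule assms(3))
  have iso: "g \<in> D_isometries e J" if "g \<in> \<Gamma>" for g
    using sub.subset that by (auto simp: carrier_G)
  have gD: "g z \<in> D" if "g \<in> \<Gamma>" "z \<in> D" for g z
    using iso[OF that(1)] that(2) Bij_imp_funcset by (auto simp: D_isometries_def D_def)
  have inv_app: "(inv\<^bsub>G_grp e J\<^esub> h) (h z) = z" "h ((inv\<^bsub>G_grp e J\<^esub> h) z) = z" if "h \<in> \<Gamma>" "z \<in> D" for h z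
  proof -
    have "bij_betw h D D"
      using iso[OF that(1)] by (simp add: D_isometries_def Bij_def D_def)
    then show "(inv\<^bsub>G_grp e J\<^esub> h) (h z) = z" "h ((inv\<^bsub>G_grp e J\<^esub> h) z) = z"
      using gD[OF that] that(2) unfolding inv_G[OF iso[OF that(1)]]
      by (simp_all add: D_def bij_betw_inv_into_left bij_betw_inv_into_right)
  qed
  have index: "\<Gamma> - stab_inf e J \<Gamma> = \<Gamma> - {\<one>\<^bsub>G_grp e J\<^esub>}"
    by (simp add: assms(5))
  have not_inf: "g \<notin> G_inf e J" if "g \<in> \<Gamma>" "g \<noteq> \<one>\<^bsub>G_grp e J\<^esub>" for g
    using that assms(5) by (auto simp: stab_inf_def)
  (* F consists of points that are strictly higher than all other points of their orbit. *)
  have F_heights: "ht e (g z) < ht e z" if z: "z \<in> F" and g: "g \<in> \<Gamma>" "g \<noteq> \<one>\<^bsub>G_grp e J\<^esub>" for g z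
  proof -
    have zD: "z \<in> D_dom e" and zE: "z \<in> Ext_I e J g"
      using z g by (auto simp: F_def D_def index)
    obtain t p where tp: "ht e (g z) = ht e z / (t * (norm (polar_ht z p))\<^sup>2)" "1 < t * (norm (polar_ht z p))\<^sup>2"
      using isometric_sphere_heights[OF iso[OF g(1)] not_inf[OF g]] zD zE by metis
    have "ht e z / (t * (norm (polar_ht z p))\<^sup>2) < ht e z / 1"
      using tp(2) zD by (intro divide_strict_left_mono) (auto simp: D_iff)
    then show ?thesis
      by (simp add: tp(1))
  qed
  (* Moving up increases |polar_ht z p|, because its real part is positive. *)
  have above: "up s z \<in> F" if z: "z \<in> D" and max: "\<And>g. g \<in> \<Gamma> \<Longrightarrow> ht e (g z) \<le> ht e z" and s: "s > 0" for z s
  proof -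
    have zD: "z \<in> D_dom e" and uD: "up s z \<in> D_dom e"
      using z s by (simp_all add: D_def up_D)
    have "up s z \<in> Ext_I e J g" if g: "g \<in> \<Gamma>" "g \<noteq> \<one>\<^bsub>G_grp e J\<^esub>" for g
    proof -
      obtain t p where t: "0 < t" and p: "ht e p = 0" and h: "ht e (g z) = ht e z / (t * (norm (polar_ht z p))\<^sup>2)"
        and E: "up s z \<in> Ext_I e J g \<longleftrightarrow> 1 < t * (norm (polar_ht (up s z) p))\<^sup>2"
        using isometric_sphere_heights[OF iso[OF g(1)] not_inf[OF g]] zD uD by metis
      have hz: "0 < ht e z"
        using zD by (simp add: D_iff)
      have re: "0 < c_re e (polar_ht z p)"
        using hz p by (simp add: re_polar_ht add_pos_nonneg)
      then have "polar_ht z p \<noteq> 0"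
        by (auto simp: c_simps)
      then have n: "0 < t * (norm (polar_ht z p))\<^sup>2"
        using t by simp
      have "ht e z \<le> ht e z * (t * (norm (polar_ht z p))\<^sup>2)"
        using max[OF g(1)] n by (simp add: h divide_le_eq)
      then have "1 \<le> t * (norm (polar_ht z p))\<^sup>2"
        using hz by simp
      also have "\<dots> < t * (norm (polar_ht (up s z) p))\<^sup>2"
      proof -
        have "(norm (polar_ht z p + s *\<^sub>R e))\<^sup>2 = (norm (polar_ht z p))\<^sup>2 + 2 * s * c_re e (polar_ht z p) + s\<^sup>2"
          unfolding power2_norm_eq_inner by (simp add: inner_simps c_re_def inner_commute power2_eq_square)
        moreover have "0 < 2 * s * c_re e (polar_ht z p) + s\<^sup>2"
          using s re by (simp add: add_pos_pos)
        ultimately show ?thesis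
          using t by (simp add: polar_ht_up)
      qed
      finally show ?thesis
        using E by simp
    qed
    then show ?thesis
      using uD by (auto simp: F_def D_def index)
  qed
  have gen: "generate (G_grp e J) (\<Gamma> - stab_inf e J \<Gamma>) = \<Gamma>"
  proof (intro antisym subsetI)
    fix x assume "x \<in> generate (G_grp e J) (\<Gamma> - stab_inf e J \<Gamma>)"
    then show "x \<in> \<Gamma>"
      by (induction rule: generate.induct) (auto intro: sub.one_closed sub.m_inv_closed sub.m_closed)
  next
    fix x assume "x \<in> \<Gamma>"
    then show "x \<in> generate (G_grp e J) (\<Gamma> - stab_inf e J \<Gamma>)"
      unfolding index by (cases "x = \<one>\<^bsub>G_grp e J\<^esub>") (auto intro: generate.one generate.incl)
  qed
  have open_F: "open F"
  proof -
    have "F = D - (top_of_set D closure_of (\<Union>g\<in>\<Gamma> - stab_inf e J \<Gamma>. Int_I e J g))"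
      using assms(4) by (simp add: type_O_def common_exterior_def F_def D_def)
    then have "openin (top_of_set D) F"
      by (metis closedin_closure_of openin_diff openin_topspace topspace_euclidean_subtopology)
    then show ?thesis
      using open_D by (simp add: D_def openin_open_eq)
  qed
  have disjoint: "g ` F \<inter> h ` F = {}" if gh: "g \<in> \<Gamma>" "h \<in> \<Gamma>" "g \<noteq> h" for g h
  proof (rule ccontr)
    assume "g ` F \<inter> h ` F \<noteq> {}"
    then obtain a b where ab: "a \<in> F" "b \<in> F" "g a = h b"
      by blast
    (* If k x = l y with k and l different, then l\<^sup>-\<^sup>1 k is not the identity and moves x to y. *)
    have lower: "ht e y < ht e x" if kl: "k \<in> \<Gamma>" "l \<in> \<Gamma>" "k \<noteq> l" and xy: "x \<in> F" "y \<in> F" "k x = l y" for k l x y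
    proof -
      define m where "m = inv\<^bsub>G_grp e J\<^esub> l \<otimes>\<^bsub>G_grp e J\<^esub> k"
      have m: "m \<in> \<Gamma>"
        using kl by (simp add: m_def sub.m_closed sub.m_inv_closed)
      have m_app: "m z = (inv\<^bsub>G_grp e J\<^esub> l) (k z)" if "z \<in> D" for z
        using that mult_G[OF iso[OF sub.m_inv_closed[OF kl(2)]] iso[OF kl(1)]]
        by (simp add: m_def compose_def D_def)
      have "m \<noteq> \<one>\<^bsub>G_grp e J\<^esub>"
      proof
        assume "m = \<one>\<^bsub>G_grp e J\<^esub>"
        then have "(inv\<^bsub>G_grp e J\<^esub> l) (k z) = z" if "z \<in> D" for z
          using m_app[OF that] that by (simp add: one_G D_def)
        then have "k z = l z" if "z \<in> D" for z
          using inv_app(2)[OF kl(2) gD[OF kl(1) that]] that by simp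
        moreover have "k \<in> extensional D" "l \<in> extensional D"
          using iso kl by (auto simp: D_isometries_def Bij_def D_def)
        ultimately show False
          using kl(3) extensionalityI by blast
      qed
      then have "ht e (m x) < ht e x"
        by (rule F_heights[OF xy(1) m])
      moreover have "m x = y"
        using xy kl by (simp add: m_app inv_app F_def)
      ultimately show ?thesis by simp
    qed
    have "ht e b < ht e a" "ht e a < ht e b"
      using lower[OF gh(1,2,3) ab] lower[OF gh(2,1) gh(3)[symmetric] ab(2,1) ab(3)[symmetric]] by auto
    then show False by simp
  qed
  have cover: "D = (\<Union>g\<in>\<Gamma>. g ` (top_of_set D closure_of F))"
  proof (intro antisym subsetI)
    fix z assume z: "z \<in> D"
    obtain g where g: "g \<in> \<Gamma>" and max: "\<And>h. h \<in> \<Gamma> \<Longrightarrow> ht e (h z) \<le> ht e (g z)"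
      using assms(6) z unfolding type_F_def gen D_def by blast
    define w where "w = g z"
    have w: "w \<in> D"
      unfolding w_def by (rule gD[OF g z])
    have maxw: "ht e (h w) \<le> ht e w" if h: "h \<in> \<Gamma>" for h
      using max[OF sub.m_closed[OF h g]] mult_G[OF iso[OF h] iso[OF g]] z
      by (simp add: w_def compose_def D_def)
    (* w itself may lie on isometric spheres, but the points above it lie in F. *)
    have "w \<in> closure F"
      unfolding closure_approachable
    proof (intro allI impI)
      fix \<epsilon> :: real assume \<epsilon>: "\<epsilon> > 0"
      have "dist (up (\<epsilon> / 2) w) w < \<epsilon>"
        using \<epsilon> by (simp add: up_def dist_norm norm_prod_def minus_prod_def)
      moreover have "up (\<epsilon> / 2) w \<in> F"
        using \<epsilon> by (intro above w maxw) auto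
      ultimately show "\<exists>y\<in>F. dist y w < \<epsilon>"
        by blast
    qed
    then have "w \<in> top_of_set D closure_of F"
      using w by (simp add: closure_of_subtopology F_def Int_absorb1)
    moreover have "z = (inv\<^bsub>G_grp e J\<^esub> g) w"
      using inv_app(1)[OF g z] by (simp add: w_def)
    ultimately show "z \<in> (\<Union>g\<in>\<Gamma>. g ` (top_of_set D closure_of F))"
      using sub.m_inv_closed[OF g] by blast
  next
    fix z assume "z \<in> (\<Union>g\<in>\<Gamma>. g ` (top_of_set D closure_of F))"
    then obtain g w where "g \<in> \<Gamma>" "w \<in> D" "z = g w"
      using closure_of_subset_topspace[of "top_of_set D" F] by auto
    then show "z \<in> D"
      using gD by blast
  qed
  have "F \<subseteq> D"
    by (simp add: F_def)
  then have "fundamental_region e \<Gamma> F"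
    unfolding fundamental_region_def D_def[symmetric] using open_F disjoint cover by blast
  then show ?thesis
    by (simp add: F_def D_def)
qed

end
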